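(* Let $d\in\mathbb{N}$. Let $(U_n)_{n\in\mathbb{Z}_+}$ and $(B_n)_{n\in\mathbb{Z}_+}$ be $\mathbb{R}^d$-valued and $\mathbb{R}^{d\times d}$-valued stochastic processes, respectively, defined on a probability space $(\Omega,\mathcal{F},\mathbb{P})$ and adapted to a filtration $(\mathcal{F}_n)_{n\in\mathbb{Z}_+}$. Suppose that $B_n$ is invertible for all sufficiently large $n\in\mathbb{N}$. Let $(Q_n)_{n\in\mathbb{N}}$ be a (deterministic) sequence in $\mathbb{R}^{d\times d}$ such that $Q_n\to 0$ as $n\to\infty$ and $Q_n$ is invertible for all sufficiently large $n\in\mathbb{N}$. Let $G\in\mathcal{F}_\infty:=\sigma(\bigcup_{k=0}^\infty\mathcal{F}_k)$ with $\mathbb{P}(G)>0$. Assume that: (i) there exists an $\mathbb{R}^{d\times d}$-valued, $\mathcal{F}_\infty$-measurable random matrix $\eta$ such that $\mathbb{P}(G\cap\{\exists\,\eta^{-1}\})>0$ and $Q_nB_n^{-1}\to\eta$ in $\mathbb{P}_G$-probability as $n\to\infty$; (ii) $(Q_nU_n)_{n\in\mathbb{N}}$ is stochastically bounded in $\mathbb{P}_{G\cap\{\exists\,\eta^{-1}\}}$-probability, i.e. $$\lim_{K\to\infty}\sup_{n\in\mathbb{N}}\mathbb{P}_{G\cap\{\exists\,\eta^{-1}\}}(\|Q_nU_n\|>K)=0;$$ (iii) there exists an invertible matrix $P\in\mathbb{R}^{d\times d}$ with $\varrho(P)<1$ such that for each $r\in\mathbb{N}$, $B_nB_{n-r}^{-1}\to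 P^r$ in $\mathbb{P}_G$-probability as $n\to\infty$; (iv) there exists a probability measure $\mu$ on $(\mathbb{R}^d,\mathcal{B}(\mathbb{R}^d))$ with $\int_{\mathbb{R}^d}\log^+(\|x\|)\,\mu(dx)<\infty$ such that for all $\theta\in\mathbb{R}^d$, $$\mathbb{E}_{\mathbb{P}}\bigl(e^{i\langle\theta,B_n\Delta U_n\rangle}\mid\mathcal{F}_{n-1}\bigr)\to\int_{\mathbb{R}^d}e^{i\langle\theta,x\rangle}\,\mu(dx)\quad\text{in }\mathbb{P}_{G\cap\{\exists\,\eta^{-1}\}}\text{-probability as }n\to\infty.$$ Then $$B_nU_n\to\sum_{j=0}^\infty P^jZ_j\quad\mathcal{F}_\infty\text{-mixing under }\mathbb{P}_{G\cap\{\exists\,\eta^{-1}\}}\text{ as }n\to\infty,$$ and $$Q_nU_n\to\eta\sum_{j=0}^\infty P^jZ_j\quad\mathcal{F}_\infty\text{-stably under }\mathbb{P}_{G\cap\{\exists\,\eta^{-1}\}}\text{ as }n\to\infty,$$ where $(Z_j)_{j\in\mathbb{Z}_+}$ denotes a $\mathbb{P}$-independent and identically distributed sequence of $\mathbb{R}^d$-valued random vectors which is $\mathbb{P}$-independent of $\mathcal{F}_\infty$, with $\mathbb{P}(Z_0\in B)=\mu(B)$ for all $B\in\mathcal{B}(\mathbb{R}^d)$.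
   Context: $\mathbb{Z}_+$ is the set of non-negative integers, $\mathbb{N}$ the set of positive integers. $\|\cdot\|$ and $\langle\cdot,\cdot\rangle$ are the Euclidean norm and inner product on $\mathbb{R}^d$; $\varrho(P)$ is the spectral radius of $P$. For $x\ge 0$, $\log^+(x):=\log(x)$ if $x\ge1$ and $0$ if $0\le x<1$. $\Delta U_0:=0$ and $\Delta U_n:=U_n-U_{n-1}$ for $n\in\mathbb{N}$. $\{\exists\,\eta^{-1}\}$ is the event that $\eta$ is invertible. For an event $A$ with $\mathbb{P}(A)>0$, $\mathbb{P}_A(\cdot):=\mathbb{P}(\cdot\cap A)/\mathbb{P}(A)$. Every random variable is defined on a (suitable) probability space $(\Omega,\mathcal{F},\mathbb{P})$; in particular this space is assumed to carry the sequence $(Z_j)_{j\in\mathbb{Z}_+}$. The series $\sum_{j=0}^\infty P^jZ_j$ is $\mathbb{P}$-almost surely absolutely convergent under these hypotheses. Stable and mixing convergence: let $\mathbb{Q}$ be a probability measure on $(\Omega,\mathcal{F})$, $\mathcal{G}\subset\mathcal{F}$ a sub-$\sigma$-field, and $X_n$ ($n\in\mathbb{N}$), $X$ be $\mathbb{R}^d$-valued random variables on $(\Omega,\mathcal{F})$. $X_n\to X$ $\mathcal{G}$-stably under $\mathbb{Q}$ as $n\to\infty$ if $\lim_{n\to\infty}\mathbb{E}_{\mathbb{Q}}(\xi\,\mathbb{E}_{\mathbb{Q}}(h(X_n)\mid\mathcal{G}))=\mathbb{E}_{\mathbb{Q}}(\xi\,\mathbb{E}_{\mathbb{Q}}(h(X)\mid\mathcal{G}))$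 for all random variables $\xi:\Omega\to\mathbb{R}$ with $\mathbb{E}_{\mathbb{Q}}(|\xi|)<\infty$ and all bounded continuous $h:\mathbb{R}^d\to\mathbb{R}$ (equivalently, $\lim_n\mathbb{E}_{\mathbb{Q}}(\xi h(X_n))=\mathbb{E}_{\mathbb{Q}}(\xi h(X))$ for all $\mathcal{G}$-measurable $\mathbb{Q}$-integrable real $\xi$ and all bounded continuous $h$). $X_n\to X$ $\mathcal{G}$-mixing under $\mathbb{Q}$ if $X_n\to X$ $\mathcal{G}$-stably under $\mathbb{Q}$ and $\sigma(X)$ and $\mathcal{G}$ are independent under $\mathbb{Q}$. *)

theory Defs
  imports "HOL-Probability.Probability"
begin

text \<open>
  The power \<open>A ^ n\<close> of the library is taken entrywise on \<^typ>\<open>real^'d^'d\<close>,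
  so powers with respect to the matrix product are defined here.
\<close>

primrec matrix_power :: "real^'d^'d \<Rightarrow> nat \<Rightarrow> real^'d^'d" where
  "matrix_power A 0 = mat 1"
| "matrix_power A (Suc n) = A ** matrix_power A n"

text \<open>The complex eigenvalues of a real matrix.\<close>

definition complex_spectrum :: "real^'d^'d \<Rightarrow> complex set" where
  "complex_spectrum A = {c. \<exists>v::complex^'d. v \<noteq> 0 \<and> map_matrix of_real A *v v = c *s v}"

definition spectral_radius :: "real^'d^'d \<Rightarrow> real" where
  "spectral_radius A = (SUP c \<in> complex_spectrum A. cmod c)"

definition log_plus :: "real \<Rightarrow> real" where
  "log_plus x = (if 1 \<le> x then ln x else 0)"

definition increment :: "(nat \<Rightarrow> 'a \<Rightarrow> 'b::ab_group_add) \<Rightarrow> nat \<Rightarrow> 'a \<Rightarrow> 'b" where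
  "increment U n \<omega> = (if n = 0 then 0 else U n \<omega> - U (n - 1) \<omega>)"

definition sigma_infinity :: "'a measure \<Rightarrow> (nat \<Rightarrow> 'a measure) \<Rightarrow> 'a measure" where
  "sigma_infinity M F = sigma (space M) (\<Union>k. sets (F k))"

definition sigma_gen :: "'a measure \<Rightarrow> ('a \<Rightarrow> 'b::topological_space) \<Rightarrow> 'a set set" where
  "sigma_gen M X = sets (vimage_algebra (space M) X borel)"

definition sigma_gen_seq :: "'a measure \<Rightarrow> (nat \<Rightarrow> 'a \<Rightarrow> 'b::topological_space) \<Rightarrow> 'a set set" where
  "sigma_gen_seq M Z = sigma_sets (space M) (\<Union>j. sigma_gen M (Z j))"

definition complex_cond_exp :: "'a measure \<Rightarrow> 'a measure \<Rightarrow> ('a \<Rightarrow> complex) \<Rightarrow> 'a \<Rightarrow> complex" where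
  "complex_cond_exp M H f \<omega> =
     Complex (real_cond_exp M H (\<lambda>\<omega>. Re (f \<omega>)) \<omega>) (real_cond_exp M H (\<lambda>\<omega>. Im (f \<omega>)) \<omega>)"

definition converges_in_prob ::
  "'a measure \<Rightarrow> (nat \<Rightarrow> 'a \<Rightarrow> 'b::metric_space) \<Rightarrow> ('a \<Rightarrow> 'b) \<Rightarrow> bool" where
  "converges_in_prob N X Y \<longleftrightarrow>
     (\<forall>\<epsilon>>0. (\<lambda>n. measure N {\<omega> \<in> space N. dist (X n \<omega>) (Y \<omega>) > \<epsilon>}) \<longlonglongrightarrow> 0)"

definition stochastically_bounded ::
  "'a measure \<Rightarrow> (nat \<Rightarrow> 'a \<Rightarrow> 'b::real_normed_vector) \<Rightarrow> bool" where
  "stochastically_bounded N X \<longleftrightarrow>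
     ((\<lambda>K::real. SUP n\<in>{1..}. measure N {\<omega> \<in> space N. norm (X n \<omega>) > K}) \<longlongrightarrow> 0) at_top"

text \<open>
  The first three conjuncts are the standing assumptions under which the two notions of
  convergence are considered; \<open>N\<close> is the probability measure and \<open>H\<close> the sub-\<open>\<sigma>\<close>-field.
  The random variables \<open>\<xi>\<close> are measurable with respect to the full \<open>\<sigma>\<close>-field.
\<close>

definition converges_stably ::
  "'a measure \<Rightarrow> 'a measure \<Rightarrow> (nat \<Rightarrow> 'a \<Rightarrow> 'b::euclidean_space) \<Rightarrow> ('a \<Rightarrow> 'b) \<Rightarrow> bool" where
  "converges_stably N H X Y \<longleftrightarrow>
     subalgebra N H \<and> (\<forall>n. X n \<in> borel_measurable N) \<and> Y \<in> borel_measurable N \<and>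
     (\<forall>\<xi>::'a \<Rightarrow> real. \<forall>h::'b \<Rightarrow> real.
        integrable N \<xi> \<longrightarrow> continuous_on UNIV h \<longrightarrow> bounded (range h) \<longrightarrow>
        (\<lambda>n. \<integral>\<omega>. \<xi> \<omega> * real_cond_exp N H (\<lambda>\<omega>. h (X n \<omega>)) \<omega> \<partial>N)
          \<longlonglongrightarrow> (\<integral>\<omega>. \<xi> \<omega> * real_cond_exp N H (\<lambda>\<omega>. h (Y \<omega>)) \<omega> \<partial>N))"

definition converges_mixing ::
  "'a measure \<Rightarrow> 'a measure \<Rightarrow> (nat \<Rightarrow> 'a \<Rightarrow> 'b::euclidean_space) \<Rightarrow> ('a \<Rightarrow> 'b) \<Rightarrow> bool" where
  "converges_mixing N H X Y \<longleftrightarrow>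
     converges_stably N H X Y \<and> prob_space.indep_set N (sigma_gen N Y) (sets H)"

end

theory Submission
  imports Defs "HOL-Complex_Analysis.Laurent_Convergence"
begin

text \<open>
  With \<open>X\<^sub>n = B\<^sub>n U\<^sub>n\<close> and \<open>W\<^sub>n = B\<^sub>n \<Delta>U\<^sub>n\<close> one has
  \<open>X\<^sub>n = W\<^sub>n + (B\<^sub>n B\<^sub>n\<^sub>-\<^sub>1\<^sup>-\<^sup>1) X\<^sub>n\<^sub>-\<^sub>1\<close>, and \<open>X\<^sub>n\<close> is tight because
  \<open>Q\<^sub>n U\<^sub>n = (Q\<^sub>n B\<^sub>n\<^sup>-\<^sup>1) X\<^sub>n\<close> is tight and \<open>Q\<^sub>n B\<^sub>n\<^sup>-\<^sup>1\<close> tends to the invertible \<open>\<eta>\<close>.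
  Hence \<open>X\<^sub>n = W\<^sub>n + P X\<^sub>n\<^sub>-\<^sub>1\<close> up to a null sequence, and the weighted characteristic functions
  \<open>\<psi>\<^sub>n(\<theta>) = E (\<xi> exp (i \<theta> \<bullet> X\<^sub>n))\<close>, for \<open>F\<^sub>\<infinity>\<close>-measurable \<open>\<xi>\<close>, satisfy
  \<open>\<psi>\<^sub>n(\<theta>) = \<phi>(\<theta>) \<psi>\<^sub>n\<^sub>-\<^sub>1(P\<^sup>T \<theta>) + o(1)\<close>, \<open>\<phi>\<close> being the characteristic function of \<open>\<mu>\<close>.
  Iterating \<open>r\<close> times and using that \<open>\<psi>\<^sub>n\<close> is near \<open>E \<xi>\<close> at small arguments, uniformly in large
  \<open>n\<close> by tightness, identifies the limit as \<open>E \<xi>\<close> times the infinite product of the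
  \<open>\<phi>((P\<^sup>j)\<^sup>T \<theta>)\<close>, the characteristic function of \<open>\<Sum>\<^sub>j P\<^sup>j Z\<^sub>j\<close>. For \<open>Q\<^sub>n U\<^sub>n\<close> the same
  argument runs in the random, \<open>F\<^sub>\<infinity>\<close>-measurable direction \<open>\<eta>\<^sup>T \<theta>\<close>.
\<close>

subsection \<open>Matrices\<close>

no_notation fps_nth (infixl "$" 75)

text \<open>The obstacle in the recursion is that \<open>iv\<close> conditions on
  \<open>F (n - 1)\<close>, while the weight \<xi> is only \<open>Finf\<close>-measurable and cannot
  be pulled out of that conditional expectation. Indicators of sets in \<open>F k\<close> can be
  pulled out once n has passed k, and then the error is exactly 0; a monotone class argument with L1
  limits extends this, as a limit statement, to all integrable \<open>Finf\<close>-measurable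
  weights. The same device handles the event \<open>A\<close>: conditional expectations are taken
  under \<open>M\<close> but convergence is under the measure conditioned on \<open>A\<close>, and
  since \<open>A\<close> lies in \<open>Finf\<close>, the density is absorbed into the weight. The
  recursion keeps \<phi> as a factor and never divides by it, since \<phi> may have zeros. Weights
  may be signed, so passing from characteristic functions to bounded continuous test functions is
  not a statement about laws; it rests on trigonometric polynomials that are close on a ball and
  bounded everywhere, tightness controlling the complement. \<open>B n\<close> is invertible only
  from a random index on, so every algebraic identity is used off events whose probability tends to
  0.\<close>

lemma norm_matrix_vector_mult_le:
  fixes A :: "('a::real_normed_field)^'n^'m" and x :: "'a^'n"
  shows "norm (A *v x) \<le> norm A * norm x"
proof -
  have "norm ((A *v x) $ i) \<le> norm (A $ i) * norm x" for i
  proof -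
    have "norm ((A *v x) $ i) \<le> (\<Sum>j\<in>UNIV. norm (A $ i $ j * x $ j))"
      unfolding matrix_vector_mult_def by (simp add: norm_sum)
    also have "\<dots> = (\<Sum>j\<in>UNIV. \<bar>norm (A $ i $ j)\<bar> * \<bar>norm (x $ j)\<bar>)"
      by (simp add: norm_mult)
    also have "\<dots> \<le> norm (A $ i) * norm x"
      unfolding norm_vec_def by (rule L2_set_mult_ineq)
    finally show ?thesis .
  qed
  then have "norm (A *v x) \<le> L2_set (\<lambda>i. norm (A $ i) * norm x) UNIV"
    unfolding norm_vec_def[of "A *v x"] by (intro L2_set_mono) auto
  also have "\<dots> = norm A * norm x"
    by (simp add: norm_vec_def[of A] L2_set_left_distrib)
  finally show ?thesis .
qed

lemma continuous_on_matrix_vector_mult [continuous_intros]: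
  fixes f :: "'a::topological_space \<Rightarrow> real^'n^'m"
  assumes "continuous_on S f" "continuous_on S g"
  shows "continuous_on S (\<lambda>x. f x *v g x)"
  unfolding matrix_vector_mult_def
  using assms by (intro continuous_on_vec_lambda continuous_intros) auto

lemma continuous_on_matrix_matrix_mult [continuous_intros]:
  fixes f :: "'a::topological_space \<Rightarrow> real^'n^'m" and g :: "'a \<Rightarrow> real^'k^'n"
  assumes "continuous_on S f" "continuous_on S g"
  shows "continuous_on S (\<lambda>x. f x ** g x)"
  unfolding matrix_matrix_mult_def
  using assms by (intro continuous_on_vec_lambda continuous_intros) auto

lemma borel_measurable_matrix_vector_mult [measurable (raw)]:
  fixes f :: "'a \<Rightarrow> real^'n^'m"
  assumes "f \<in> borel_measurable M" "g \<in> borel_measurable M"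
  shows "(\<lambda>x. f x *v g x) \<in> borel_measurable M"
  by (rule borel_measurable_continuous_Pair[OF assms]) (intro continuous_intros)

lemma borel_measurable_matrix_matrix_mult [measurable (raw)]:
  fixes f :: "'a \<Rightarrow> real^'n^'m" and g :: "'a \<Rightarrow> real^'k^'n"
  assumes "f \<in> borel_measurable M" "g \<in> borel_measurable M"
  shows "(\<lambda>x. f x ** g x) \<in> borel_measurable M"
  by (rule borel_measurable_continuous_Pair[OF assms]) (intro continuous_intros)

lemma continuous_on_det [continuous_intros]:
  fixes f :: "'a::topological_space \<Rightarrow> ('b::real_normed_field)^'n^'n"
  assumes "\<And>i j. continuous_on S (\<lambda>x. f x $ i $ j)"
  shows "continuous_on S (\<lambda>x. det (f x))"
  unfolding det_def
  by (intro continuous_on_sum continuous_on_mult continuous_on_const continuous_on_prod assms)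

lemma holomorphic_on_det:
  assumes "\<And>i j. (\<lambda>z. f z $ i $ j) holomorphic_on S"
  shows "(\<lambda>z. det (f z)) holomorphic_on S"
  unfolding det_def
  by (intro holomorphic_on_sum holomorphic_on_mult holomorphic_on_const holomorphic_on_prod assms)

lemma
  fixes A :: "('a::semiring_1)^'n^'m"
  assumes "invertible A"
  shows matrix_inv_right: "A ** matrix_inv A = mat 1"
    and matrix_inv_left: "matrix_inv A ** A = mat 1"
  using someI_ex[OF assms[unfolded invertible_def]] by (auto simp: matrix_inv_def)

text \<open>Column \<open>l\<close> of the inverse solves \<open>A *v x = axis l 1\<close>. The
  formula exhibits the entries as quotients of polynomials in the entries of \<open>A\<close>, from
  which measurability of \<open>matrix_inv\<close> is read off.\<close>

lemma matrix_inv_cramer: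
  fixes A :: "('a::field)^'n^'n"
  assumes "det A \<noteq> 0"
  shows "matrix_inv A $ k $ l = det (\<chi> i j. if j = k then axis l 1 $ i else A $ i $ j) / det A"
proof -
  have inv: "invertible A"
    using assms by (simp add: invertible_det_nz)
  have "A *v (matrix_inv A *v axis l 1) = axis l 1"
    by (simp add: matrix_vector_mul_assoc matrix_inv_right[OF inv])
  then have "matrix_inv A *v axis l 1 =
      (\<chi> k. det (\<chi> i j. if j = k then axis l 1 $ i else A $ i $ j) / det A)"
    using cramer[OF assms] by blast
  then have "(matrix_inv A *v axis l 1) $ k =
      det (\<chi> i j. if j = k then axis l 1 $ i else A $ i $ j) / det A"
    by simp
  then show ?thesis
    by (simp add: matrix_vector_mult_def axis_def if_distrib cong: if_cong)
qed

lemma borel_measurable_matrix_inv [measurable]: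
  "(matrix_inv :: real^'n^'n \<Rightarrow> real^'n^'n) \<in> borel_measurable borel"
proof -
  \<comment> \<open>For a singular matrix the condition under the choice operator is unsatisfiable,
    so \<open>matrix_inv\<close> has this one default value on the whole set
    \<open>det A = 0\<close>.\<close>
  define c :: "real^'n^'n" where "c = (SOME _. False)"
  have noninv: "matrix_inv A = c" if "det A = 0" for A :: "real^'n^'n"
    using that unfolding c_def matrix_inv_def
    by (metis invertible_def invertible_det_nz)
  have comp: "(\<lambda>A::real^'n^'n. matrix_inv A $ k $ l) \<in> borel_measurable borel" for k l
  proof -
    have [measurable]: "(det :: real^'n^'n \<Rightarrow> real) \<in> borel_measurable borel"
      by (intro borel_measurable_continuous_onI continuous_intros)
    have "continuous_on UNIV (\<lambda>A::real^'n^'n. if j = k then axis l 1 $ i else A $ i $ j)" for i j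
      by (cases "j = k") (auto intro!: continuous_intros)
    then have [measurable]: "(\<lambda>A::real^'n^'n. det (\<chi> i j. if j = k then axis l 1 $ i else A $ i $ j))
        \<in> borel_measurable borel"
      by (intro borel_measurable_continuous_onI continuous_on_det) simp
    have "(\<lambda>A::real^'n^'n. matrix_inv A $ k $ l) =
        (\<lambda>A. if det A = 0 then c $ k $ l
             else det (\<chi> i j. if j = k then axis l 1 $ i else A $ i $ j) / det A)"
      by (auto simp: fun_eq_iff noninv matrix_inv_cramer)
    then show ?thesis
      by simp
  qed
  show ?thesis
    unfolding borel_measurable_euclidean_space[of matrix_inv]
    using comp by (auto simp: Basis_vec_def inner_axis)
qed

text \<open>Eigenvalue moduli are at most the entrywise Euclidean norm of the matrix. Boundedness is
  what makes the \<open>SUP\<close> in \<open>spectral_radius\<close> an upper bound of the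
  spectrum.\<close>

lemma complex_spectrum_bdd: "bdd_above (cmod ` complex_spectrum A)"
proof (rule bdd_aboveI)
  fix r assume "r \<in> cmod ` complex_spectrum A"
  then obtain c v where c: "r = cmod c" "v \<noteq> 0" "map_matrix of_real A *v v = c *s v"
    by (auto simp: complex_spectrum_def)
  have "norm (c *s v) = cmod c * norm v"
    by (simp add: norm_vec_def norm_mult L2_set_right_distrib)
  then have "cmod c * norm v \<le> norm (map_matrix complex_of_real A) * norm v"
    using norm_matrix_vector_mult_le[of "map_matrix complex_of_real A" v] c by simp
  then show "r \<le> norm (map_matrix complex_of_real A)"
    using c by simp
qed

text \<open>A kernel vector of \<open>1 - z A\<close> would be an eigenvector for
  \<open>1 / z\<close>, whose modulus exceeds \<open>t\<close> and hence the spectral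
  radius.\<close>

lemma det_resolvent_nonzero:
  assumes "spectral_radius A < t" "0 < t" "cmod z < 1 / t"
  shows "det (\<chi> i j. (if i = j then 1 else 0) - z * of_real (A $ i $ j)) \<noteq> 0" (is "det ?D \<noteq> 0")
proof
  assume "det ?D = 0"
  then have "\<not> (\<exists>B. B ** ?D = mat 1)"
    unfolding invertible_left_inverse[symmetric] by (simp add: invertible_det_nz)
  then obtain v where v: "v \<noteq> 0" "?D *v v = 0"
    unfolding matrix_left_invertible_ker by blast
  define w where "w = map_matrix complex_of_real A *v v"
  have eq: "v $ i = z * w $ i" for i
  proof -
    have "0 = (?D *v v) $ i" unfolding v(2) by simp
    also have "\<dots> = (\<Sum>j\<in>UNIV. (if i = j then v $ j else 0) - z * (of_real (A $ i $ j) * v $ j))"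
      unfolding matrix_vector_mult_def
      by (auto intro!: sum.cong simp: algebra_simps)
    also have "\<dots> = v $ i - z * w $ i"
      unfolding w_def matrix_vector_mult_def map_matrix_def
      by (simp add: sum_subtractf sum_distrib_left)
    finally show ?thesis by simp
  qed
  have "z \<noteq> 0"
    using v eq by (auto simp: vec_eq_iff)
  then have "w = (1 / z) *s v"
    using eq by (simp add: vec_eq_iff)
  then have "1 / z \<in> complex_spectrum A"
    using v by (auto simp: complex_spectrum_def w_def)
  then have "cmod (1 / z) \<le> spectral_radius A"
    unfolding spectral_radius_def by (intro cSUP_upper complex_spectrum_bdd)
  moreover have "t < cmod (1 / z)"
    using assms \<open>z \<noteq> 0\<close> by (simp add: norm_divide field_simps)
  ultimately show False
    using assms by simp
qed

text \<open>
  The entries of \<open>(1 - z A)\<^sup>-\<^sup>1\<close> are rational by Cramer's rule, with no pole in a disc of radius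
  exceeding 1, and their Taylor coefficients are the entries of the powers of \<open>A\<close>.
\<close>

lemma matrix_power_entry_decay:
  assumes "spectral_radius A < t" "0 < t" "0 < s" "s < 1 / t"
  shows "\<exists>C. \<forall>n. \<bar>matrix_power A n $ k $ l\<bar> * s ^ n \<le> C"
proof -
  define D where "D z = (\<chi> i j. (if i = j then 1 else 0) - z * complex_of_real (A $ i $ j))" for z
  \<comment> \<open>By Cramer's rule \<open>x k z\<close> is entry (k, l) of the inverse of
    \<open>D z\<close>, which is \<open>1 - z A\<close>.\<close>
  define x where "x k z = det (\<chi> i j. if j = k then axis l 1 $ i else D z $ i $ j) / det (D z)" for k z
  have Dnz: "det (D z) \<noteq> 0" if "z \<in> ball 0 (1 / t)" for z
    using det_resolvent_nonzero[OF assms(1,2), of z] that by (simp add: D_def)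
  have hol: "x k holomorphic_on ball 0 (1 / t)" for k
  proof -
    have "(\<lambda>z. if j = k then axis l 1 $ i else D z $ i $ j) holomorphic_on ball 0 (1 / t)" for i j
      by (cases "j = k") (auto simp: D_def intro!: holomorphic_intros)
    then show ?thesis
      unfolding x_def using Dnz
      by (intro holomorphic_on_divide holomorphic_on_det)
        (auto simp: D_def intro!: holomorphic_intros)
  qed
  have sol: "x k z = (if k = l then 1 else 0) + z * (\<Sum>m\<in>UNIV. of_real (A $ k $ m) * x m z)"
    if "z \<in> ball 0 (1 / t)" for k z
  proof -
    have "D z *v (\<chi> k. x k z) = axis l 1"
      using cramer[OF Dnz[OF that], of "\<chi> k. x k z" "axis l 1"] by (simp add: x_def)
    then have "(D z *v (\<chi> k. x k z)) $ k = axis l 1 $ k" by simp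
    moreover have "(D z *v (\<chi> k. x k z)) $ k =
        (\<Sum>j\<in>UNIV. (if k = j then x j z else 0) - z * (of_real (A $ k $ j) * x j z))"
      unfolding matrix_vector_mult_def D_def by (auto intro!: sum.cong simp: algebra_simps)
    moreover have "\<dots> = x k z - z * (\<Sum>j\<in>UNIV. of_real (A $ k $ j) * x j z)"
      by (simp add: sum_subtractf sum_distrib_left)
    ultimately show ?thesis
      by (auto simp: axis_def diff_eq_eq split: if_splits)
  qed
  define X where "X k = fps_expansion (x k) 0" for k
  have open0: "\<forall>\<^sub>F z in nhds 0. z \<in> ball (0::complex) (1 / t)"
    using assms by (intro eventually_nhds_in_open) auto
  have exp: "x k has_fps_expansion X k" for k
    unfolding X_def using hol[of k] assms
    by (intro has_fps_expansion_fps_expansion[of "ball 0 (1 / t)"]) auto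
  \<comment> \<open>The equation x = e_l + z A x, read on power series: comparing coefficients gives
    the recursion that defines \<open>matrix_power\<close>.\<close>
  have X_eq: "X k = fps_const (if k = l then 1 else 0)
      + fps_X * (\<Sum>m\<in>UNIV. fps_const (of_real (A $ k $ m)) * X m)" (is "_ = ?R") for k
  proof -
    have "(\<lambda>z. (if k = l then 1 else 0) + z * (\<Sum>m\<in>UNIV. of_real (A $ k $ m) * x m z))
        has_fps_expansion ?R"
      by (intro fps_expansion_intros exp)
    moreover have "\<forall>\<^sub>F z in nhds 0. x k z =
        (if k = l then 1 else 0) + z * (\<Sum>m\<in>UNIV. of_real (A $ k $ m) * x m z)"
      using open0 by eventually_elim (rule sol)
    ultimately have "x k has_fps_expansion ?R"
      by (subst has_fps_expansion_cong[OF _ refl]) auto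
    with exp[of k] show ?thesis
      by (rule fps_expansion_unique_complex)
  qed
  have coeff: "fps_nth (X k) n = of_real (matrix_power A n $ k $ l)" for k n
  proof (induction n arbitrary: k)
    case 0
    show ?case by (subst X_eq) (simp add: mat_def)
  next
    case (Suc n)
    show ?case
      by (subst X_eq) (simp add: fps_sum_nth Suc matrix_matrix_mult_def)
  qed
  have "fps_conv_radius (X k) \<ge> ereal (1 / t)"
    unfolding X_def using assms hol
    by (intro conv_radius_fps_expansion) simp
  \<comment> \<open>\<open>s\<close> lies inside the disc of convergence, so the terms at
    \<open>s\<close> tend to 0 and in particular stay bounded.\<close>
  then have "ereal (norm (complex_of_real s)) < fps_conv_radius (X k)"
    using assms by (elim less_le_trans[rotated]) simp
  then have "summable (\<lambda>n. fps_nth (X k) n * complex_of_real s ^ n)"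
    by (rule summable_fps)
  then have "Bseq (\<lambda>n. fps_nth (X k) n * complex_of_real s ^ n)"
    by (intro convergent_imp_Bseq convergentI[of _ 0] summable_LIMSEQ_zero)
  then obtain C where C: "norm (fps_nth (X k) n * complex_of_real s ^ n) \<le> C" for n
    unfolding Bseq_def by blast
  have "\<bar>matrix_power A n $ k $ l\<bar> * s ^ n \<le> C" for n
    using C[of n] assms by (simp add: coeff norm_mult norm_power)
  then show ?thesis
    by blast
qed

lemma matrix_power_decay:
  assumes "spectral_radius A < 1"
  obtains C t where "0 < t" "t < 1" "\<And>n. norm (matrix_power A n) \<le> C * t ^ n"
proof -
  \<comment> \<open>\<open>t\<close> lies strictly between the spectral radius and 1, and
    \<open>s\<close> is the midpoint of 1 and \<open>1 / t\<close>; the rate returned is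
    \<open>1 / s\<close>. The \<open>max\<close> keeps \<open>t\<close> positive and spares a proof
    that the spectrum is nonempty.\<close>
  define t where "t = (1 + max 0 (spectral_radius A)) / 2"
  define s where "s = (1 + 1 / t) / 2"
  have t: "spectral_radius A < t" "0 < t" "t < 1"
    using assms by (auto simp: t_def max_def)
  define u where "u = 1 / t"
  have "1 < u" using t by (simp add: u_def)
  then have s: "1 < s" "s < 1 / t"
    unfolding s_def u_def[symmetric] by auto
  have "\<exists>C. \<forall>n. \<bar>matrix_power A n $ k $ l\<bar> * s ^ n \<le> C" for k l
    using matrix_power_entry_decay[OF t(1,2)] s by auto
  then obtain C where C: "\<bar>matrix_power A n $ k $ l\<bar> * s ^ n \<le> C k l" for n k l
    by metis
  have "norm (matrix_power A n) \<le> (\<Sum>k\<in>UNIV. \<Sum>l\<in>UNIV. C k l) * (1 / s) ^ n" for n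
  proof -
    have "norm (matrix_power A n) \<le> (\<Sum>k\<in>UNIV. norm (matrix_power A n $ k))"
      unfolding norm_vec_def by (rule L2_set_le_sum) simp
    also have "\<dots> \<le> (\<Sum>k\<in>UNIV. \<Sum>l\<in>UNIV. \<bar>matrix_power A n $ k $ l\<bar>)"
      by (intro sum_mono norm_le_l1_cart)
    also have "\<dots> \<le> (\<Sum>k\<in>UNIV. \<Sum>l\<in>UNIV. C k l * (1 / s) ^ n)"
      using C s by (intro sum_mono) (simp add: field_simps)
    finally show ?thesis
      by (simp add: sum_distrib_right)
  qed
  then show ?thesis
    using s that[of "1 / s"] by auto
qed

subsection \<open>Approximation by trigonometric polynomials\<close>

text \<open>The phase \<open>c\<close> lets cosines alone produce sines and constants. Closure under
  products is derived from the product-to-sum formula.\<close>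

inductive trig_poly :: "('a::real_inner \<Rightarrow> real) \<Rightarrow> bool" where
  wave: "trig_poly (\<lambda>x. a * cos (\<theta> \<bullet> x + c))"
| add: "trig_poly f \<Longrightarrow> trig_poly g \<Longrightarrow> trig_poly (\<lambda>x. f x + g x)"

lemma trig_poly_cong: "trig_poly f \<Longrightarrow> (\<And>x. g x = f x) \<Longrightarrow> trig_poly g"
  by (metis ext)

lemma trig_poly_const: "trig_poly (\<lambda>_. a)"
  using wave[of a 0 0] by simp

lemma trig_poly_sum: "(\<And>i. i \<in> I \<Longrightarrow> trig_poly (f i)) \<Longrightarrow> trig_poly (\<lambda>x. \<Sum>i\<in>I. f i x)"
  by (induction I rule: infinite_finite_induct) (auto intro: trig_poly_const trig_poly.add)

lemma trig_poly_mult_wave: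
  "trig_poly f \<Longrightarrow> trig_poly (\<lambda>x. a * cos (\<theta> \<bullet> x + c) * f x)"
proof (induction rule: trig_poly.induct)
  case (wave b \<eta> d)
  have "a * cos (\<theta> \<bullet> x + c) * (b * cos (\<eta> \<bullet> x + d)) =
      (a * b / 2) * cos ((\<theta> - \<eta>) \<bullet> x + (c - d)) + (a * b / 2) * cos ((\<theta> + \<eta>) \<bullet> x + (c + d))" for x
    using cos_times_cos[of "\<theta> \<bullet> x + c" "\<eta> \<bullet> x + d"]
    by (simp add: inner_diff_left inner_add_left algebra_simps) (simp add: field_simps)
  then show ?case
    by (rule trig_poly_cong[OF trig_poly.add[OF trig_poly.wave trig_poly.wave]])
next
  case (add f g)
  then show ?case
    by (simp add: distrib_left trig_poly.add)
qed

lemma trig_poly_mult: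
  "trig_poly f \<Longrightarrow> trig_poly g \<Longrightarrow> trig_poly (\<lambda>x. f x * g x)"
proof (induction rule: trig_poly.induct)
  case (wave a \<theta> c)
  then show ?case by (rule trig_poly_mult_wave)
next
  case (add f f')
  then show ?case
    by (simp add: distrib_right trig_poly.add)
qed

lemma trig_poly_sin: "trig_poly (\<lambda>x. a * sin (\<theta> \<bullet> x))"
  using wave[of a "\<theta>" "- (pi / 2)"] by (simp add: cos_diff)

text \<open>Each coordinate of the substituted vector is a sine wave, and trigonometric polynomials
  form an algebra.\<close>

lemma trig_poly_real_polynomial_function:
  fixes p :: "'a::euclidean_space \<Rightarrow> real"
  assumes "real_polynomial_function p"
  shows "trig_poly (\<lambda>x. p (\<Sum>b\<in>Basis. sin (\<delta> * (x \<bullet> b)) *\<^sub>R b))"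
  using assms
proof (induction rule: real_polynomial_function.induct)
  case (linear f)
  interpret bounded_linear f by fact
  have "f (\<Sum>b\<in>Basis. sin (\<delta> * (x \<bullet> b)) *\<^sub>R b) = (\<Sum>b\<in>Basis. f b * sin ((\<delta> *\<^sub>R b) \<bullet> x))" for x
    by (simp add: sum scaleR mult.commute inner_commute)
  then show ?case
    by (rule trig_poly_cong[OF trig_poly_sum[OF trig_poly_sin]])
qed (simp_all add: trig_poly_const trig_poly.add trig_poly_mult)

text \<open>
  The globally bounded approximation of \<open>h\<close> is obtained by composing a polynomial approximation
  of \<open>v \<mapsto> h (L arcsin v)\<close> on the cube \<open>[-1, 1]\<^sup>d\<close> with \<open>v = sin (x / L)\<close>.
\<close>

lemma trig_poly_approximation:
  fixes h :: "'a::euclidean_space \<Rightarrow> real"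
  assumes h: "continuous_on UNIV h" "\<And>x. \<bar>h x\<bar> \<le> C" and "0 < L" "0 < e"
  obtains g where "trig_poly g" "\<And>x. \<bar>g x\<bar> \<le> C + e" "\<And>x. norm x \<le> L \<Longrightarrow> \<bar>h x - g x\<bar> < e"
proof -
  define H :: "'a \<Rightarrow> real" where "H v = h (\<Sum>b\<in>Basis. (L * arcsin (v \<bullet> b)) *\<^sub>R b)" for v
  define S where "S x = (\<Sum>b\<in>Basis. sin ((1 / L) * (x \<bullet> b)) *\<^sub>R b)" for x :: 'a
  have S_nth: "S x \<bullet> b = sin ((1 / L) * (x \<bullet> b))" if "b \<in> Basis" for b x
    using that by (simp add: S_def inner_sum_left inner_Basis if_distrib cong: if_cong)
  have box: "S x \<in> cbox (- One) One" for x
    by (auto simp: mem_box S_nth)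
  have "continuous_on (cbox (- One) One) (\<lambda>v::'a. \<Sum>b\<in>Basis. (L * arcsin (v \<bullet> b)) *\<^sub>R b)"
    by (intro continuous_intros) (auto simp: mem_box)
  then have "continuous_on (cbox (- One) One) H"
    unfolding H_def by (rule continuous_on_compose2[OF h(1)]) simp
  then obtain p where p: "real_polynomial_function p" "\<And>v. v \<in> cbox (- One) One \<Longrightarrow> \<bar>H v - p v\<bar> < e"
    using Stone_Weierstrass_real_polynomial_function[OF compact_cbox _ \<open>0 < e\<close>] by blast
  \<comment> \<open>The bound is global because \<open>S x\<close> never leaves the cube on which
    \<open>p\<close> is close to \<open>H\<close>, and \<open>H\<close> inherits the bound of
    \<open>h\<close>.\<close>
  have "\<bar>p (S x)\<bar> \<le> C + e" for x
    using p(2)[OF box[of x]] h(2)[of "\<Sum>b\<in>Basis. (L * arcsin (S x \<bullet> b)) *\<^sub>R b"]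
    by (auto simp: H_def)
  moreover have "\<bar>h x - p (S x)\<bar> < e" if "norm x \<le> L" for x
  proof -
    \<comment> \<open>For \<open>norm x \<le> L\<close> the argument of the sine is in [-1, 1],
      hence in [-pi/2, pi/2], where \<open>arcsin\<close> inverts \<open>sin\<close>.\<close>
    have "L * arcsin (S x \<bullet> b) = x \<bullet> b" if b: "b \<in> Basis" for b
    proof -
      have "\<bar>x \<bullet> b\<bar> \<le> L"
        using Basis_le_norm[OF b, of x] \<open>norm x \<le> L\<close> by simp
      then have "\<bar>(1 / L) * (x \<bullet> b)\<bar> \<le> 1"
        using \<open>0 < L\<close> by (simp add: abs_mult)
      then have "- (pi / 2) \<le> (1 / L) * (x \<bullet> b) \<and> (1 / L) * (x \<bullet> b) \<le> pi / 2"
        using pi_ge_two by linarith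
      then show ?thesis
        using \<open>0 < L\<close> b by (simp add: S_nth arcsin_sin)
    qed
    then have "H (S x) = h x"
      unfolding H_def by (simp add: euclidean_representation)
    then show ?thesis
      using p(2)[OF box[of x]] by simp
  qed
  moreover have "trig_poly (\<lambda>x. p (S x))"
    unfolding S_def by (rule trig_poly_real_polynomial_function[OF p(1)])
  ultimately show ?thesis
    using that by blast
qed

subsection \<open>Tightness and convergence in probability\<close>

lemma norm_iexp_diff_le: "cmod (iexp a - iexp b) \<le> \<bar>a - b\<bar>"
proof -
  have "iexp a - iexp b = iexp b * (iexp (a - b) - 1)"
    by (simp add: algebra_simps flip: exp_add)
  then have "cmod (iexp a - iexp b) = cmod (iexp (a - b) - 1)"
    by (simp add: norm_mult)
  also have "\<dots> \<le> \<bar>a - b\<bar>"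
    using iexp_approx1[of "a - b" 0] by simp
  finally show ?thesis .
qed

lemma norm_iexp_diff_le_2: "cmod (iexp a - iexp b) \<le> 2"
  using norm_triangle_ineq4[of "iexp a" "iexp b"] by simp

lemma integrable_scaleR_bounded:
  fixes f :: "'a \<Rightarrow> 'b::{banach, second_countable_topology}"
  assumes "integrable M \<xi>" "f \<in> borel_measurable M" "AE \<omega> in M. norm (f \<omega>) \<le> C"
  shows "integrable M (\<lambda>\<omega>. \<xi> \<omega> *\<^sub>R f \<omega>)"
proof (rule Bochner_Integration.integrable_bound)
  show "integrable M (\<lambda>\<omega>. C * \<xi> \<omega>)" using assms by simp
  show "AE \<omega> in M. norm (\<xi> \<omega> *\<^sub>R f \<omega>) \<le> norm (C * \<xi> \<omega>)"
    using assms(3)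
  proof eventually_elim
    case (elim \<omega>)
    then have "\<bar>\<xi> \<omega>\<bar> * norm (f \<omega>) \<le> \<bar>\<xi> \<omega>\<bar> * \<bar>C\<bar>"
      by (intro mult_left_mono) auto
    then show ?case
      by (simp add: abs_mult mult.commute)
  qed
qed (use assms in measurable)

lemma integrable_weighted_iexp:
  fixes f g :: "'a \<Rightarrow> 'b::euclidean_space"
  assumes "integrable M \<xi>" "f \<in> borel_measurable M" "g \<in> borel_measurable M"
  shows "integrable M (\<lambda>\<omega>. \<xi> \<omega> *\<^sub>R iexp (f \<omega> \<bullet> g \<omega>))"
  using assms by (intro integrable_scaleR_bounded[where C = 1]) auto

lemma norm_weighted_integral_le:
  fixes f :: "'a \<Rightarrow> 'b::{banach, second_countable_topology}"
  assumes "integrable M \<xi>" "f \<in> borel_measurable M"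
    and g: "g \<in> borel_measurable M" "AE \<omega> in M. norm (f \<omega>) \<le> g \<omega>" "AE \<omega> in M. g \<omega> \<le> C"
  shows "norm (\<integral>\<omega>. \<xi> \<omega> *\<^sub>R f \<omega> \<partial>M) \<le> (\<integral>\<omega>. \<bar>\<xi> \<omega>\<bar> * g \<omega> \<partial>M)"
proof -
  have C: "AE \<omega> in M. norm (f \<omega>) \<le> C"
    using g(2,3) by eventually_elim (rule order_trans)
  have 1: "integrable M (\<lambda>\<omega>. \<xi> \<omega> *\<^sub>R f \<omega>)"
    by (rule integrable_scaleR_bounded[OF assms(1,2) C])
  have "AE \<omega> in M. norm (g \<omega>) \<le> C"
    using g(2,3)
  proof eventually_elim
    case (elim \<omega>)
    then show ?case
      using norm_ge_zero[of "f \<omega>"] unfolding real_norm_def by linarith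
  qed
  then have 2: "integrable M (\<lambda>\<omega>. \<bar>\<xi> \<omega>\<bar> * g \<omega>)"
    using integrable_scaleR_bounded[OF integrable_abs[OF assms(1)] g(1)] by simp
  have "AE \<omega> in M. norm (\<xi> \<omega> *\<^sub>R f \<omega>) \<le> \<bar>\<xi> \<omega>\<bar> * g \<omega>"
    using g(2) by eventually_elim (auto intro: mult_left_mono)
  then show ?thesis
    using integral_mono_AE[OF integrable_norm[OF 1] 2] integral_norm_bound[of M "\<lambda>\<omega>. \<xi> \<omega> *\<^sub>R f \<omega>"]
    by simp
qed

lemma integral_tail_tendsto_0:
  assumes "integrable M f"
  shows "(\<lambda>k::nat. \<integral>\<omega>. \<bar>f \<omega>\<bar> * indicator {real k<..} \<bar>f \<omega>\<bar> \<partial>M) \<longlonglongrightarrow> 0"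
proof -
  have [measurable]: "f \<in> borel_measurable M" using assms by auto
  have "(\<lambda>k::nat. \<integral>\<omega>. \<bar>f \<omega>\<bar> * indicator {real k<..} \<bar>f \<omega>\<bar> \<partial>M) \<longlonglongrightarrow> (\<integral>\<omega>. 0 \<partial>M)"
  proof (rule integral_dominated_convergence[where w = "\<lambda>\<omega>. \<bar>f \<omega>\<bar>"])
    show "AE \<omega> in M. (\<lambda>k::nat. \<bar>f \<omega>\<bar> * indicator {real k<..} \<bar>f \<omega>\<bar>) \<longlonglongrightarrow> 0"
    proof (rule AE_I2)
      fix \<omega>
      obtain m :: nat where "\<bar>f \<omega>\<bar> \<le> real m" using real_arch_simple by blast
      then have "\<forall>\<^sub>F k in sequentially. \<bar>f \<omega>\<bar> * indicator {real k<..} \<bar>f \<omega>\<bar> = 0"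
        by (intro eventually_mono[OF eventually_ge_at_top[of m]]) (auto simp: indicator_def)
      then show "(\<lambda>k::nat. \<bar>f \<omega>\<bar> * indicator {real k<..} \<bar>f \<omega>\<bar>) \<longlonglongrightarrow> 0"
        by (rule tendsto_eventually)
    qed
    show "\<And>k::nat. AE \<omega> in M. norm (\<bar>f \<omega>\<bar> * indicator {real k<..} \<bar>f \<omega>\<bar>) \<le> \<bar>f \<omega>\<bar>"
      by (auto simp: indicator_def)
  qed (use assms in auto)
  then show ?thesis by simp
qed

text \<open>Absolute continuity of the integral: truncate at a level \<open>k\<close> whose tail
  integral is below \<open>e / 2\<close>; the truncated part contributes at most \<open>k\<close>
  times the measure of the set.\<close>

lemma (in finite_measure) integral_small_on_small_sets:
  assumes f: "integrable M f" and "0 < (e::real)"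
  shows "\<exists>\<delta>>0. \<forall>S\<in>sets M. measure M S < \<delta> \<longrightarrow> (\<integral>\<omega>. \<bar>f \<omega>\<bar> * indicator S \<omega> \<partial>M) < e"
proof -
  have [measurable]: "f \<in> borel_measurable M" using f by auto
  have "\<forall>\<^sub>F k in sequentially. (\<integral>\<omega>. \<bar>f \<omega>\<bar> * indicator {real k<..} \<bar>f \<omega>\<bar> \<partial>M) < e / 2"
    using integral_tail_tendsto_0[OF f] \<open>0 < e\<close> by (intro order_tendstoD) auto
  then obtain k where k: "(\<integral>\<omega>. \<bar>f \<omega>\<bar> * indicator {real k<..} \<bar>f \<omega>\<bar> \<partial>M) < e / 2"
    by (auto simp: eventually_sequentially)
  show ?thesis
  proof (intro exI[of _ "e / (2 * (real k + 1))"] conjI ballI impI)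
    fix S assume [measurable]: "S \<in> sets M" and S: "measure M S < e / (2 * (real k + 1))"
    have int1: "integrable M (\<lambda>\<omega>. \<bar>f \<omega>\<bar> * indicator {real k<..} \<bar>f \<omega>\<bar>)"
      using integrable_scaleR_bounded[OF integrable_abs[OF f], of "\<lambda>\<omega>. indicator {real k<..} \<bar>f \<omega>\<bar> :: real" 1]
      by (simp add: indicator_def)
    have int2: "integrable M (\<lambda>\<omega>. real k * indicator S \<omega>)"
      by (intro integrable_mult_right) (simp add: less_top[symmetric])
    have int3: "integrable M (\<lambda>\<omega>. \<bar>f \<omega>\<bar> * indicator S \<omega>)"
      using f by (intro integrable_real_mult_indicator) auto
    have "(\<integral>\<omega>. \<bar>f \<omega>\<bar> * indicator S \<omega> \<partial>M) \<le>
        (\<integral>\<omega>. \<bar>f \<omega>\<bar> * indicator {real k<..} \<bar>f \<omega>\<bar> + real k * indicator S \<omega> \<partial>M)"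
      by (intro integral_mono Bochner_Integration.integrable_add int1 int2 int3) (auto simp: indicator_def)
    also have "\<dots> = (\<integral>\<omega>. \<bar>f \<omega>\<bar> * indicator {real k<..} \<bar>f \<omega>\<bar> \<partial>M) + real k * measure M S"
      by (subst Bochner_Integration.integral_add[OF int1 int2]) simp
    also have "real k * measure M S \<le> (real k + 1) * measure M S"
      by (intro mult_right_mono) auto
    also have "(real k + 1) * measure M S < e / 2"
      using S by (simp add: field_simps)
    finally show "(\<integral>\<omega>. \<bar>f \<omega>\<bar> * indicator S \<omega> \<partial>M) < e"
      using k by simp
  qed (use \<open>0 < e\<close> in auto)
qed

text \<open>The bound is asked only for large \<open>n\<close>, so that exceptional events which are
  small only in the limit can be discarded.\<close>

definition tight_sequence :: "'a measure \<Rightarrow> (nat \<Rightarrow> 'a \<Rightarrow> 'b::real_normed_vector) \<Rightarrow> bool" where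
  "tight_sequence N X \<longleftrightarrow>
     (\<forall>e>0. \<exists>K. \<forall>\<^sub>F n in sequentially. measure N {\<omega> \<in> space N. K < norm (X n \<omega>)} < e)"

lemma converges_in_prob_0_iff:
  fixes X :: "nat \<Rightarrow> 'a \<Rightarrow> 'b::real_normed_vector"
  shows "converges_in_prob N X (\<lambda>_. 0) \<longleftrightarrow>
     (\<forall>\<epsilon>>0. (\<lambda>n. measure N {\<omega> \<in> space N. \<epsilon> < norm (X n \<omega>)}) \<longlonglongrightarrow> 0)"
  by (simp add: converges_in_prob_def)

lemma tight_sequenceE:
  assumes "tight_sequence N X" "0 < e"
  obtains K where "\<forall>\<^sub>F n in sequentially. measure N {\<omega> \<in> space N. K < norm (X n \<omega>)} < e"
  using assms unfolding tight_sequence_def by blast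

lemma (in finite_measure) tight_sequence_posE:
  fixes X :: "nat \<Rightarrow> 'a \<Rightarrow> 'b::euclidean_space"
  assumes X: "tight_sequence M X" "\<And>n. X n \<in> borel_measurable M" and "0 < e"
  obtains K where "0 < K" "\<forall>\<^sub>F n in sequentially. measure M {\<omega> \<in> space M. K < norm (X n \<omega>)} < e"
proof -
  note [measurable] = X(2)
  obtain K where K: "\<forall>\<^sub>F n in sequentially. measure M {\<omega> \<in> space M. K < norm (X n \<omega>)} < e"
    using X(1) \<open>0 < e\<close> by (rule tight_sequenceE)
  have "measure M {\<omega> \<in> space M. max K 1 < norm (X n \<omega>)} \<le> measure M {\<omega> \<in> space M. K < norm (X n \<omega>)}" for n
    by (rule finite_measure_mono) auto
  then have "\<forall>\<^sub>F n in sequentially. measure M {\<omega> \<in> space M. max K 1 < norm (X n \<omega>)} < e"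
    using K by (auto elim!: eventually_mono intro: le_less_trans)
  then show ?thesis
    using that[of "max K 1"] by simp
qed

text \<open>Continuity from above along sets decreasing to the empty set. It lets a single variable,
  such as the limit or the inverse of \<eta>, enter the lemmas on tight sequences.\<close>

lemma (in finite_measure) tight_sequence_const:
  fixes Y :: "'a \<Rightarrow> 'b::euclidean_space"
  assumes [measurable]: "Y \<in> borel_measurable M"
  shows "tight_sequence M (\<lambda>_. Y)"
  unfolding tight_sequence_def
proof (intro allI impI)
  fix e :: real assume "0 < e"
  have "(\<lambda>k::nat. measure M {\<omega> \<in> space M. real k < norm (Y \<omega>)}) \<longlonglongrightarrow>
      measure M (\<Inter>k::nat. {\<omega> \<in> space M. real k < norm (Y \<omega>)})"
    by (rule finite_Lim_measure_decseq) (auto simp: decseq_def)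
  moreover have "(\<Inter>k::nat. {\<omega> \<in> space M. real k < norm (Y \<omega>)}) = {}"
  proof (intro equalityI subsetI)
    fix \<omega> assume *: "\<omega> \<in> (\<Inter>k::nat. {\<omega> \<in> space M. real k < norm (Y \<omega>)})"
    obtain k :: nat where "norm (Y \<omega>) \<le> real k"
      using real_arch_simple by blast
    with * show "\<omega> \<in> {}"
      by (auto dest: spec[of _ k])
  qed simp
  ultimately have "\<forall>\<^sub>F k in sequentially. measure M {\<omega> \<in> space M. real k < norm (Y \<omega>)} < e"
    using \<open>0 < e\<close> by (intro order_tendstoD) auto
  then obtain k :: nat where "measure M {\<omega> \<in> space M. real k < norm (Y \<omega>)} < e"
    by (auto simp: eventually_sequentially)
  then show "\<exists>K. \<forall>\<^sub>F n in sequentially. measure M {\<omega> \<in> space M. K < norm (Y \<omega>)} < e"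
    by (intro exI[of _ "real k"]) simp
qed

text \<open>Absolute continuity of the integral of \<open>\<bar>\<xi>\<bar>\<close> carries
  tightness over to the finite measure with that density.\<close>

lemma (in finite_measure) tight_sequence_weighted:
  fixes X :: "nat \<Rightarrow> 'a \<Rightarrow> 'b::euclidean_space"
  assumes X: "tight_sequence M X" "\<And>n. X n \<in> borel_measurable M"
    and \<xi>: "integrable M \<xi>" and "0 < (e::real)"
  obtains K where "0 < K"
    "\<forall>\<^sub>F n in sequentially. (\<integral>\<omega>. \<bar>\<xi> \<omega>\<bar> * indicator {K<..} (norm (X n \<omega>)) \<partial>M) < e"
proof -
  note [measurable] = X(2)
  obtain \<delta> where "0 < \<delta>"
    and \<delta>: "\<And>S. S \<in> sets M \<Longrightarrow> measure M S < \<delta> \<Longrightarrow> (\<integral>\<omega>. \<bar>\<xi> \<omega>\<bar> * indicator S \<omega> \<partial>M) < e"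
    using integral_small_on_small_sets[OF \<xi> \<open>0 < e\<close>] by blast
  obtain K where K: "0 < K"
    "\<forall>\<^sub>F n in sequentially. measure M {\<omega> \<in> space M. K < norm (X n \<omega>)} < \<delta>"
    using tight_sequence_posE[OF X \<open>0 < \<delta>\<close>] .
  have "(\<integral>\<omega>. \<bar>\<xi> \<omega>\<bar> * indicator {K<..} (norm (X n \<omega>)) \<partial>M) =
      (\<integral>\<omega>. \<bar>\<xi> \<omega>\<bar> * indicator {\<omega> \<in> space M. K < norm (X n \<omega>)} \<omega> \<partial>M)" for n
    by (rule Bochner_Integration.integral_cong) (auto simp: indicator_def)
  then show ?thesis
    using K by (intro that[of K]) (auto elim!: eventually_mono intro: \<delta>)
qed

text \<open>Where \<open>norm (D n \<omega>)\<close> is at most \<epsilon>, the integrand is at most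
  \<epsilon> times the weight; the remaining event has small probability, hence small weighted mass,
  and there \<open>D n\<close> is bounded.\<close>

lemma (in finite_measure) converges_in_prob_weighted:
  fixes D :: "nat \<Rightarrow> 'a \<Rightarrow> 'b::euclidean_space"
  assumes D: "converges_in_prob M D (\<lambda>_. 0)" "\<And>n. D n \<in> borel_measurable M"
    "\<And>n. AE \<omega> in M. norm (D n \<omega>) \<le> C"
    and \<xi>: "integrable M \<xi>"
  shows "(\<lambda>n. \<integral>\<omega>. \<bar>\<xi> \<omega>\<bar> * norm (D n \<omega>) \<partial>M) \<longlonglongrightarrow> 0"
proof (rule LIMSEQ_I)
  fix e :: real assume "0 < e"
  note [measurable] = D(2)
  define I where "I = (\<integral>\<omega>. \<bar>\<xi> \<omega>\<bar> \<partial>M)"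
  define c where "c = max C 1"
  define \<epsilon> where "\<epsilon> = e / (2 * (I + 1))"
  have "0 \<le> I" by (simp add: I_def)
  then have "0 < \<epsilon>" using \<open>0 < e\<close> by (simp add: \<epsilon>_def)
  have "0 < c" by (simp add: c_def)
  define S where "S n = {\<omega> \<in> space M. \<epsilon> < norm (D n \<omega>)}" for n
  have S [measurable]: "S n \<in> sets M" for n
    unfolding S_def by measurable
  obtain \<delta> where "0 < \<delta>"
    and \<delta>: "\<And>S. S \<in> sets M \<Longrightarrow> measure M S < \<delta> \<Longrightarrow>
      (\<integral>\<omega>. \<bar>\<xi> \<omega>\<bar> * indicator S \<omega> \<partial>M) < e / (2 * c)"
    using integral_small_on_small_sets[OF \<xi>, of "e / (2 * c)"] \<open>0 < e\<close> \<open>0 < c\<close> by auto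
  have "(\<lambda>n. measure M (S n)) \<longlonglongrightarrow> 0"
    using D(1) \<open>0 < \<epsilon>\<close> unfolding converges_in_prob_0_iff S_def by blast
  then have "\<forall>\<^sub>F n in sequentially. measure M (S n) < \<delta>"
    using \<open>0 < \<delta>\<close> by (intro order_tendstoD)
  then obtain n0 where n0: "\<And>n. n0 \<le> n \<Longrightarrow> measure M (S n) < \<delta>"
    by (auto simp: eventually_sequentially)
  have "(\<integral>\<omega>. \<bar>\<xi> \<omega>\<bar> * norm (D n \<omega>) \<partial>M) < e" if "n0 \<le> n" for n
  proof -
    have int1: "integrable M (\<lambda>\<omega>. \<bar>\<xi> \<omega>\<bar> * norm (D n \<omega>))"
      using integrable_scaleR_bounded[OF integrable_abs[OF \<xi>], of "\<lambda>\<omega>. norm (D n \<omega>)" C] D(3)[of n] by simp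
    have int2: "integrable M (\<lambda>\<omega>. c * (\<bar>\<xi> \<omega>\<bar> * indicator (S n) \<omega>))"
      using \<xi> by (intro integrable_mult_right integrable_real_mult_indicator) auto
    have int3: "integrable M (\<lambda>\<omega>. \<epsilon> * \<bar>\<xi> \<omega>\<bar>)"
      using \<xi> by simp
    have "(\<integral>\<omega>. \<bar>\<xi> \<omega>\<bar> * norm (D n \<omega>) \<partial>M) \<le>
        (\<integral>\<omega>. \<epsilon> * \<bar>\<xi> \<omega>\<bar> + c * (\<bar>\<xi> \<omega>\<bar> * indicator (S n) \<omega>) \<partial>M)"
    proof (intro integral_mono_AE int1 Bochner_Integration.integrable_add int2 int3)
      show "AE \<omega> in M. \<bar>\<xi> \<omega>\<bar> * norm (D n \<omega>) \<le> \<epsilon> * \<bar>\<xi> \<omega>\<bar> + c * (\<bar>\<xi> \<omega>\<bar> * indicator (S n) \<omega>)"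
        using D(3)[of n] AE_space
      proof eventually_elim
        case (elim \<omega>)
        have "norm (D n \<omega>) \<le> \<epsilon> + c * indicator (S n) \<omega>"
          using elim \<open>0 < \<epsilon>\<close> \<open>0 < c\<close> by (auto simp: S_def indicator_def c_def)
        then have "\<bar>\<xi> \<omega>\<bar> * norm (D n \<omega>) \<le> \<bar>\<xi> \<omega>\<bar> * (\<epsilon> + c * indicator (S n) \<omega>)"
          by (rule mult_left_mono) simp
        then show ?case
          by (simp add: algebra_simps)
      qed
    qed
    also have "\<dots> = \<epsilon> * I + c * (\<integral>\<omega>. \<bar>\<xi> \<omega>\<bar> * indicator (S n) \<omega> \<partial>M)"
      unfolding Bochner_Integration.integral_add[OF int3 int2] I_def by simp
    also have "c * (\<integral>\<omega>. \<bar>\<xi> \<omega>\<bar> * indicator (S n) \<omega> \<partial>M) < e / 2"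
      using mult_strict_left_mono[OF \<delta>[OF S n0[OF that]] \<open>0 < c\<close>] \<open>0 < c\<close> by simp
    also have "\<epsilon> * I \<le> e / 2"
      using \<open>0 < e\<close> \<open>0 \<le> I\<close> by (simp add: \<epsilon>_def field_simps)
    finally show ?thesis by simp
  qed
  then show "\<exists>n0. \<forall>n\<ge>n0. norm ((\<integral>\<omega>. \<bar>\<xi> \<omega>\<bar> * norm (D n \<omega>) \<partial>M) - 0) < e"
    by (intro exI[of _ n0]) (simp add: abs_of_nonneg)
qed

text \<open>A null sequence times a tight one is null. The domination may fail on events of
  vanishing probability, which in the application are those where \<open>B n\<close> is
  singular.\<close>

lemma (in finite_measure) converges_in_prob_dominated:
  fixes D :: "nat \<Rightarrow> 'a \<Rightarrow> 'b::euclidean_space"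
    and E :: "nat \<Rightarrow> 'a \<Rightarrow> 'c::euclidean_space"
    and T :: "nat \<Rightarrow> 'a \<Rightarrow> 'd::euclidean_space"
  assumes [measurable]: "\<And>n. D n \<in> borel_measurable M" "\<And>n. E n \<in> borel_measurable M"
      "\<And>n. T n \<in> borel_measurable M"
    and E: "converges_in_prob M E (\<lambda>_. 0)" and T: "tight_sequence M T"
    and bad: "(\<lambda>n. measure M {\<omega> \<in> space M. \<not> norm (D n \<omega>) \<le> c * (norm (E n \<omega>) * norm (T n \<omega>))}) \<longlonglongrightarrow> 0"
  shows "converges_in_prob M D (\<lambda>_. 0)"
  unfolding converges_in_prob_0_iff
proof (intro allI impI)
  fix \<epsilon> :: real assume "0 < \<epsilon>"
  show "(\<lambda>n. measure M {\<omega> \<in> space M. \<epsilon> < norm (D n \<omega>)}) \<longlonglongrightarrow> 0"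
  proof (rule LIMSEQ_I)
    fix \<delta> :: real assume "0 < \<delta>"
    obtain K where K: "0 < K"
      "\<forall>\<^sub>F n in sequentially. measure M {\<omega> \<in> space M. K < norm (T n \<omega>)} < \<delta> / 3"
      using tight_sequence_posE[OF T, of "\<delta> / 3"] \<open>0 < \<delta>\<close> by auto
    \<comment> \<open>\<open>c'\<close> is a positive majorant of \<open>c\<close>, and \<eta> is
      chosen so that \<open>c' * (\<eta> * K)\<close> equals \<epsilon>.\<close>
    define c' where "c' = \<bar>c\<bar> + 1"
    define \<eta> where "\<eta> = \<epsilon> / (c' * K)"
    have "0 < c'" by (simp add: c'_def)
    then have "0 < \<eta>" using K \<open>0 < \<epsilon>\<close> by (simp add: \<eta>_def)
    let ?B = "\<lambda>n. {\<omega> \<in> space M. \<not> norm (D n \<omega>) \<le> c * (norm (E n \<omega>) * norm (T n \<omega>))}"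
    let ?E = "\<lambda>n. {\<omega> \<in> space M. \<eta> < norm (E n \<omega>)}"
    let ?T = "\<lambda>n. {\<omega> \<in> space M. K < norm (T n \<omega>)}"
    have "\<forall>\<^sub>F n in sequentially. measure M (?E n) < \<delta> / 3"
      using E \<open>0 < \<eta>\<close> \<open>0 < \<delta>\<close> unfolding converges_in_prob_0_iff by (intro order_tendstoD) auto
    moreover have "\<forall>\<^sub>F n in sequentially. measure M (?B n) < \<delta> / 3"
      using bad \<open>0 < \<delta>\<close> by (intro order_tendstoD) auto
    ultimately have "\<forall>\<^sub>F n in sequentially. measure M {\<omega> \<in> space M. \<epsilon> < norm (D n \<omega>)} < \<delta>"
      using K(2)
    proof eventually_elim
      case (elim n)
      have sub: "{\<omega> \<in> space M. \<epsilon> < norm (D n \<omega>)} \<subseteq> ?B n \<union> (?E n \<union> ?T n)"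
      proof (rule ccontr)
        assume "\<not> ?thesis"
        then obtain \<omega> where "\<omega> \<in> {\<omega> \<in> space M. \<epsilon> < norm (D n \<omega>)}" "\<omega> \<notin> ?B n \<union> (?E n \<union> ?T n)"
          by blast
        then have \<omega>: "\<epsilon> < norm (D n \<omega>)" "norm (E n \<omega>) \<le> \<eta>" "norm (T n \<omega>) \<le> K"
          "norm (D n \<omega>) \<le> c * (norm (E n \<omega>) * norm (T n \<omega>))"
          by (auto simp: not_less)
        have "c * (norm (E n \<omega>) * norm (T n \<omega>)) \<le> c' * (\<eta> * K)"
          using \<omega> \<open>0 < \<eta>\<close> K(1) by (intro mult_mono) (auto simp: c'_def)
        also have "\<dots> = \<epsilon>"
          using \<open>0 < c'\<close> K(1) by (simp add: \<eta>_def)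
        finally show False using \<omega> by simp
      qed
      have "measure M {\<omega> \<in> space M. \<epsilon> < norm (D n \<omega>)} \<le> measure M (?B n \<union> (?E n \<union> ?T n))"
        by (intro finite_measure_mono sub) measurable
      also have "\<dots> \<le> measure M (?B n) + (measure M (?E n) + measure M (?T n))"
        by (intro order_trans[OF measure_Un_le] add_left_mono measure_Un_le) measurable
      finally show ?case using elim by simp
    qed
    then show "\<exists>n0. \<forall>n\<ge>n0. norm (measure M {\<omega> \<in> space M. \<epsilon> < norm (D n \<omega>)} - 0) < \<delta>"
      by (auto simp: eventually_sequentially)
  qed
qed

text \<open>If the inverse of \<eta> has norm at most \<open>k\<close> and \<open>R n\<close> is
  within \<open>1 / (2 * k)\<close> of \<eta>, then norm x \<le> k (K + norm x / (2 k)). Half of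
  norm x is absorbed on the left, which leaves the bound \<open>2 * k * K\<close>.\<close>

lemma (in finite_measure) tight_sequence_inverse_image:
  fixes X V :: "nat \<Rightarrow> 'a \<Rightarrow> real^'n" and R :: "nat \<Rightarrow> 'a \<Rightarrow> real^'n^'n"
  assumes [measurable]: "\<And>n. X n \<in> borel_measurable M" "\<And>n. V n \<in> borel_measurable M"
      "\<And>n. R n \<in> borel_measurable M" "\<eta> \<in> borel_measurable M"
    and R: "converges_in_prob M R \<eta>" and inv: "AE \<omega> in M. invertible (\<eta> \<omega>)"
    and V: "tight_sequence M V"
    and bad: "(\<lambda>n. measure M {\<omega> \<in> space M. R n \<omega> *v X n \<omega> \<noteq> V n \<omega>}) \<longlonglongrightarrow> 0"
  shows "tight_sequence M X"
  unfolding tight_sequence_def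
proof (intro allI impI)
  fix e :: real assume "0 < e"
  have "tight_sequence M (\<lambda>_ \<omega>. matrix_inv (\<eta> \<omega>))"
    by (rule tight_sequence_const) measurable
  then obtain k where k: "0 < k"
    "\<forall>\<^sub>F n in sequentially. measure M {\<omega> \<in> space M. k < norm (matrix_inv (\<eta> \<omega>))} < e / 4"
    using tight_sequence_posE[of "\<lambda>_ \<omega>. matrix_inv (\<eta> \<omega>)" "e / 4"] \<open>0 < e\<close> by auto
  obtain K where K: "\<forall>\<^sub>F n in sequentially. measure M {\<omega> \<in> space M. K < norm (V n \<omega>)} < e / 4"
    using tight_sequence_posE[OF V, of "e / 4"] \<open>0 < e\<close> by auto
  let ?I = "{\<omega> \<in> space M. k < norm (matrix_inv (\<eta> \<omega>))}"
  let ?V = "\<lambda>n. {\<omega> \<in> space M. K < norm (V n \<omega>)}"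
  let ?R = "\<lambda>n. {\<omega> \<in> space M. 1 / (2 * k) < dist (R n \<omega>) (\<eta> \<omega>)}"
  let ?B = "\<lambda>n. {\<omega> \<in> space M. R n \<omega> *v X n \<omega> \<noteq> V n \<omega>}"
  have "\<forall>\<^sub>F n in sequentially. measure M (?R n) < e / 4"
    using R \<open>0 < k\<close> \<open>0 < e\<close> unfolding converges_in_prob_def by (intro order_tendstoD(2)[of _ 0]) auto
  moreover have "\<forall>\<^sub>F n in sequentially. measure M (?B n) < e / 4"
    using bad \<open>0 < e\<close> by (intro order_tendstoD) auto
  ultimately have "\<forall>\<^sub>F n in sequentially. measure M {\<omega> \<in> space M. 2 * k * K < norm (X n \<omega>)} < e"
    using k(2) K
  proof eventually_elim
    case (elim n)
    have "AE \<omega> in M. \<omega> \<in> {\<omega> \<in> space M. 2 * k * K < norm (X n \<omega>)} \<longrightarrow> \<omega> \<in> (?B n \<union> ?R n) \<union> (?I \<union> ?V n)"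
      using inv
    proof eventually_elim
      case (elim \<omega>)
      show ?case
      proof (rule ccontr)
        assume "\<not> ?thesis"
        then have \<omega>: "2 * k * K < norm (X n \<omega>)" "R n \<omega> *v X n \<omega> = V n \<omega>"
          "norm (\<eta> \<omega> - R n \<omega>) \<le> 1 / (2 * k)" "norm (matrix_inv (\<eta> \<omega>)) \<le> k" "norm (V n \<omega>) \<le> K"
          by (auto simp: not_less dist_norm norm_minus_commute)
        define x where "x = X n \<omega>"
        have "x = matrix_inv (\<eta> \<omega>) *v (\<eta> \<omega> *v x)"
          by (simp add: matrix_vector_mul_assoc matrix_inv_left[OF elim])
        then have "norm x \<le> norm (matrix_inv (\<eta> \<omega>)) * norm (\<eta> \<omega> *v x)"
          using norm_matrix_vector_mult_le[of "matrix_inv (\<eta> \<omega>)" "\<eta> \<omega> *v x"] by simp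
        also have "\<dots> \<le> k * norm (\<eta> \<omega> *v x)"
          using \<omega> by (intro mult_right_mono) auto
        also have "\<eta> \<omega> *v x = V n \<omega> + (\<eta> \<omega> - R n \<omega>) *v x"
          using \<omega>(2) by (simp add: x_def matrix_vector_mult_diff_rdistrib)
        also have "norm \<dots> \<le> K + 1 / (2 * k) * norm x"
          using \<omega>(5) order_trans[OF norm_matrix_vector_mult_le mult_right_mono[OF \<omega>(3) norm_ge_zero]]
          by (rule norm_triangle_mono)
        finally have "norm x \<le> k * (K + 1 / (2 * k) * norm x)"
          using \<open>0 < k\<close> by (simp add: mult_left_mono)
        then have "norm x \<le> 2 * k * K"
          using \<open>0 < k\<close> by (simp add: field_simps)
        then show False
          using \<omega>(1) by (simp add: x_def)
      qed
    qed
    then have "measure M {\<omega> \<in> space M. 2 * k * K < norm (X n \<omega>)} \<le> measure M ((?B n \<union> ?R n) \<union> (?I \<union> ?V n))"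
      by (rule finite_measure_mono_AE) measurable
    also have "\<dots> \<le> (measure M (?B n) + measure M (?R n)) + (measure M ?I + measure M (?V n))"
      by (intro order_trans[OF measure_Un_le] add_mono measure_Un_le) measurable
    finally show ?case using elim by simp
  qed
  then show "\<exists>K. \<forall>\<^sub>F n in sequentially. measure M {\<omega> \<in> space M. K < norm (X n \<omega>)} < e"
    by blast
qed

subsection \<open>Weighted characteristic functions\<close>

text \<open>On \<open>norm (X n \<omega>) \<le> K\<close> the exponentials differ by at most K times
  the distance of the directions, a bound free of \<open>n\<close>; tightness disposes of the rest.
  It serves both deterministic directions shrinking to 0 and simple functions approximating a random
  direction.\<close>

lemma (in finite_measure) weighted_iexp_perturbation:
  fixes X :: "nat \<Rightarrow> 'a \<Rightarrow> 'b::euclidean_space" and \<zeta> :: "nat \<Rightarrow> 'a \<Rightarrow> 'b"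
  assumes X: "tight_sequence M X" "\<And>n. X n \<in> borel_measurable M"
    and \<xi>: "integrable M \<xi>"
    and \<zeta> [measurable]: "\<And>k. \<zeta> k \<in> borel_measurable M" "\<zeta>' \<in> borel_measurable M"
    and lim: "\<And>\<omega>. \<omega> \<in> space M \<Longrightarrow> (\<lambda>k. \<zeta> k \<omega>) \<longlonglongrightarrow> \<zeta>' \<omega>"
    and "0 < e"
  shows "\<forall>\<^sub>F k in sequentially. \<forall>\<^sub>F n in sequentially.
    cmod ((\<integral>\<omega>. \<xi> \<omega> *\<^sub>R iexp (\<zeta> k \<omega> \<bullet> X n \<omega>) \<partial>M) - (\<integral>\<omega>. \<xi> \<omega> *\<^sub>R iexp (\<zeta>' \<omega> \<bullet> X n \<omega>) \<partial>M)) < e"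
proof -
  note [measurable] = X(2)
  obtain K where K: "0 < K"
    "\<forall>\<^sub>F n in sequentially. (\<integral>\<omega>. \<bar>\<xi> \<omega>\<bar> * indicator {K<..} (norm (X n \<omega>)) \<partial>M) < e / 4"
    using tight_sequence_weighted[OF X \<xi>, of "e / 4"] \<open>0 < e\<close> by auto
  \<comment> \<open>The cut at 2, the trivial bound for a difference of unit complex numbers,
    supplies the integrable majorant although the directions may be unbounded.\<close>
  define g where "g k \<omega> = min 2 (K * norm (\<zeta> k \<omega> - \<zeta>' \<omega>))" for k \<omega>
  have g: "0 \<le> g k \<omega>" "g k \<omega> \<le> 2" for k \<omega>
    using \<open>0 < K\<close> by (auto simp: g_def)
  have g_meas [measurable]: "g k \<in> borel_measurable M" for k
    unfolding g_def by measurable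
  have int_g: "integrable M (\<lambda>\<omega>. \<bar>\<xi> \<omega>\<bar> * g k \<omega>)" for k
    using integrable_scaleR_bounded[OF integrable_abs[OF \<xi>] g_meas[of k], of 2] g by simp
  have "(\<lambda>k. \<integral>\<omega>. \<bar>\<xi> \<omega>\<bar> * g k \<omega> \<partial>M) \<longlonglongrightarrow> (\<integral>\<omega>. 0 \<partial>M)"
  proof (rule integral_dominated_convergence[where w = "\<lambda>\<omega>. 2 * \<bar>\<xi> \<omega>\<bar>"])
    show "AE \<omega> in M. (\<lambda>k. \<bar>\<xi> \<omega>\<bar> * g k \<omega>) \<longlonglongrightarrow> 0"
    proof (rule AE_I2)
      fix \<omega> assume "\<omega> \<in> space M"
      have "(\<lambda>k. \<bar>\<xi> \<omega>\<bar> * g k \<omega>) \<longlonglongrightarrow> \<bar>\<xi> \<omega>\<bar> * min 2 (K * norm (\<zeta>' \<omega> - \<zeta>' \<omega>))"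
        unfolding g_def by (intro tendsto_intros lim \<open>\<omega> \<in> space M\<close>)
      then show "(\<lambda>k. \<bar>\<xi> \<omega>\<bar> * g k \<omega>) \<longlonglongrightarrow> 0" by simp
    qed
    show "AE \<omega> in M. norm (\<bar>\<xi> \<omega>\<bar> * g k \<omega>) \<le> 2 * \<bar>\<xi> \<omega>\<bar>" for k
      using g[of k] by (auto simp: abs_mult mult.commute[of 2] intro!: mult_left_mono)
  qed (use \<xi> in auto)
  then have "\<forall>\<^sub>F k in sequentially. (\<integral>\<omega>. \<bar>\<xi> \<omega>\<bar> * g k \<omega> \<partial>M) < e / 2"
    using \<open>0 < e\<close> by (intro order_tendstoD) auto
  then show ?thesis
  proof eventually_elim
    case (elim k)
    show ?case
      using K(2)
    proof eventually_elim
      case (elim n)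
      let ?J = "\<lambda>\<omega>. indicator {K<..} (norm (X n \<omega>)) :: real"
      have int_J: "integrable M (\<lambda>\<omega>. \<bar>\<xi> \<omega>\<bar> * ?J \<omega>)"
        using integrable_scaleR_bounded[OF integrable_abs[OF \<xi>], of ?J 1] by (simp add: indicator_def)
      have "cmod (iexp (\<zeta> k \<omega> \<bullet> X n \<omega>) - iexp (\<zeta>' \<omega> \<bullet> X n \<omega>)) \<le> 2 * ?J \<omega> + g k \<omega>" for \<omega>
      proof (cases "K < norm (X n \<omega>)")
        case True
        then show ?thesis
          using norm_iexp_diff_le_2[of "\<zeta> k \<omega> \<bullet> X n \<omega>" "\<zeta>' \<omega> \<bullet> X n \<omega>"] g(1)[of k \<omega>] by simp
      next
        case False
        have "\<bar>\<zeta> k \<omega> \<bullet> X n \<omega> - \<zeta>' \<omega> \<bullet> X n \<omega>\<bar> \<le> norm (\<zeta> k \<omega> - \<zeta>' \<omega>) * norm (X n \<omega>)"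
          using Cauchy_Schwarz_ineq2[of "\<zeta> k \<omega> - \<zeta>' \<omega>" "X n \<omega>"] by (simp add: inner_diff_left)
        also have "\<dots> \<le> norm (\<zeta> k \<omega> - \<zeta>' \<omega>) * K"
          using False by (intro mult_left_mono) auto
        finally show ?thesis
          using norm_iexp_diff_le[of "\<zeta> k \<omega> \<bullet> X n \<omega>" "\<zeta>' \<omega> \<bullet> X n \<omega>"]
            norm_iexp_diff_le_2[of "\<zeta> k \<omega> \<bullet> X n \<omega>" "\<zeta>' \<omega> \<bullet> X n \<omega>"] False
          by (simp add: g_def mult.commute)
      qed
      moreover have "2 * ?J \<omega> + g k \<omega> \<le> 4" for \<omega>
        using g(2)[of k \<omega>] by (simp add: indicator_def)
      ultimately have "cmod (\<integral>\<omega>. \<xi> \<omega> *\<^sub>R (iexp (\<zeta> k \<omega> \<bullet> X n \<omega>) - iexp (\<zeta>' \<omega> \<bullet> X n \<omega>)) \<partial>M) \<le>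
          (\<integral>\<omega>. \<bar>\<xi> \<omega>\<bar> * (2 * ?J \<omega> + g k \<omega>) \<partial>M)"
        by (intro norm_weighted_integral_le[OF \<xi>, where C = 4]) simp_all
      also have "\<dots> = (\<integral>\<omega>. 2 * (\<bar>\<xi> \<omega>\<bar> * ?J \<omega>) + \<bar>\<xi> \<omega>\<bar> * g k \<omega> \<partial>M)"
        by (simp add: algebra_simps)
      also have "\<dots> = 2 * (\<integral>\<omega>. \<bar>\<xi> \<omega>\<bar> * ?J \<omega> \<partial>M) + (\<integral>\<omega>. \<bar>\<xi> \<omega>\<bar> * g k \<omega> \<partial>M)"
        by (subst Bochner_Integration.integral_add[OF integrable_mult_right[OF int_J] int_g]) simp
      also have "\<dots> < e"
        using elim \<open>(\<integral>\<omega>. \<bar>\<xi> \<omega>\<bar> * g k \<omega> \<partial>M) < e / 2\<close> by simp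
      finally show ?case
        by (simp only: scaleR_diff_right
            Bochner_Integration.integral_diff[OF integrable_weighted_iexp[OF \<xi> \<zeta>(1) X(2)] integrable_weighted_iexp[OF \<xi> \<zeta>(2) X(2)]])
    qed
  qed
qed

text \<open>The integrability claim is carried through the induction because the integral of a sum
  splits only with it.\<close>

lemma (in finite_measure) weighted_trig_poly_convergence:
  fixes X :: "nat \<Rightarrow> 'a \<Rightarrow> 'b::euclidean_space"
  assumes X [measurable]: "\<And>n. X n \<in> borel_measurable M" "Y \<in> borel_measurable M"
    and \<xi>: "integrable M \<xi>"
    and cf: "\<And>\<theta>. (\<lambda>n. \<integral>\<omega>. \<xi> \<omega> *\<^sub>R iexp (\<theta> \<bullet> X n \<omega>) \<partial>M) \<longlonglongrightarrow> (\<integral>\<omega>. \<xi> \<omega> *\<^sub>R iexp (\<theta> \<bullet> Y \<omega>) \<partial>M)"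
    and "trig_poly g"
  shows "(\<forall>V. V \<in> borel_measurable M \<longrightarrow> integrable M (\<lambda>\<omega>. \<xi> \<omega> * g (V \<omega>))) \<and>
    (\<lambda>n. \<integral>\<omega>. \<xi> \<omega> * g (X n \<omega>) \<partial>M) \<longlonglongrightarrow> (\<integral>\<omega>. \<xi> \<omega> * g (Y \<omega>) \<partial>M)"
  using \<open>trig_poly g\<close>
proof (induction rule: trig_poly.induct)
  case (wave a \<theta> c)
  have int: "integrable M (\<lambda>\<omega>. (a *\<^sub>R iexp c) * (\<xi> \<omega> *\<^sub>R iexp (\<theta> \<bullet> V \<omega>)))"
    if "V \<in> borel_measurable M" for V
    using integrable_weighted_iexp[OF \<xi> _ that, of "\<lambda>_. \<theta>"] by (intro integrable_mult_right) auto
  \<comment> \<open>A wave is the real part of the character for \<theta> times the complex constant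
    that encodes amplitude and phase.\<close>
  have Re: "\<xi> \<omega> * (a * cos (\<theta> \<bullet> V \<omega> + c)) = Re ((a *\<^sub>R iexp c) * (\<xi> \<omega> *\<^sub>R iexp (\<theta> \<bullet> V \<omega>)))" for V \<omega>
    by (simp add: cos_add Re_exp Im_exp algebra_simps)
  have eq: "(\<integral>\<omega>. \<xi> \<omega> * (a * cos (\<theta> \<bullet> V \<omega> + c)) \<partial>M) =
      Re ((a *\<^sub>R iexp c) * (\<integral>\<omega>. \<xi> \<omega> *\<^sub>R iexp (\<theta> \<bullet> V \<omega>) \<partial>M))" if "V \<in> borel_measurable M" for V
    unfolding Re integral_Re[OF int[OF that]] by (subst integral_mult_right_zero) simp
  show ?case
    unfolding eq[OF X(1)] eq[OF X(2)]
    using int by (intro conjI allI impI tendsto_intros cf) (simp only: Re integrable_Re)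
next
  case (add f g)
  then show ?case
    by (auto simp: distrib_left intro!: tendsto_add)
qed

text \<open>
  A substitute for the multidimensional Levy continuity theorem, tightness being assumed.
\<close>

lemma (in finite_measure) weighted_continuity_theorem:
  fixes X :: "nat \<Rightarrow> 'a \<Rightarrow> 'b::euclidean_space"
  assumes tight: "tight_sequence M X"
    and X [measurable]: "\<And>n. X n \<in> borel_measurable M" "Y \<in> borel_measurable M"
    and \<xi>: "integrable M \<xi>"
    and cf: "\<And>\<theta>. (\<lambda>n. \<integral>\<omega>. \<xi> \<omega> *\<^sub>R iexp (\<theta> \<bullet> X n \<omega>) \<partial>M) \<longlonglongrightarrow> (\<integral>\<omega>. \<xi> \<omega> *\<^sub>R iexp (\<theta> \<bullet> Y \<omega>) \<partial>M)"
    and h: "continuous_on UNIV h" "bounded (range h)"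
  shows "(\<lambda>n. \<integral>\<omega>. \<xi> \<omega> * h (X n \<omega>) \<partial>M) \<longlonglongrightarrow> (\<integral>\<omega>. \<xi> \<omega> * h (Y \<omega>) \<partial>M)"
proof (rule LIMSEQ_I)
  fix e :: real assume "0 < e"
  obtain C where C: "0 < C" "\<And>x. \<bar>h x\<bar> \<le> C"
    using h(2) by (auto simp: bounded_pos)
  have [measurable]: "h \<in> borel_measurable borel"
    using h(1) by (rule borel_measurable_continuous_onI)
  define I where "I = (\<integral>\<omega>. \<bar>\<xi> \<omega>\<bar> \<partial>M)"
  have "0 \<le> I" by (simp add: I_def)
  \<comment> \<open>The cap at 1 bounds \<open>\<bar>h - g\<bar>\<close> outside the ball by C + (C
    + \<epsilon>) \<le> 2 C + 1, the factor in the choice of \<delta>. Ball and complement then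
    contribute at most \<open>e / 8\<close> each, below the \<open>e / 3\<close> claimed in
    \<open>close\<close>.\<close>
  define \<epsilon> where "\<epsilon> = min 1 (e / (8 * (I + 1)))"
  have "0 < \<epsilon>" "\<epsilon> \<le> 1" using \<open>0 < e\<close> \<open>0 \<le> I\<close> by (auto simp: \<epsilon>_def)
  have \<epsilon>I: "\<epsilon> * I \<le> e / 8"
  proof -
    have "\<epsilon> * I \<le> e / (8 * (I + 1)) * I"
      using \<open>0 \<le> I\<close> by (intro mult_right_mono) (auto simp: \<epsilon>_def)
    also have "\<dots> \<le> e / 8"
      using \<open>0 \<le> I\<close> \<open>0 < e\<close> by (simp add: field_simps)
    finally show ?thesis .
  qed
  define \<delta> where "\<delta> = e / (8 * (2 * C + 1))"
  have "0 < \<delta>" using \<open>0 < e\<close> C by (simp add: \<delta>_def)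
  obtain K1 where K1: "0 < K1"
    "\<forall>\<^sub>F n in sequentially. (\<integral>\<omega>. \<bar>\<xi> \<omega>\<bar> * indicator {K1<..} (norm (X n \<omega>)) \<partial>M) < \<delta>"
    using tight_sequence_weighted[OF tight X(1) \<xi> \<open>0 < \<delta>\<close>] .
  obtain K2 where K2: "0 < K2"
    "\<forall>\<^sub>F n in sequentially. (\<integral>\<omega>. \<bar>\<xi> \<omega>\<bar> * indicator {K2<..} (norm (Y \<omega>)) \<partial>M) < \<delta>"
    using tight_sequence_weighted[OF tight_sequence_const[OF X(2)] X(2) \<xi> \<open>0 < \<delta>\<close>] .
  define L where "L = max K1 K2"
  have "0 < L" using K1(1) by (simp add: L_def)
  obtain g where g: "trig_poly g" "\<And>x. \<bar>g x\<bar> \<le> C + \<epsilon>" "\<And>x. norm x \<le> L \<Longrightarrow> \<bar>h x - g x\<bar> < \<epsilon>"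
    by (rule trig_poly_approximation[OF h(1) C(2) \<open>0 < L\<close> \<open>0 < \<epsilon>\<close>]) blast
  note trig = weighted_trig_poly_convergence[OF X \<xi> cf g(1)]
  have close: "\<bar>(\<integral>\<omega>. \<xi> \<omega> * h (V \<omega>) \<partial>M) - (\<integral>\<omega>. \<xi> \<omega> * g (V \<omega>) \<partial>M)\<bar> < e / 3"
    if [measurable]: "V \<in> borel_measurable M"
      and small: "(\<integral>\<omega>. \<bar>\<xi> \<omega>\<bar> * indicator {K<..} (norm (V \<omega>)) \<partial>M) < \<delta>" and "K \<le> L" for V K
  proof -
    let ?J = "\<lambda>\<omega>. indicator {K<..} (norm (V \<omega>)) :: real"
    have int_J: "integrable M (\<lambda>\<omega>. \<bar>\<xi> \<omega>\<bar> * ?J \<omega>)"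
      using integrable_scaleR_bounded[OF integrable_abs[OF \<xi>], of ?J 1] by (simp add: indicator_def)
    have int_h: "integrable M (\<lambda>\<omega>. \<xi> \<omega> * h (V \<omega>))"
      using integrable_scaleR_bounded[OF \<xi>, of "\<lambda>\<omega>. h (V \<omega>)" C] C(2) by simp
    have int_g: "integrable M (\<lambda>\<omega>. \<xi> \<omega> * g (V \<omega>))"
      using trig that(1) by blast
    have bound: "\<bar>\<xi> \<omega> * h (V \<omega>) - \<xi> \<omega> * g (V \<omega>)\<bar> \<le> \<epsilon> * \<bar>\<xi> \<omega>\<bar> + (2 * C + 1) * (\<bar>\<xi> \<omega>\<bar> * ?J \<omega>)" for \<omega>
    proof -
      have "\<bar>h (V \<omega>) - g (V \<omega>)\<bar> \<le> \<epsilon> + (2 * C + 1) * ?J \<omega>"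
        using C(2)[of "V \<omega>"] g(2,3)[of "V \<omega>"] \<open>0 < \<epsilon>\<close> \<open>\<epsilon> \<le> 1\<close> \<open>K \<le> L\<close> by (auto simp: indicator_def)
      then have "\<bar>\<xi> \<omega>\<bar> * \<bar>h (V \<omega>) - g (V \<omega>)\<bar> \<le> \<bar>\<xi> \<omega>\<bar> * (\<epsilon> + (2 * C + 1) * ?J \<omega>)"
        by (rule mult_left_mono) simp
      then show ?thesis
        by (simp add: algebra_simps flip: abs_mult)
    qed
    have "\<bar>(\<integral>\<omega>. \<xi> \<omega> * h (V \<omega>) \<partial>M) - (\<integral>\<omega>. \<xi> \<omega> * g (V \<omega>) \<partial>M)\<bar> =
        \<bar>\<integral>\<omega>. \<xi> \<omega> * h (V \<omega>) - \<xi> \<omega> * g (V \<omega>) \<partial>M\<bar>"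
      by (simp add: Bochner_Integration.integral_diff[OF int_h int_g])
    also have "\<dots> \<le> (\<integral>\<omega>. \<bar>\<xi> \<omega> * h (V \<omega>) - \<xi> \<omega> * g (V \<omega>)\<bar> \<partial>M)"
      by (rule integral_abs_bound)
    also have "\<dots> \<le> (\<integral>\<omega>. \<epsilon> * \<bar>\<xi> \<omega>\<bar> + (2 * C + 1) * (\<bar>\<xi> \<omega>\<bar> * ?J \<omega>) \<partial>M)"
      using bound by (intro integral_mono Bochner_Integration.integrable_add integrable_mult_right int_J
          integrable_abs Bochner_Integration.integrable_diff int_h int_g \<xi>)
    also have "\<dots> = \<epsilon> * I + (2 * C + 1) * (\<integral>\<omega>. \<bar>\<xi> \<omega>\<bar> * ?J \<omega> \<partial>M)"
      unfolding I_def using \<xi>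
      by (subst Bochner_Integration.integral_add[OF integrable_mult_right integrable_mult_right[OF int_J]]) simp_all
    also have "(2 * C + 1) * (\<integral>\<omega>. \<bar>\<xi> \<omega>\<bar> * ?J \<omega> \<partial>M) < (2 * C + 1) * \<delta>"
      using small C(1) by (intro mult_strict_left_mono) auto
    also have "\<dots> = e / 8"
    proof -
      have "c * (e / (8 * c)) = e / 8" if "0 < c" for c
        using that by simp
      from this[of "2 * C + 1"] show ?thesis
        using C(1) by (simp add: \<delta>_def)
    qed
    finally show ?thesis
      using \<epsilon>I \<open>0 < e\<close> by simp
  qed
  have "\<forall>\<^sub>F n in sequentially. dist (\<integral>\<omega>. \<xi> \<omega> * g (X n \<omega>) \<partial>M) (\<integral>\<omega>. \<xi> \<omega> * g (Y \<omega>) \<partial>M) < e / 3"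
    using trig \<open>0 < e\<close> by (intro tendstoD) auto
  then have "\<forall>\<^sub>F n in sequentially. norm ((\<integral>\<omega>. \<xi> \<omega> * h (X n \<omega>) \<partial>M) - (\<integral>\<omega>. \<xi> \<omega> * h (Y \<omega>) \<partial>M)) < e"
    using K1(2) K2(2)
  proof eventually_elim
    case (elim n)
    have "\<bar>(\<integral>\<omega>. \<xi> \<omega> * h (X n \<omega>) \<partial>M) - (\<integral>\<omega>. \<xi> \<omega> * g (X n \<omega>) \<partial>M)\<bar> < e / 3"
      using elim by (intro close[of _ K1]) (auto simp: L_def)
    moreover have "\<bar>(\<integral>\<omega>. \<xi> \<omega> * h (Y \<omega>) \<partial>M) - (\<integral>\<omega>. \<xi> \<omega> * g (Y \<omega>) \<partial>M)\<bar> < e / 3"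
      using elim by (intro close[of _ K2]) (auto simp: L_def)
    ultimately show ?case
      using elim(1) unfolding dist_real_def real_norm_def by linarith
  qed
  then show "\<exists>n0. \<forall>n\<ge>n0. norm ((\<integral>\<omega>. \<xi> \<omega> * h (X n \<omega>) \<partial>M) - (\<integral>\<omega>. \<xi> \<omega> * h (Y \<omega>) \<partial>M)) < e"
    by (auto simp: eventually_sequentially)
qed

subsection \<open>Conditional expectations\<close>

context finite_measure_subalgebra
begin

lemma complex_cond_exp_measurable [measurable]:
  "complex_cond_exp M F f \<in> borel_measurable M"
proof -
  have "complex_cond_exp M F f = (\<lambda>\<omega>. complex_of_real (real_cond_exp M F (\<lambda>\<omega>. Re (f \<omega>)) \<omega>)
      + \<i> * complex_of_real (real_cond_exp M F (\<lambda>\<omega>. Im (f \<omega>)) \<omega>))"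
    by (auto simp: complex_cond_exp_def complex_eq_iff)
  then show ?thesis by simp
qed

text \<open>Real and imaginary part are bounded by 1 separately, whence 2; the later estimates only
  require a constant independent of the index.\<close>

lemma norm_complex_cond_exp_le:
  assumes [measurable]: "f \<in> borel_measurable M" and f: "\<And>\<omega>. cmod (f \<omega>) \<le> 1"
  shows "AE \<omega> in M. cmod (complex_cond_exp M F f \<omega>) \<le> 2"
proof -
  have Re: "\<bar>Re (f \<omega>)\<bar> \<le> 1" and Im: "\<bar>Im (f \<omega>)\<bar> \<le> 1" for \<omega>
    using abs_Re_le_cmod[of "f \<omega>"] abs_Im_le_cmod[of "f \<omega>"] f[of \<omega>] by linarith+
  have bound: "AE \<omega> in M. \<bar>real_cond_exp M F u \<omega>\<bar> \<le> 1"
    if [measurable]: "u \<in> borel_measurable M" and u: "\<And>\<omega>. \<bar>u \<omega>\<bar> \<le> 1" for u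
  proof -
    have int: "integrable M u"
      using u by (intro integrable_const_bound[where B = 1]) auto
    have "AE \<omega> in M. real_cond_exp M F u \<omega> \<le> 1" "AE \<omega> in M. - 1 \<le> real_cond_exp M F u \<omega>"
      using u by (auto intro!: real_cond_exp_le_c real_cond_exp_ge_c int simp: abs_le_iff minus_le_iff)
    then show ?thesis
      by eventually_elim simp
  qed
  have "AE \<omega> in M. \<bar>real_cond_exp M F (\<lambda>\<omega>. Re (f \<omega>)) \<omega>\<bar> \<le> 1"
    "AE \<omega> in M. \<bar>real_cond_exp M F (\<lambda>\<omega>. Im (f \<omega>)) \<omega>\<bar> \<le> 1"
    using Re Im by (auto intro!: bound)
  then show ?thesis
  proof eventually_elim
    case (elim \<omega>)
    then show ?case
      using cmod_le[of "complex_cond_exp M F f \<omega>"] by (simp add: complex_cond_exp_def)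
  qed
qed

lemma complex_cond_exp_integral:
  assumes f [measurable]: "f \<in> borel_measurable F" "\<And>\<omega>. cmod (f \<omega>) \<le> 1"
    and g [measurable]: "g \<in> borel_measurable M" "\<And>\<omega>. cmod (g \<omega>) \<le> 1"
  shows "(\<integral>\<omega>. f \<omega> * complex_cond_exp M F g \<omega> \<partial>M) = (\<integral>\<omega>. f \<omega> * g \<omega> \<partial>M)"
proof -
  have [measurable]: "f \<in> borel_measurable M"
    by (rule measurable_from_subalg[OF subalg f(1)])
  have int_fg: "integrable M (\<lambda>\<omega>. f \<omega> * g \<omega>)"
    using f(2) g(2) by (intro integrable_const_bound[where B = 1]) (auto simp: norm_mult mult_le_one)
  have int_fc: "integrable M (\<lambda>\<omega>. f \<omega> * complex_cond_exp M F g \<omega>)"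
  proof (rule integrable_const_bound[where B = 2])
    show "AE \<omega> in M. norm (f \<omega> * complex_cond_exp M F g \<omega>) \<le> 2"
      using norm_complex_cond_exp_le[OF g]
    proof eventually_elim
      case (elim \<omega>)
      then show ?case
        using mult_mono[OF f(2)[of \<omega>] elim] by (simp add: norm_mult)
    qed
  qed measurable
  \<comment> \<open>\<open>p\<close> and \<open>q\<close> range over \<open>Re\<close> and
    \<open>Im\<close> so that one argument covers the four real products in a complex
    product.\<close>
  have real: "integrable M (\<lambda>\<omega>. p (f \<omega>) * real_cond_exp M F (\<lambda>\<omega>. q (g \<omega>)) \<omega>)"
    "(\<integral>\<omega>. p (f \<omega>) * real_cond_exp M F (\<lambda>\<omega>. q (g \<omega>)) \<omega> \<partial>M) = (\<integral>\<omega>. p (f \<omega>) * q (g \<omega>) \<partial>M)"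
    "integrable M (\<lambda>\<omega>. p (f \<omega>) * q (g \<omega>))"
    if p: "p \<in> {Re, Im}" and q: "q \<in> {Re, Im}" for p q :: "complex \<Rightarrow> real"
  proof -
    have [measurable]: "p \<in> borel_measurable borel" "q \<in> borel_measurable borel"
      using p q by auto
    have le: "\<bar>p z\<bar> \<le> cmod z" "\<bar>q z\<bar> \<le> cmod z" for z
      using p q abs_Re_le_cmod abs_Im_le_cmod by auto
    have "\<bar>p (f \<omega>)\<bar> \<le> 1" "\<bar>q (g \<omega>)\<bar> \<le> 1" for \<omega>
      using le(1)[of "f \<omega>"] le(2)[of "g \<omega>"] f(2)[of \<omega>] g(2)[of \<omega>] by linarith+
    then show int: "integrable M (\<lambda>\<omega>. p (f \<omega>) * q (g \<omega>))"
      by (intro integrable_const_bound[where B = 1]) (auto simp: abs_mult mult_le_one)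
    show "integrable M (\<lambda>\<omega>. p (f \<omega>) * real_cond_exp M F (\<lambda>\<omega>. q (g \<omega>)) \<omega>)"
      "(\<integral>\<omega>. p (f \<omega>) * real_cond_exp M F (\<lambda>\<omega>. q (g \<omega>)) \<omega> \<partial>M) = (\<integral>\<omega>. p (f \<omega>) * q (g \<omega>) \<partial>M)"
      by (rule real_cond_exp_intg[OF int]; measurable)+
  qed
  have "Re (\<integral>\<omega>. f \<omega> * complex_cond_exp M F g \<omega> \<partial>M) = Re (\<integral>\<omega>. f \<omega> * g \<omega> \<partial>M)"
    using real[of Re Re] real[of Im Im]
    unfolding integral_Re[OF int_fc, symmetric] integral_Re[OF int_fg, symmetric]
    by (simp add: complex_cond_exp_def)
  moreover have "Im (\<integral>\<omega>. f \<omega> * complex_cond_exp M F g \<omega> \<partial>M) = Im (\<integral>\<omega>. f \<omega> * g \<omega> \<partial>M)"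
    using real[of Re Im] real[of Im Re]
    unfolding integral_Im[OF int_fc, symmetric] integral_Im[OF int_fg, symmetric]
    by (simp add: complex_cond_exp_def)
  ultimately show ?thesis
    by (rule complex_eqI)
qed

end

lemma sets_sigma_infinity:
  assumes "\<And>n. subalgebra M (F n)"
  shows "sets (sigma_infinity M F) = sigma_sets (space M) (\<Union>k. sets (F k))"
proof -
  have "sets (F k) \<subseteq> Pow (space M)" for k
    using assms[of k] sets.space_closed[of M] by (auto simp: subalgebra_def)
  then show ?thesis
    unfolding sigma_infinity_def by (intro sets_measure_of) auto
qed

lemma subalgebra_sigma_infinity:
  assumes "\<And>n. subalgebra M (F n)"
  shows "subalgebra M (sigma_infinity M F)"
proof -
  have "(\<Union>k. sets (F k)) \<subseteq> sets M"
    using assms by (auto simp: subalgebra_def)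
  then show ?thesis
    unfolding subalgebra_def sets_sigma_infinity[OF assms]
    by (auto simp: sigma_infinity_def space_measure_of_conv dest: sets.sigma_sets_subset)
qed

text \<open>Boundedness of \<open>D\<close>, uniform in \<open>n\<close>, makes the weighted
  integral Lipschitz in the weight for the L1 norm, so the weights with vanishing limit form an
  L1-closed set.\<close>

lemma (in finite_measure) weighted_integral_L1_limit:
  fixes D :: "nat \<Rightarrow> 'a \<Rightarrow> complex"
  assumes D [measurable]: "\<And>n. D n \<in> borel_measurable M" "\<And>n. AE \<omega> in M. cmod (D n \<omega>) \<le> C"
    and w: "\<And>m. integrable M (w m)" "integrable M w'"
    and L1: "(\<lambda>m. \<integral>\<omega>. \<bar>w' \<omega> - w m \<omega>\<bar> \<partial>M) \<longlonglongrightarrow> 0"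
    and lim: "\<And>m. (\<lambda>n. \<integral>\<omega>. w m \<omega> *\<^sub>R D n \<omega> \<partial>M) \<longlonglongrightarrow> 0"
  shows "(\<lambda>n. \<integral>\<omega>. w' \<omega> *\<^sub>R D n \<omega> \<partial>M) \<longlonglongrightarrow> 0"
proof (rule LIMSEQ_I)
  fix e :: real assume "0 < e"
  define c where "c = max C 1"
  have "0 < c" by (simp add: c_def)
  have c: "AE \<omega> in M. cmod (D n \<omega>) \<le> c" for n
    using D(2)[of n] by eventually_elim (simp add: c_def)
  have "\<forall>\<^sub>F m in sequentially. (\<integral>\<omega>. \<bar>w' \<omega> - w m \<omega>\<bar> \<partial>M) < e / (2 * c)"
    using L1 \<open>0 < e\<close> \<open>0 < c\<close> by (intro order_tendstoD(2)[of _ 0]) auto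
  then obtain m where m: "(\<integral>\<omega>. \<bar>w' \<omega> - w m \<omega>\<bar> \<partial>M) < e / (2 * c)"
    by (auto simp: eventually_sequentially)
  have diff: "cmod ((\<integral>\<omega>. w' \<omega> *\<^sub>R D n \<omega> \<partial>M) - (\<integral>\<omega>. w m \<omega> *\<^sub>R D n \<omega> \<partial>M)) < e / 2" for n
  proof -
    note int = integrable_scaleR_bounded[OF w(2) D(1) c, of n] integrable_scaleR_bounded[OF w(1) D(1) c, of m n]
    have "cmod (\<integral>\<omega>. (w' \<omega> - w m \<omega>) *\<^sub>R D n \<omega> \<partial>M) \<le> (\<integral>\<omega>. \<bar>w' \<omega> - w m \<omega>\<bar> * c \<partial>M)"
      using w by (intro norm_weighted_integral_le[OF _ D(1) _ c, where C = c]) auto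
    also have "\<dots> < e / 2"
      using m \<open>0 < c\<close> by (simp add: field_simps)
    finally show ?thesis
      using int by (simp add: scaleR_diff_left)
  qed
  have "\<forall>\<^sub>F n in sequentially. cmod (\<integral>\<omega>. w m \<omega> *\<^sub>R D n \<omega> \<partial>M) < e / 2"
    using tendsto_norm[OF lim[of m]] \<open>0 < e\<close> by (intro order_tendstoD(2)[of _ 0]) auto
  then obtain n0 where n0: "\<And>n. n0 \<le> n \<Longrightarrow> cmod (\<integral>\<omega>. w m \<omega> *\<^sub>R D n \<omega> \<partial>M) < e / 2"
    by (auto simp: eventually_sequentially)
  have "cmod (\<integral>\<omega>. w' \<omega> *\<^sub>R D n \<omega> \<partial>M) < e" if "n0 \<le> n" for n
    using diff[of n] n0[OF that]
      norm_triangle_sub[of "\<integral>\<omega>. w' \<omega> *\<^sub>R D n \<omega> \<partial>M" "\<integral>\<omega>. w m \<omega> *\<^sub>R D n \<omega> \<partial>M"] by simp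
  then show "\<exists>n0. \<forall>n\<ge>n0. norm ((\<integral>\<omega>. w' \<omega> *\<^sub>R D n \<omega> \<partial>M) - 0) < e"
    by auto
qed

text \<open>Monotone class argument: Dynkin's lemma passes from the sets of all \<open>F k\<close>
  to the sets of the limit \<sigma>-field, then linearity and L1 limits reach integrable
  weights.\<close>

lemma (in finite_measure) weighted_integral_vanish_sigma_infinity:
  fixes D :: "nat \<Rightarrow> 'a \<Rightarrow> complex"
  assumes D [measurable]: "\<And>n. D n \<in> borel_measurable M" "\<And>n. AE \<omega> in M. cmod (D n \<omega>) \<le> C"
    and F: "\<And>n. subalgebra M (F n)" "\<And>m n. m \<le> n \<Longrightarrow> sets (F m) \<subseteq> sets (F n)"
    and vanish: "\<And>k S. S \<in> sets (F k) \<Longrightarrow> (\<lambda>n. \<integral>\<omega>. indicator S \<omega> *\<^sub>R D n \<omega> \<partial>M) \<longlonglongrightarrow> 0"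
    and w: "integrable M w" "w \<in> borel_measurable (sigma_infinity M F)"
  shows "(\<lambda>n. \<integral>\<omega>. w \<omega> *\<^sub>R D n \<omega> \<partial>M) \<longlonglongrightarrow> 0"
proof -
  let ?R = "\<lambda>w::'a \<Rightarrow> real. (\<lambda>n. \<integral>\<omega>. w \<omega> *\<^sub>R D n \<omega> \<partial>M) \<longlonglongrightarrow> 0"
  have F_sub: "sets (F k) \<subseteq> sets M" for k
    using F(1)[of k] by (simp add: subalgebra_def)
  note sub = subalgebra_sigma_infinity[OF F(1)]
  have R_add: "?R (\<lambda>\<omega>. u \<omega> + v \<omega>)" if "integrable M u" "integrable M v" "?R u" "?R v" for u v
  proof -
    have "(\<lambda>n. (\<integral>\<omega>. u \<omega> *\<^sub>R D n \<omega> \<partial>M) + (\<integral>\<omega>. v \<omega> *\<^sub>R D n \<omega> \<partial>M)) \<longlonglongrightarrow> 0"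
      using tendsto_add[OF that(3,4)] by simp
    then show ?thesis
      using that(1,2) by (simp add: scaleR_add_left integrable_scaleR_bounded[OF _ D])
  qed
  have scale: "?R (\<lambda>\<omega>. c * u \<omega>)" if "?R u" for u c
    using tendsto_scaleR[OF tendsto_const[of c] that] by (simp flip: scaleR_scaleR)
  have int_ind: "integrable M (\<lambda>\<omega>. indicator S \<omega> :: real)" if "S \<in> sets M" for S
    using that by (simp add: less_top[symmetric])
  have ind: "?R (indicator S)" if S: "S \<in> sets (sigma_infinity M F)" for S
  proof -
    have G: "(\<Union>k. sets (F k)) \<subseteq> Pow (space M)"
      using F_sub sets.space_closed[of M] by auto
    have "sets (sigma_infinity M F) \<subseteq> sets M"
      using sub by (simp add: subalgebra_def)
    then have sets_M: "S \<in> sets M" if "S \<in> sigma_sets (space M) (\<Union>k. sets (F k))" for S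
      using that unfolding sets_sigma_infinity[OF F(1)] by (rule subsetD)
    \<comment> \<open>Here the filtration must be increasing: two sets from different levels both
      belong to the later one.\<close>
    have stable: "Int_stable (\<Union>k. sets (F k))"
    proof (rule Int_stableI)
      fix a b assume "a \<in> (\<Union>k. sets (F k))" "b \<in> (\<Union>k. sets (F k))"
      then obtain i j where "a \<in> sets (F i)" "b \<in> sets (F j)" by blast
      then have "a \<inter> b \<in> sets (F (max i j))"
        using F(2)[of i "max i j"] F(2)[of j "max i j"] by auto
      then show "a \<inter> b \<in> (\<Union>k. sets (F k))" by blast
    qed
    from S show ?thesis
      unfolding sets_sigma_infinity[OF F(1)]
    proof (induction rule: sigma_sets_induct_disjoint[OF stable G, consumes 1, case_names basic empty compl union])
      case (basic S)
      then show ?case using vanish by auto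
    next
      case empty
      then show ?case by simp
    next
      case (compl S)
      have sp: "?R (indicator (space M))"
        using vanish[of "space (F 0)" 0] F(1)[of 0] by (simp add: subalgebra_def)
      have "?R (\<lambda>\<omega>. indicator (space M) \<omega> + (- 1) * indicator S \<omega>)"
        using compl sets_M by (intro R_add scale sp int_ind integrable_mult_right) auto
      moreover have "(\<integral>\<omega>. (indicator (space M) \<omega> + (- 1) * indicator S \<omega>) *\<^sub>R D n \<omega> \<partial>M) =
          (\<integral>\<omega>. indicator (space M - S) \<omega> *\<^sub>R D n \<omega> \<partial>M)" for n
        by (rule Bochner_Integration.integral_cong) (auto simp: indicator_def)
      ultimately show ?case by simp
    next
      \<comment> \<open>Finite partial sums of the indicators converge boundedly to the indicator of
        the union, hence in L1.\<close>
      case (union A)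
      have A: "A i \<in> sets M" for i
        using union sets_M by auto
      let ?w = "\<lambda>m \<omega>. \<Sum>i<m. indicator (A i) \<omega> :: real"
      have int_w: "integrable M (?w m)" for m
        using A by (intro Bochner_Integration.integrable_sum int_ind)
      have Rw: "?R (?w m)" for m
      proof (induction m)
        case (Suc m)
        then show ?case
          using R_add[OF int_w int_ind[OF A] Suc] union by simp
      qed simp
      have int_U: "integrable M (\<lambda>\<omega>. indicator (\<Union>i. A i) \<omega> :: real)"
        using A by (intro int_ind) auto
      have sums: "(\<lambda>i. indicator (A i) \<omega> :: real) sums indicator (\<Union>i. A i) \<omega>" for \<omega>
        using union by (intro indicator_sums) (auto simp: disjoint_family_on_def)
      then have w_lim: "(\<lambda>m. ?w m \<omega>) \<longlonglongrightarrow> indicator (\<Union>i. A i) \<omega>" for \<omega>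
        by (simp add: sums_def)
      have w_le: "\<bar>?w m \<omega>\<bar> \<le> 1" for m \<omega>
      proof -
        have "?w m \<omega> \<le> indicator (\<Union>i. A i) \<omega>"
          unfolding sums_unique[OF sums] by (intro sum_le_suminf sums_summable[OF sums]) auto
        also have "\<dots> \<le> 1" by (rule indicator_le_1)
        finally show ?thesis by (simp add: sum_nonneg)
      qed
      have "(\<lambda>m. \<integral>\<omega>. \<bar>indicator (\<Union>i. A i) \<omega> - ?w m \<omega>\<bar> \<partial>M) \<longlonglongrightarrow> (\<integral>\<omega>. 0 \<partial>M)"
      proof (rule integral_dominated_convergence[where w = "\<lambda>_. 2"])
        show "AE \<omega> in M. (\<lambda>m. \<bar>indicator (\<Union>i. A i) \<omega> - ?w m \<omega>\<bar>) \<longlonglongrightarrow> 0"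
        proof (rule AE_I2)
          fix \<omega>
          show "(\<lambda>m. \<bar>indicator (\<Union>i. A i) \<omega> - ?w m \<omega>\<bar>) \<longlonglongrightarrow> 0"
            using tendsto_rabs[OF tendsto_diff[OF tendsto_const w_lim[of \<omega>]], of "indicator (\<Union>i. A i) \<omega>"] by simp
        qed
        show "AE \<omega> in M. norm \<bar>indicator (\<Union>i. A i) \<omega> - ?w m \<omega>\<bar> \<le> 2" for m
        proof (rule AE_I2)
          fix \<omega>
          have "\<bar>indicator (\<Union>i. A i) \<omega> :: real\<bar> \<le> 1" by (simp add: indicator_def)
          then show "norm \<bar>indicator (\<Union>i. A i) \<omega> - ?w m \<omega>\<bar> \<le> 2"
            using w_le[of \<omega> m] unfolding real_norm_def by linarith
        qed
      qed (use A in measurable)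
      then show ?case
        by (intro weighted_integral_L1_limit[OF D int_w int_U _ Rw]) simp
    qed
  qed
  \<comment> \<open>The induction over integrable functions runs in the restricted measure, so that
    every set and approximant it produces is measurable for the limit \<sigma>-field.\<close>
  have sets_restr: "sets (restr_to_subalg M (sigma_infinity M F)) = sets (sigma_infinity M F)"
    by (rule sets_restr_to_subalg[OF sub])
  have "integrable (restr_to_subalg M (sigma_infinity M F)) w"
    using w by (intro integrable_in_subalg[OF sub])
  then show ?thesis
  proof (induction rule: integrable_induct)
    case (base S c)
    then show ?case
      using scale[OF ind, of S c] by (simp add: sets_restr mult.commute)
  next
    case (add u v)
    then show ?case
      by (intro R_add integrable_from_subalg[OF sub])
  next
    case (lim f s)
    have int: "integrable M (s i)" "integrable M f" for i
      by (rule integrable_from_subalg[OF sub], rule lim)+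
    \<comment> \<open>The induction supplies approximants with
      \<open>\<bar>s i \<omega>\<bar> \<le> 2 * \<bar>f \<omega>\<bar>\<close>, which gives the
      factor 3 in the majorant.\<close>
    have "(\<lambda>i. \<integral>\<omega>. \<bar>f \<omega> - s i \<omega>\<bar> \<partial>M) \<longlonglongrightarrow> (\<integral>\<omega>. 0 \<partial>M)"
    proof (rule integral_dominated_convergence[where w = "\<lambda>\<omega>. 3 * \<bar>f \<omega>\<bar>"])
      show "AE \<omega> in M. (\<lambda>i. \<bar>f \<omega> - s i \<omega>\<bar>) \<longlonglongrightarrow> 0"
      proof (rule AE_I2)
        fix \<omega> assume "\<omega> \<in> space M"
        then have "(\<lambda>i. s i \<omega>) \<longlonglongrightarrow> f \<omega>"
          using lim by (simp add: space_restr_to_subalg)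
        then show "(\<lambda>i. \<bar>f \<omega> - s i \<omega>\<bar>) \<longlonglongrightarrow> 0"
          using tendsto_rabs[OF tendsto_diff[OF tendsto_const, of "\<lambda>i. s i \<omega>" "f \<omega>" sequentially "f \<omega>"]] by simp
      qed
      show "AE \<omega> in M. norm \<bar>f \<omega> - s i \<omega>\<bar> \<le> 3 * \<bar>f \<omega>\<bar>" for i
      proof (rule AE_I2)
        fix \<omega> assume "\<omega> \<in> space M"
        then have "\<bar>s i \<omega>\<bar> \<le> 2 * \<bar>f \<omega>\<bar>"
          using lim by (auto simp: space_restr_to_subalg)
        then show "norm \<bar>f \<omega> - s i \<omega>\<bar> \<le> 3 * \<bar>f \<omega>\<bar>"
          unfolding real_norm_def by linarith
      qed
    qed (use int in auto)
    then show ?case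
      using lim by (intro weighted_integral_L1_limit[OF D int]) auto
  qed
qed

text \<open>For the indicator of a set in \<open>F k\<close> the integral is exactly 0 as soon as
  \<open>k \<le> n\<close>, since indicator times \<open>V n\<close> is then
  \<open>F n\<close>-measurable. The bound 3 is 1 for \<open>g n\<close> plus 2 for its conditional
  expectation.\<close>

lemma (in finite_measure) weighted_martingale_difference_vanish:
  fixes g V :: "nat \<Rightarrow> 'a \<Rightarrow> complex"
  assumes F: "\<And>n. subalgebra M (F n)" "\<And>m n. m \<le> n \<Longrightarrow> sets (F m) \<subseteq> sets (F n)"
    and g [measurable]: "\<And>n. g n \<in> borel_measurable M" "\<And>n \<omega>. cmod (g n \<omega>) \<le> 1"
    and V: "\<And>n. V n \<in> borel_measurable (F n)" "\<And>n \<omega>. cmod (V n \<omega>) \<le> 1"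
    and w: "integrable M w" "w \<in> borel_measurable (sigma_infinity M F)"
  shows "(\<lambda>n. \<integral>\<omega>. w \<omega> *\<^sub>R (V n \<omega> * (g n \<omega> - complex_cond_exp M (F n) (g n) \<omega>)) \<partial>M) \<longlonglongrightarrow> 0"
proof (rule weighted_integral_vanish_sigma_infinity[OF _ _ F _ w, where C = 3])
  interpret F: finite_measure_subalgebra M "F n" for n
    by unfold_locales (rule F(1))
  have V_M [measurable]: "V n \<in> borel_measurable M" for n
    by (rule measurable_from_subalg[OF F(1) V(1)])
  show meas: "(\<lambda>\<omega>. V n \<omega> * (g n \<omega> - complex_cond_exp M (F n) (g n) \<omega>)) \<in> borel_measurable M" for n
    by measurable
  show bound: "AE \<omega> in M. cmod (V n \<omega> * (g n \<omega> - complex_cond_exp M (F n) (g n) \<omega>)) \<le> 3" for n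
    using F.norm_complex_cond_exp_le[OF g, of n n]
  proof eventually_elim
    case (elim \<omega>)
    have "cmod (g n \<omega> - complex_cond_exp M (F n) (g n) \<omega>) \<le> 1 + 2"
      using g(2)[of n \<omega>] elim by (intro order_trans[OF norm_triangle_ineq4] add_mono)
    then show ?case
      using mult_mono[OF V(2)[of n \<omega>], of _ "1 + 2"] by (simp add: norm_mult)
  qed
  fix k S assume S: "S \<in> sets (F k)"
  have "(\<integral>\<omega>. indicator S \<omega> *\<^sub>R (V n \<omega> * (g n \<omega> - complex_cond_exp M (F n) (g n) \<omega>)) \<partial>M) = 0" if "k \<le> n" for n
  proof -
    define f where "f \<omega> = indicator S \<omega> * V n \<omega>" for \<omega>
    have [measurable]: "S \<in> sets (F n)" "V n \<in> borel_measurable (F n)"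
      using S F(2)[OF that] V(1) by auto
    have f: "f \<in> borel_measurable (F n)" "\<And>\<omega>. cmod (f \<omega>) \<le> 1"
      using V(2)[of n] unfolding f_def by (auto simp: indicator_def)
    have [measurable]: "f \<in> borel_measurable M"
      by (rule measurable_from_subalg[OF F(1) f(1)])
    have int1: "integrable M (\<lambda>\<omega>. f \<omega> * g n \<omega>)"
      using f(2) g(2) by (intro integrable_const_bound[where B = 1]) (auto simp: norm_mult mult_le_one)
    have int2: "integrable M (\<lambda>\<omega>. f \<omega> * complex_cond_exp M (F n) (g n) \<omega>)"
    proof (rule integrable_const_bound[where B = 2])
      show "AE \<omega> in M. norm (f \<omega> * complex_cond_exp M (F n) (g n) \<omega>) \<le> 2"
        using F.norm_complex_cond_exp_le[OF g, of n n]
      proof eventually_elim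
        case (elim \<omega>)
        then show ?case
          using mult_mono[OF f(2)[of \<omega>] elim] by (simp add: norm_mult)
      qed
    qed measurable
    have "(\<integral>\<omega>. indicator S \<omega> *\<^sub>R (V n \<omega> * (g n \<omega> - complex_cond_exp M (F n) (g n) \<omega>)) \<partial>M) =
        (\<integral>\<omega>. f \<omega> * g n \<omega> - f \<omega> * complex_cond_exp M (F n) (g n) \<omega> \<partial>M)"
      by (rule Bochner_Integration.integral_cong) (auto simp: f_def indicator_def algebra_simps)
    then show ?thesis
      using F.complex_cond_exp_integral[OF f g] int1 int2 by simp
  qed
  then show "(\<lambda>n. \<integral>\<omega>. indicator S \<omega> *\<^sub>R (V n \<omega> * (g n \<omega> - complex_cond_exp M (F n) (g n) \<omega>)) \<partial>M) \<longlonglongrightarrow> 0"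
    by (intro tendsto_eventually) (auto simp: eventually_sequentially)
qed

subsection \<open>Random series with a logarithmic moment\<close>

lemma le_exp_log_plus: "x \<le> exp (log_plus x)"
  by (simp add: log_plus_def)

lemma log_plus_nonneg: "0 \<le> log_plus x"
  by (simp add: log_plus_def)

lemma borel_measurable_log_plus [measurable]: "log_plus \<in> borel_measurable borel"
  unfolding log_plus_def[abs_def] by measurable

text \<open>Counts the multiples of \<open>c\<close> below \<open>y\<close>, zero included.
  Integrated over \<open>y\<close>, it compares a sum of tail probabilities with a mean.\<close>

lemma sum_indicator_multiples_le:
  assumes "0 < c" "0 \<le> y"
  shows "(\<Sum>j<n. of_bool (c * real j < y) :: real) \<le> y / c + 1"
proof -
  have sub: "{j. j < n \<and> c * real j < y} \<subseteq> {..<nat \<lceil>y / c\<rceil>}"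
  proof
    fix j assume "j \<in> {j. j < n \<and> c * real j < y}"
    then have "real j < y / c"
      using \<open>0 < c\<close> by (simp add: field_simps)
    then show "j \<in> {..<nat \<lceil>y / c\<rceil>}"
      by simp linarith
  qed
  have "(\<Sum>j<n. of_bool (c * real j < y) :: real) = real (card {j. j < n \<and> c * real j < y})"
    by (simp add: sum.If_cases of_bool_def Int_def lessThan_def)
  also have "\<dots> \<le> real (nat \<lceil>y / c\<rceil>)"
    using card_mono[OF _ sub] by simp
  also have "\<dots> \<le> y / c + 1"
    using assms by simp
  finally show ?thesis .
qed

context prob_space
begin

text \<open>Borel-Cantelli: the tail probabilities at the levels \<open>c * real j\<close> sum to at
  most the mean of \<open>L x / c + 1\<close>, which the logarithmic moment makes finite.\<close>

lemma AE_eventually_log_plus_le: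
  fixes Z :: "nat \<Rightarrow> 'a \<Rightarrow> 'b::euclidean_space"
  assumes Z [measurable]: "\<And>j. Z j \<in> borel_measurable M"
    and law: "\<And>j. distr M borel (Z j) = \<mu>"
    and log: "(\<integral>\<^sup>+ x. ennreal (log_plus (norm x)) \<partial>\<mu>) < \<infinity>"
    and "0 < c"
  shows "AE \<omega> in M. \<forall>\<^sub>F j in sequentially. log_plus (norm (Z j \<omega>)) \<le> c * real j"
proof -
  interpret \<mu>: prob_space \<mu>
    using prob_space_distr[OF Z] law by metis
  have sets_\<mu> [measurable_cong]: "sets \<mu> = sets borel"
    using law[of 0] by auto
  define L where "L = (\<lambda>x::'b. log_plus (norm x))"
  have [measurable]: "L \<in> borel_measurable borel"
    unfolding L_def by measurable
  have int_L: "integrable \<mu> L"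
    using log by (intro integrableI_nonneg) (auto simp: L_def log_plus_nonneg)
  define S where "S j = {\<omega> \<in> space M. c * real j < L (Z j \<omega>)}" for j
  have S [measurable]: "S j \<in> sets M" for j
    unfolding S_def by measurable
  have meas_S: "measure M (S j) = (\<integral>x. of_bool (c * real j < L x) \<partial>\<mu>)" for j
  proof -
    have "measure M (S j) = measure (distr M borel (Z j)) {x. c * real j < L x}"
      by (subst measure_distr) (auto simp: S_def vimage_def Int_def conj_commute)
    also have "\<dots> = (\<integral>x. indicator {x. c * real j < L x} x \<partial>\<mu>)"
      unfolding law by simp
    finally show ?thesis
      by (simp add: indicator_def)
  qed
  have "summable (\<lambda>j. measure M (S j))"
  proof (rule summableI_nonneg_bounded)
    fix n
    have int: "integrable \<mu> (\<lambda>x. of_bool (c * real j < L x) :: real)" for j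
      by (intro \<mu>.integrable_const_bound[where B = 1]) auto
    have "(\<Sum>j<n. measure M (S j)) = (\<integral>x. (\<Sum>j<n. of_bool (c * real j < L x)) \<partial>\<mu>)"
      unfolding meas_S using int by (intro Bochner_Integration.integral_sum[symmetric])
    also have "\<dots> \<le> (\<integral>x. L x / c + 1 \<partial>\<mu>)"
      using sum_indicator_multiples_le[OF \<open>0 < c\<close>] int int_L
      by (intro integral_mono Bochner_Integration.integrable_sum Bochner_Integration.integrable_add)
        (auto simp: L_def log_plus_nonneg)
    finally show "(\<Sum>j<n. measure M (S j)) \<le> (\<integral>x. L x / c + 1 \<partial>\<mu>)" .
  qed simp
  then have "AE \<omega> in M. \<forall>\<^sub>F j in sequentially. \<omega> \<in> space M - S j"
    by (intro borel_cantelli_AE1) (auto simp: less_top[symmetric])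
  then show ?thesis
    by eventually_elim (auto simp: S_def L_def not_less elim: eventually_mono)
qed

text \<open>The logarithmic moment keeps the norm of \<open>Z j\<close> eventually below
  \<open>exp (c * real j)\<close> for every positive \<open>c\<close>, so geometric decay of the
  matrices wins.\<close>

lemma AE_summable_matrix_series:
  fixes Z :: "nat \<Rightarrow> 'a \<Rightarrow> real^'n" and P :: "nat \<Rightarrow> real^'n^'m"
  assumes Z [measurable]: "\<And>j. Z j \<in> borel_measurable M"
    and law: "\<And>j. distr M borel (Z j) = \<mu>"
    and log: "(\<integral>\<^sup>+ x. ennreal (log_plus (norm x)) \<partial>\<mu>) < \<infinity>"
    and P: "\<And>j. norm (P j) \<le> C * t ^ j" and t: "0 < t" "t < 1"
  shows "AE \<omega> in M. summable (\<lambda>j. P j *v Z j \<omega>)"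
proof -
  \<comment> \<open>Half the decay rate: \<open>t * exp c\<close> is then the square root of
    \<open>t\<close>, still below 1.\<close>
  define c where "c = - ln t / 2"
  have "0 < c" using t by (simp add: c_def)
  have "t * exp c = exp (ln t + c)"
    using t(1) by (simp add: exp_add)
  also have "\<dots> < 1"
    using t by (simp add: c_def)
  finally have tc: "0 < t * exp c" "t * exp c < 1"
    using t by auto
  have "AE \<omega> in M. \<forall>\<^sub>F j in sequentially. log_plus (norm (Z j \<omega>)) \<le> c * real j"
    by (rule AE_eventually_log_plus_le[OF Z law log \<open>0 < c\<close>])
  then show ?thesis
  proof eventually_elim
    case (elim \<omega>)
    have "\<forall>\<^sub>F j in sequentially. norm (P j *v Z j \<omega>) \<le> C * (t * exp c) ^ j"
      using elim
    proof eventually_elim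
      case (elim j)
      have "norm (Z j \<omega>) \<le> exp (c * real j)"
        using le_exp_log_plus[of "norm (Z j \<omega>)"] elim by (meson exp_le_cancel_iff order_trans)
      then have "norm (P j) * norm (Z j \<omega>) \<le> (C * t ^ j) * exp (c * real j)"
        using P[of j] order_trans[OF norm_ge_zero P[of j]] by (intro mult_mono) auto
      also have "\<dots> = C * (t * exp c) ^ j"
        by (simp add: power_mult_distrib exp_of_nat2_mult)
      finally show ?case
        using norm_matrix_vector_mult_le[of "P j" "Z j \<omega>"] by linarith
    qed
    moreover have "summable (\<lambda>j. C * (t * exp c) ^ j)"
      using tc by (intro summable_mult summable_geometric) auto
    ultimately show ?case
      by (rule summable_comparison_test_ev)
  qed
qed

lemma indep_var_if_indep_subalgebras:
  assumes "subalgebra M H" "subalgebra M K" and indep: "indep_set (sets H) (sets K)"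
    and X: "X \<in> measurable H S" and Y: "Y \<in> measurable K T"
  shows "indep_var S X T Y"
proof -
  have H: "{X -` A \<inter> space M |A. A \<in> sets S} \<subseteq> sets H" and K: "{Y -` A \<inter> space M |A. A \<in> sets T} \<subseteq> sets K"
    using assms measurable_sets[OF X] measurable_sets[OF Y] by (auto simp: subalgebra_def)
  have "sigma_sets (space M) {X -` A \<inter> space M |A. A \<in> sets S} \<subseteq> sets H"
    using sets.sigma_sets_subset[OF H] assms(1) by (simp add: subalgebra_def)
  moreover have "sigma_sets (space M) {Y -` A \<inter> space M |A. A \<in> sets T} \<subseteq> sets K"
    using sets.sigma_sets_subset[OF K] assms(2) by (simp add: subalgebra_def)
  ultimately have "indep_set (sigma_sets (space M) {X -` A \<inter> space M |A. A \<in> sets S})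
      (sigma_sets (space M) {Y -` A \<inter> space M |A. A \<in> sets T})"
    using indep unfolding indep_sets2_eq by blast
  moreover have "X \<in> measurable M S" "Y \<in> measurable M T"
    using measurable_from_subalg assms by blast+
  ultimately show ?thesis
    unfolding indep_var_eq by blast
qed

lemma char_partial_sum:
  fixes Z :: "nat \<Rightarrow> 'a \<Rightarrow> real^'n" and P :: "nat \<Rightarrow> real^'n^'m"
  assumes Z [measurable]: "\<And>j. Z j \<in> borel_measurable M"
    and law: "\<And>j. distr M borel (Z j) = \<mu>"
    and indep: "indep_vars (\<lambda>_. borel) Z UNIV"
  shows "(\<integral>\<omega>. iexp (\<theta> \<bullet> (\<Sum>j<r. P j *v Z j \<omega>)) \<partial>M) = (\<Prod>j<r. \<integral>x. iexp (\<theta> \<bullet> (P j *v x)) \<partial>\<mu>)"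
proof -
  have "indep_vars (\<lambda>_. borel) (\<lambda>j \<omega>. iexp (\<theta> \<bullet> (P j *v Z j \<omega>))) {..<r}"
    by (rule indep_vars_compose2[OF indep_vars_subset[OF indep]]) auto
  moreover have "integrable M (\<lambda>\<omega>. iexp (\<theta> \<bullet> (P j *v Z j \<omega>)))" for j
    by (intro integrable_const_bound[where B = 1]) auto
  ultimately have "(\<integral>\<omega>. (\<Prod>j<r. iexp (\<theta> \<bullet> (P j *v Z j \<omega>))) \<partial>M) =
      (\<Prod>j<r. \<integral>\<omega>. iexp (\<theta> \<bullet> (P j *v Z j \<omega>)) \<partial>M)"
    by (intro indep_vars_lebesgue_integral) auto
  moreover have "(\<integral>\<omega>. iexp (\<theta> \<bullet> (P j *v Z j \<omega>)) \<partial>M) = (\<integral>x. iexp (\<theta> \<bullet> (P j *v x)) \<partial>\<mu>)" for j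
    unfolding law[of j, symmetric] by (subst integral_distr) auto
  moreover have "(\<Prod>j<r. iexp (\<theta> \<bullet> (P j *v Z j \<omega>))) = iexp (\<theta> \<bullet> (\<Sum>j<r. P j *v Z j \<omega>))" for \<omega>
    by (simp add: exp_sum[symmetric] inner_sum_right sum_distrib_left)
  ultimately show ?thesis
    by simp
qed

lemma char_series_tendsto:
  fixes Y :: "nat \<Rightarrow> 'a \<Rightarrow> 'b::euclidean_space"
  assumes [measurable]: "\<And>j. Y j \<in> borel_measurable M" and sum: "AE \<omega> in M. summable (\<lambda>j. Y j \<omega>)"
  shows "(\<lambda>r. \<integral>\<omega>. iexp (\<theta> \<bullet> (\<Sum>j<r. Y j \<omega>)) \<partial>M) \<longlonglongrightarrow> (\<integral>\<omega>. iexp (\<theta> \<bullet> (\<Sum>j. Y j \<omega>)) \<partial>M)"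
proof (rule integral_dominated_convergence[where w = "\<lambda>_. 1"])
  show "AE \<omega> in M. (\<lambda>r. iexp (\<theta> \<bullet> (\<Sum>j<r. Y j \<omega>))) \<longlonglongrightarrow> iexp (\<theta> \<bullet> (\<Sum>j. Y j \<omega>))"
    using sum by eventually_elim (intro tendsto_intros summable_LIMSEQ)
qed auto

end

subsection \<open>Limits of weighted characteristic functions\<close>

text \<open>\<open>\<theta> v* A\<close> is the transpose of \<open>A\<close> applied to \<theta>;
  pair it with itself and cancel one factor.\<close>

lemma norm_vector_matrix_mult_le: "norm (\<theta> v* A) \<le> norm \<theta> * norm A" for A :: "real^'n^'m"
proof -
  have "norm (\<theta> v* A) * norm (\<theta> v* A) = \<theta> \<bullet> (A *v (\<theta> v* A))"
    by (simp add: dot_lmul_matrix[symmetric] power2_eq_square[symmetric] power2_norm_eq_inner)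
  also have "\<dots> \<le> norm \<theta> * (norm A * norm (\<theta> v* A))"
    by (intro order_trans[OF norm_cauchy_schwarz] mult_left_mono norm_matrix_vector_mult_le) simp
  finally show ?thesis
    by (cases "\<theta> v* A = 0") (auto simp: mult.assoc[symmetric])
qed

lemma borel_measurable_vector_matrix_mult [measurable (raw)]:
  fixes A :: "'a \<Rightarrow> real^'n^'m"
  assumes "A \<in> borel_measurable M"
  shows "(\<lambda>\<omega>. \<theta> v* A \<omega>) \<in> borel_measurable M"
proof -
  have "continuous_on UNIV (\<lambda>B::real^'n^'m. \<theta> v* B)"
    unfolding vector_matrix_mult_def by (intro continuous_on_vec_lambda continuous_intros)
  then show ?thesis
    using assms by (rule borel_measurable_continuous_on)
qed

lemma (in finite_measure) measure_tendsto_0_if_AE_eventually: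
  assumes [measurable]: "\<And>n. S n \<in> sets M" and ev: "AE \<omega> in M. \<forall>\<^sub>F n in sequentially. \<omega> \<notin> S n"
  shows "(\<lambda>n. measure M (S n)) \<longlonglongrightarrow> 0"
proof -
  have "(\<lambda>n. \<integral>\<omega>. indicator (S n) \<omega> \<partial>M) \<longlonglongrightarrow> (\<integral>\<omega>. (0::real) \<partial>M)"
  proof (rule integral_dominated_convergence[where w = "\<lambda>_. 1"])
    show "AE \<omega> in M. (\<lambda>n. indicator (S n) \<omega> :: real) \<longlonglongrightarrow> 0"
      using ev by eventually_elim (auto intro!: tendsto_eventually elim: eventually_mono)
  qed auto
  then show ?thesis by simp
qed

lemma (in prob_space) tight_sequence_if_stochastically_bounded:
  assumes "stochastically_bounded M X"
  shows "tight_sequence M X"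
  unfolding tight_sequence_def
proof (intro allI impI)
  fix e :: real assume "0 < e"
  let ?p = "\<lambda>K n. measure M {\<omega> \<in> space M. K < norm (X n \<omega>)}"
  have "\<forall>\<^sub>F K in at_top. (SUP n\<in>{1..}. ?p K n) < e"
    using assms \<open>0 < e\<close> unfolding stochastically_bounded_def by (intro order_tendstoD(2)[of _ 0])
  then obtain K where K: "(SUP n\<in>{1..}. ?p K n) < e"
    by (auto simp: eventually_at_top_linorder)
  have "?p K n < e" if "1 \<le> n" for n
  proof -
    have "?p K n \<le> (SUP n\<in>{1..}. ?p K n)"
      using that by (intro cSUP_upper bdd_aboveI[of _ 1]) auto
    then show ?thesis using K by simp
  qed
  then show "\<exists>K. \<forall>\<^sub>F n in sequentially. ?p K n < e"
    by (auto simp: eventually_sequentially)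
qed

lemma (in finite_measure) weighted_integral_tendsto_0:
  fixes D E :: "nat \<Rightarrow> 'a \<Rightarrow> complex"
  assumes [measurable]: "\<And>n. D n \<in> borel_measurable M" "\<And>n. E n \<in> borel_measurable M"
    and DE: "\<And>n \<omega>. cmod (D n \<omega>) \<le> cmod (E n \<omega>)"
    and E: "converges_in_prob M E (\<lambda>_. 0)" "\<And>n. AE \<omega> in M. cmod (E n \<omega>) \<le> C"
    and \<xi>: "integrable M \<xi>"
  shows "(\<lambda>n. \<integral>\<omega>. \<xi> \<omega> *\<^sub>R D n \<omega> \<partial>M) \<longlonglongrightarrow> 0"
proof (rule Lim_null_comparison)
  show "\<forall>\<^sub>F n in sequentially. norm (\<integral>\<omega>. \<xi> \<omega> *\<^sub>R D n \<omega> \<partial>M) \<le> (\<integral>\<omega>. \<bar>\<xi> \<omega>\<bar> * norm (E n \<omega>) \<partial>M)"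
    using DE by (intro always_eventually allI norm_weighted_integral_le[OF \<xi> _ _ _ E(2)]) auto
  show "(\<lambda>n. \<integral>\<omega>. \<bar>\<xi> \<omega>\<bar> * norm (E n \<omega>) \<partial>M) \<longlonglongrightarrow> 0"
    by (rule converges_in_prob_weighted[OF E(1) _ E(2) \<xi>]) measurable
qed

text \<open>Conditional expectation is self-adjoint: it moves from \<open>h (X n \<omega>)\<close>
  to the weight, so \<open>H\<close>-measurable weights suffice and the conditional expectation
  disappears from the test.\<close>

lemma (in prob_space) converges_stablyI:
  fixes X :: "nat \<Rightarrow> 'a \<Rightarrow> 'b::euclidean_space"
  assumes H: "subalgebra M H" and X [measurable]: "\<And>n. X n \<in> borel_measurable M" "Y \<in> borel_measurable M"
    and lim: "\<And>(\<xi>::'a \<Rightarrow> real) (h::'b \<Rightarrow> real). integrable M \<xi> \<Longrightarrow> \<xi> \<in> borel_measurable H \<Longrightarrow> continuous_on UNIV h \<Longrightarrow> bounded (range h) \<Longrightarrow>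
      (\<lambda>n. \<integral>\<omega>. \<xi> \<omega> * h (X n \<omega>) \<partial>M) \<longlonglongrightarrow> (\<integral>\<omega>. \<xi> \<omega> * h (Y \<omega>) \<partial>M)"
  shows "converges_stably M H X Y"
  unfolding converges_stably_def
proof (intro conjI allI impI H X)
  interpret H: finite_measure_subalgebra M H
    by unfold_locales (rule H)
  fix \<xi> :: "'a \<Rightarrow> real" and h :: "'b \<Rightarrow> real"
  assume \<xi>: "integrable M \<xi>" and h: "continuous_on UNIV h" "bounded (range h)"
  have [measurable]: "h \<in> borel_measurable borel"
    using h(1) by (rule borel_measurable_continuous_onI)
  have [measurable]: "\<xi> \<in> borel_measurable M" using \<xi> by auto
  define \<xi>' where "\<xi>' = real_cond_exp M H \<xi>"
  have \<xi>': "integrable M \<xi>'" "\<xi>' \<in> borel_measurable H"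
    unfolding \<xi>'_def using H.real_cond_exp_int(1)[OF \<xi>] by auto
  obtain C where C: "\<And>x. \<bar>h x\<bar> \<le> C"
    using h(2) by (auto simp: bounded_iff)
  have eq: "(\<integral>\<omega>. \<xi> \<omega> * real_cond_exp M H (\<lambda>\<omega>. h (V \<omega>)) \<omega> \<partial>M) = (\<integral>\<omega>. \<xi>' \<omega> * h (V \<omega>) \<partial>M)"
    if [measurable]: "V \<in> borel_measurable M" for V
  proof -
    let ?c = "real_cond_exp M H (\<lambda>\<omega>. h (V \<omega>))"
    have int_h: "integrable M (\<lambda>\<omega>. h (V \<omega>))"
      using C by (intro integrable_const_bound[where B = C]) auto
    have "AE \<omega> in M. ?c \<omega> \<le> C" "AE \<omega> in M. - C \<le> ?c \<omega>"
      using C by (auto intro!: H.real_cond_exp_le_c H.real_cond_exp_ge_c int_h simp: abs_le_iff minus_le_iff)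
    then have c: "AE \<omega> in M. norm (?c \<omega>) \<le> C"
      by eventually_elim auto
    have int1: "integrable M (\<lambda>\<omega>. ?c \<omega> * \<xi> \<omega>)"
      using integrable_scaleR_bounded[OF \<xi> _ c] by (simp add: mult.commute)
    have int2: "integrable M (\<lambda>\<omega>. \<xi>' \<omega> * h (V \<omega>))"
      using integrable_scaleR_bounded[OF \<xi>'(1), of "\<lambda>\<omega>. h (V \<omega>)" C] C by simp
    have "(\<integral>\<omega>. \<xi> \<omega> * ?c \<omega> \<partial>M) = (\<integral>\<omega>. ?c \<omega> * \<xi>' \<omega> \<partial>M)"
      unfolding \<xi>'_def using H.real_cond_exp_intg(2)[OF int1] by (simp add: mult.commute)
    also have "\<dots> = (\<integral>\<omega>. \<xi>' \<omega> * h (V \<omega>) \<partial>M)"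
      using H.real_cond_exp_intg(2)[OF int2 \<xi>'(2)] by (simp add: mult.commute)
    finally show ?thesis .
  qed
  show "(\<lambda>n. \<integral>\<omega>. \<xi> \<omega> * real_cond_exp M H (\<lambda>\<omega>. h (X n \<omega>)) \<omega> \<partial>M)
      \<longlonglongrightarrow> (\<integral>\<omega>. \<xi> \<omega> * real_cond_exp M H (\<lambda>\<omega>. h (Y \<omega>)) \<omega> \<partial>M)"
    unfolding eq[OF X(1)] eq[OF X(2)] by (rule lim[OF \<xi>' h])
qed

text \<open>The order of choices matters: \<open>r\<close> is fixed first, making the shrunken
  direction and the tail of the product negligible; for this \<open>r\<close> the accumulated error
  is a finite combination of null sequences, so \<open>n\<close> may go to infinity
  afterwards.\<close>

lemma (in finite_measure) weighted_char_limit_by_recursion: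
  fixes X :: "nat \<Rightarrow> 'a \<Rightarrow> real^'n" and P :: "real^'n^'n" and \<phi> :: "real^'n \<Rightarrow> complex"
  defines "\<psi> \<equiv> \<lambda>\<xi> n \<theta>. \<integral>\<omega>. \<xi> \<omega> *\<^sub>R iexp (\<theta> \<bullet> X n \<omega>) \<partial>M"
  assumes X: "tight_sequence M X" "\<And>n. X n \<in> borel_measurable M"
    and \<xi>: "integrable M \<xi>"
    and \<phi>: "\<And>\<theta>. cmod (\<phi> \<theta>) \<le> 1"
    and rec: "\<And>\<theta>. (\<lambda>n. \<psi> \<xi> (Suc n) \<theta> - \<phi> \<theta> * \<psi> \<xi> n (\<theta> v* P)) \<longlonglongrightarrow> 0"
    and P: "(\<lambda>r. matrix_power P r) \<longlonglongrightarrow> 0"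
    and prod: "(\<lambda>r. \<Prod>j<r. \<phi> (\<theta> v* matrix_power P j)) \<longlonglongrightarrow> c"
  shows "(\<lambda>n. \<psi> \<xi> n \<theta>) \<longlonglongrightarrow> c * of_real (\<integral>\<omega>. \<xi> \<omega> \<partial>M)"
proof (rule LIMSEQ_I)
  fix e :: real assume "0 < e"
  define \<Psi> where "\<Psi> r \<theta> = (\<Prod>j<r. \<phi> (\<theta> v* matrix_power P j))" for r \<theta>
  have \<Psi>_le: "cmod (\<Psi> r \<theta>) \<le> 1" for r \<theta>
    unfolding \<Psi>_def prod_norm[symmetric] by (intro prod_le_1) (auto simp: \<phi>)
  have iter: "(\<lambda>n. \<psi> \<xi> (n + r) \<theta> - \<Psi> r \<theta> * \<psi> \<xi> n (\<theta> v* matrix_power P r)) \<longlonglongrightarrow> 0" for r \<theta>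
  proof (induction r arbitrary: \<theta>)
    case 0
    then show ?case by (simp add: \<Psi>_def)
  next
    case (Suc r)
    \<comment> \<open>Splitting off the factor for j = 0 shifts the others by one \<open>P\<close>
      on the left, which fits \<open>matrix_power\<close> and turns the direction into
      \<open>\<theta> v* P\<close>.\<close>
    have \<Psi>_Suc: "\<Psi> (Suc r) \<theta> = \<phi> \<theta> * \<Psi> r (\<theta> v* P)"
      unfolding \<Psi>_def prod.lessThan_Suc_shift by (simp add: vector_matrix_mul_assoc)
    have "(\<lambda>n. (\<psi> \<xi> (Suc (n + r)) \<theta> - \<phi> \<theta> * \<psi> \<xi> (n + r) (\<theta> v* P)) +
        \<phi> \<theta> * (\<psi> \<xi> (n + r) (\<theta> v* P) - \<Psi> r (\<theta> v* P) * \<psi> \<xi> n (\<theta> v* P v* matrix_power P r))) \<longlonglongrightarrow> 0 + \<phi> \<theta> * 0"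
      by (intro tendsto_add tendsto_mult tendsto_const Suc LIMSEQ_ignore_initial_segment[OF rec])
    then show ?case
      by (simp add: \<Psi>_Suc vector_matrix_mul_assoc algebra_simps)
  qed
  define I where "I = complex_of_real (\<integral>\<omega>. \<xi> \<omega> \<partial>M)"
  have lim0: "(\<lambda>r. \<theta> v* matrix_power P r) \<longlonglongrightarrow> 0"
  proof (rule Lim_null_comparison)
    show "\<forall>\<^sub>F r in sequentially. norm (\<theta> v* matrix_power P r) \<le> norm \<theta> * norm (matrix_power P r)"
      by (intro always_eventually allI norm_vector_matrix_mult_le)
    show "(\<lambda>r. norm \<theta> * norm (matrix_power P r)) \<longlonglongrightarrow> 0"
      using tendsto_mult[OF tendsto_const tendsto_norm[OF P], of "norm \<theta>"] by simp
  qed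
  have "\<forall>\<^sub>F r in sequentially. \<forall>\<^sub>F n in sequentially. cmod (\<psi> \<xi> n (\<theta> v* matrix_power P r) - I) < e / 3"
    using weighted_iexp_perturbation[OF X \<xi>, of "\<lambda>r _. \<theta> v* matrix_power P r" "\<lambda>_. 0" "e / 3"] lim0 \<open>0 < e\<close>
    by (simp add: \<psi>_def I_def \<xi> scaleR_conv_of_real)
  \<comment> \<open>The summand 1 in the denominator keeps it positive when the weight has integral
    0.\<close>
  moreover have "\<forall>\<^sub>F r in sequentially. cmod (\<Psi> r \<theta> - c) < e / (3 * (cmod I + 1))"
    using tendstoD[OF prod, of "e / (3 * (cmod I + 1))"] \<open>0 < e\<close>
    by (simp add: dist_norm \<Psi>_def add_nonneg_pos)
  ultimately have "\<forall>\<^sub>F r in sequentially. (\<forall>\<^sub>F n in sequentially. cmod (\<psi> \<xi> n (\<theta> v* matrix_power P r) - I) < e / 3)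
      \<and> cmod (\<Psi> r \<theta> - c) < e / (3 * (cmod I + 1))"
    by (rule eventually_conj)
  from eventually_happens'[OF sequentially_bot this]
  obtain r where r: "\<forall>\<^sub>F n in sequentially. cmod (\<psi> \<xi> n (\<theta> v* matrix_power P r) - I) < e / 3"
    "cmod (\<Psi> r \<theta> - c) < e / (3 * (cmod I + 1))"
    by blast
  have "\<forall>\<^sub>F n in sequentially. cmod (\<psi> \<xi> (n + r) \<theta> - \<Psi> r \<theta> * \<psi> \<xi> n (\<theta> v* matrix_power P r)) < e / 3"
    using tendstoD[OF iter, of "e / 3" r \<theta>] \<open>0 < e\<close> by (simp add: dist_norm)
  then have "\<forall>\<^sub>F n in sequentially. cmod (\<psi> \<xi> (n + r) \<theta> - c * I) < e"
    using r(1)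
  proof eventually_elim
    case (elim n)
    let ?p = "\<psi> \<xi> n (\<theta> v* matrix_power P r)"
    have "cmod (\<Psi> r \<theta> * (?p - I)) \<le> 1 * cmod (?p - I)"
      unfolding norm_mult by (intro mult_right_mono \<Psi>_le) simp
    moreover have "cmod ((\<Psi> r \<theta> - c) * I) \<le> e / 3"
    proof -
      have "cmod (\<Psi> r \<theta> - c) * cmod I \<le> e / (3 * (cmod I + 1)) * (cmod I + 1)"
        using r(2) \<open>0 < e\<close> by (intro mult_mono) auto
      also have "\<dots> = e / 3"
        using norm_ge_zero[of I] by (simp add: add_nonneg_eq_0_iff field_simps)
      finally show ?thesis by (simp add: norm_mult)
    qed
    moreover have "\<psi> \<xi> (n + r) \<theta> - c * I =
        (\<psi> \<xi> (n + r) \<theta> - \<Psi> r \<theta> * ?p) + (\<Psi> r \<theta> * (?p - I) + (\<Psi> r \<theta> - c) * I)"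
      by (simp add: algebra_simps)
    moreover have "cmod \<dots> \<le> cmod (\<psi> \<xi> (n + r) \<theta> - \<Psi> r \<theta> * ?p) +
        (cmod (\<Psi> r \<theta> * (?p - I)) + cmod ((\<Psi> r \<theta> - c) * I))"
      by (intro order_trans[OF norm_triangle_ineq] add_left_mono norm_triangle_ineq)
    ultimately show ?case
      using elim by (simp only:)
  qed
  then have "\<forall>\<^sub>F n in sequentially. cmod (\<psi> \<xi> n \<theta> - c * I) < e"
    by (rule eventually_sequentially_seg[THEN iffD1])
  then show "\<exists>n0. \<forall>n\<ge>n0. cmod (\<psi> \<xi> n \<theta> - c * complex_of_real (\<integral>\<omega>. \<xi> \<omega> \<partial>M)) < e"
    by (simp add: I_def eventually_sequentially)
qed

text \<open>For a direction with finitely many values, the indicator of each level set is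
  \<open>H\<close>-measurable and is absorbed into the weight, leaving a constant direction on each
  piece. Tightness makes the approximation of \<zeta> by such directions uniform in large
  \<open>n\<close>.\<close>

lemma (in finite_measure) weighted_char_random_direction:
  fixes X :: "nat \<Rightarrow> 'a \<Rightarrow> 'b::euclidean_space"
  assumes H: "subalgebra M H"
    and tight: "tight_sequence M X"
    and X [measurable]: "\<And>n. X n \<in> borel_measurable M" "Y \<in> borel_measurable M"
    and cf: "\<And>\<xi> \<theta>. integrable M \<xi> \<Longrightarrow> \<xi> \<in> borel_measurable H \<Longrightarrow>
      (\<lambda>n. \<integral>\<omega>. \<xi> \<omega> *\<^sub>R iexp (\<theta> \<bullet> X n \<omega>) \<partial>M) \<longlonglongrightarrow> (\<integral>\<omega>. \<xi> \<omega> *\<^sub>R iexp (\<theta> \<bullet> Y \<omega>) \<partial>M)"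
    and \<xi>: "integrable M \<xi>" "\<xi> \<in> borel_measurable H"
    and \<zeta>: "\<zeta> \<in> borel_measurable H"
  shows "(\<lambda>n. \<integral>\<omega>. \<xi> \<omega> *\<^sub>R iexp (\<zeta> \<omega> \<bullet> X n \<omega>) \<partial>M) \<longlonglongrightarrow> (\<integral>\<omega>. \<xi> \<omega> *\<^sub>R iexp (\<zeta> \<omega> \<bullet> Y \<omega>) \<partial>M)"
proof (rule LIMSEQ_I)
  fix e :: real assume "0 < e"
  have space: "space H = space M" using H by (simp add: subalgebra_def)
  obtain s where s: "\<And>k. simple_function H (s k)" "\<And>\<omega>. \<omega> \<in> space H \<Longrightarrow> (\<lambda>k. s k \<omega>) \<longlonglongrightarrow> \<zeta> \<omega>"
    using borel_measurable_implies_sequence_metric[OF \<zeta>, of 0] by blast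
  have s_H: "s k \<in> borel_measurable H" for k
    using s(1) by (rule borel_measurable_simple_function)
  note s_M [measurable] = measurable_from_subalg[OF H s_H] and \<zeta>_M [measurable] = measurable_from_subalg[OF H \<zeta>]
  define J where "J \<zeta> V = (\<integral>\<omega>. \<xi> \<omega> *\<^sub>R iexp (\<zeta> \<omega> \<bullet> V \<omega>) \<partial>M)" for \<zeta> V :: "'a \<Rightarrow> 'b"
  have simple: "(\<lambda>n. J (s k) (X n)) \<longlonglongrightarrow> J (s k) Y" for k
  proof -
    let ?R = "s k ` space M"
    define \<xi>' where "\<xi>' a \<omega> = \<xi> \<omega> * indicator (s k -` {a} \<inter> space M) \<omega>" for a \<omega>
    have fin: "finite ?R"
      using s(1)[of k] by (simp add: simple_function_def space)
    have [measurable]: "s k -` {a} \<inter> space M \<in> sets H" for a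
      using measurable_sets[OF s_H, of "{a}" k] by (simp add: space)
    then have S_M: "s k -` {a} \<inter> space M \<in> sets M" for a
      using H unfolding subalgebra_def by blast
    have \<xi>'_int: "integrable M (\<xi>' a)" for a
      unfolding \<xi>'_def using \<xi>(1) S_M by (intro integrable_real_mult_indicator)
    have \<xi>'_H: "\<xi>' a \<in> borel_measurable H" for a
      unfolding \<xi>'_def using \<xi>(2) by measurable
    have decomp: "J (s k) V = (\<Sum>a\<in>?R. \<integral>\<omega>. \<xi>' a \<omega> *\<^sub>R iexp (a \<bullet> V \<omega>) \<partial>M)"
      if V: "V \<in> borel_measurable M" for V
    proof -
      have "\<xi> \<omega> *\<^sub>R iexp (s k \<omega> \<bullet> V \<omega>) = (\<Sum>a\<in>?R. \<xi>' a \<omega> *\<^sub>R iexp (a \<bullet> V \<omega>))" if "\<omega> \<in> space M" for \<omega>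
      proof -
        have "(\<Sum>a\<in>?R. \<xi>' a \<omega> *\<^sub>R iexp (a \<bullet> V \<omega>)) =
            (\<Sum>a\<in>?R. if s k \<omega> = a then \<xi> \<omega> *\<^sub>R iexp (a \<bullet> V \<omega>) else 0)"
          using that by (intro sum.cong) (auto simp: \<xi>'_def indicator_def)
        then show ?thesis
          using fin that by simp
      qed
      then have "J (s k) V = (\<integral>\<omega>. (\<Sum>a\<in>?R. \<xi>' a \<omega> *\<^sub>R iexp (a \<bullet> V \<omega>)) \<partial>M)"
        unfolding J_def by (intro Bochner_Integration.integral_cong) auto
      also have "\<dots> = (\<Sum>a\<in>?R. \<integral>\<omega>. \<xi>' a \<omega> *\<^sub>R iexp (a \<bullet> V \<omega>) \<partial>M)"
        using V by (intro Bochner_Integration.integral_sum integrable_weighted_iexp \<xi>'_int) auto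
      finally show ?thesis .
    qed
    show ?thesis
      unfolding decomp[OF X(1)] decomp[OF X(2)]
      by (intro tendsto_sum cf \<xi>'_int \<xi>'_H)
  qed
  have "\<forall>\<^sub>F k in sequentially. \<forall>\<^sub>F n in sequentially. cmod (J (s k) (X n) - J \<zeta> (X n)) < e / 3"
    unfolding J_def using s(2) \<open>0 < e\<close>
    by (intro weighted_iexp_perturbation[OF tight X(1) \<xi>(1) s_M \<zeta>_M]) (auto simp: space)
  \<comment> \<open>The limit \<open>Y\<close>, viewed as a constant sequence, falls under the same
    perturbation lemma.\<close>
  moreover have "\<forall>\<^sub>F k in sequentially. \<forall>\<^sub>F n::nat in sequentially. cmod (J (s k) Y - J \<zeta> Y) < e / 3"
    unfolding J_def using s(2) \<open>0 < e\<close>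
    by (intro weighted_iexp_perturbation[OF tight_sequence_const[OF X(2)] X(2) \<xi>(1) s_M \<zeta>_M]) (auto simp: space)
  ultimately have "\<forall>\<^sub>F k in sequentially. (\<forall>\<^sub>F n in sequentially. cmod (J (s k) (X n) - J \<zeta> (X n)) < e / 3)
      \<and> cmod (J (s k) Y - J \<zeta> Y) < e / 3"
    by eventually_elim simp
  from eventually_happens'[OF sequentially_bot this]
  obtain k where k: "\<forall>\<^sub>F n in sequentially. cmod (J (s k) (X n) - J \<zeta> (X n)) < e / 3"
    "cmod (J (s k) Y - J \<zeta> Y) < e / 3"
    by blast
  have "\<forall>\<^sub>F n in sequentially. dist (J (s k) (X n)) (J (s k) Y) < e / 3"
    using tendstoD[OF simple, of "e / 3"] \<open>0 < e\<close> by simp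
  with k(1) have "\<forall>\<^sub>F n in sequentially. cmod (J \<zeta> (X n) - J \<zeta> Y) < e"
  proof eventually_elim
    case (elim n)
    have "cmod (u - x) \<le> cmod (v - u) + (cmod (v - w) + cmod (w - x))" for u v w x :: complex
      using norm_triangle_ineq[of "u - v" "v - x"] norm_triangle_ineq[of "v - w" "w - x"]
      by (simp add: norm_minus_commute)
    from this[of "J \<zeta> (X n)" "J \<zeta> Y" "J (s k) (X n)" "J (s k) Y"] show ?case
      using elim k(2) unfolding dist_norm by linarith
  qed
  then show "\<exists>n0. \<forall>n\<ge>n0. cmod ((\<integral>\<omega>. \<xi> \<omega> *\<^sub>R iexp (\<zeta> \<omega> \<bullet> X n \<omega>) \<partial>M) - (\<integral>\<omega>. \<xi> \<omega> *\<^sub>R iexp (\<zeta> \<omega> \<bullet> Y \<omega>) \<partial>M)) < e"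
    by (simp add: J_def eventually_sequentially)
qed

context prob_space
begin

context
  fixes A assumes A [measurable]: "A \<in> sets M" and A_pos: "0 < measure M A"
begin

text \<open>As a density, conditioning on \<open>A\<close> becomes one more factor in the weight of
  an integral over \<open>M\<close>.\<close>

lemma uniform_measure_eq_density:
  "uniform_measure M A = density M (\<lambda>\<omega>. ennreal (indicator A \<omega> / measure M A))"
  unfolding uniform_measure_def using A_pos
  by (intro density_cong) (auto simp: emeasure_eq_measure divide_ennreal indicator_def simp flip: ennreal_1)

lemma integrable_uniform_measure:
  fixes f :: "'a \<Rightarrow> 'b::{banach, second_countable_topology}"
  assumes "f \<in> borel_measurable M"
  shows "integrable (uniform_measure M A) f \<longleftrightarrow> integrable M (\<lambda>\<omega>. (indicator A \<omega> / measure M A) *\<^sub>R f \<omega>)"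
  unfolding uniform_measure_eq_density using assms by (intro integrable_density) auto

lemma integral_uniform_measure:
  fixes f :: "'a \<Rightarrow> 'b::{banach, second_countable_topology}"
  assumes "f \<in> borel_measurable M"
  shows "(\<integral>\<omega>. f \<omega> \<partial>uniform_measure M A) = (\<integral>\<omega>. (indicator A \<omega> / measure M A) *\<^sub>R f \<omega> \<partial>M)"
  unfolding uniform_measure_eq_density using assms by (intro integral_density) auto

lemma measure_uniform:
  "S \<in> sets M \<Longrightarrow> measure (uniform_measure M A) S = measure M (A \<inter> S) / measure M A"
  using A_pos by (intro measure_uniform_measure) (auto simp: emeasure_eq_measure)

lemma prob_space_uniform: "prob_space (uniform_measure M A)"
  using A_pos by (intro prob_space_uniform_measure) (auto simp: emeasure_eq_measure)

lemma AE_uniform: "AE \<omega> in M. Pr \<omega> \<Longrightarrow> AE \<omega> in uniform_measure M A. Pr \<omega>"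
  by (rule AE_uniform_measureI[OF A]) auto

text \<open>For \<open>A \<subseteq> G\<close> the measure conditioned on \<open>A\<close> is at
  most \<open>measure M G / measure M A\<close> times the one conditioned on \<open>G\<close>. This
  transports \<open>i\<close> and \<open>iii\<close> from \<open>G\<close> to
  \<open>A\<close>.\<close>

lemma converges_in_prob_uniform_mono:
  fixes X :: "nat \<Rightarrow> 'a \<Rightarrow> 'b::{metric_space, second_countable_topology}"
  assumes [measurable]: "\<And>n. X n \<in> borel_measurable M" "Y \<in> borel_measurable M"
    and G: "G \<in> sets M" "A \<subseteq> G" and conv: "converges_in_prob (uniform_measure M G) X Y"
  shows "converges_in_prob (uniform_measure M A) X Y"
  unfolding converges_in_prob_def
proof (intro allI impI)
  fix \<epsilon> :: real assume "0 < \<epsilon>"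
  define S where "S n = {\<omega> \<in> space M. \<epsilon> < dist (X n \<omega>) (Y \<omega>)}" for n
  have S [measurable]: "S n \<in> sets M" for n
    unfolding S_def by measurable
  have G_pos: "0 < measure M G"
    using A_pos finite_measure_mono[OF G(2,1)] by simp
  have G_lim: "(\<lambda>n. measure (uniform_measure M G) (S n)) \<longlonglongrightarrow> 0"
    using conv \<open>0 < \<epsilon>\<close> by (simp add: converges_in_prob_def S_def)
  have "(\<lambda>n. measure (uniform_measure M A) (S n)) \<longlonglongrightarrow> 0"
  proof (rule Lim_null_comparison)
    show "(\<lambda>n. measure M G / measure M A * measure (uniform_measure M G) (S n)) \<longlonglongrightarrow> 0"
      using tendsto_mult[OF tendsto_const G_lim, of "measure M G / measure M A"] by simp
    show "\<forall>\<^sub>F n in sequentially. norm (measure (uniform_measure M A) (S n)) \<le>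
        measure M G / measure M A * measure (uniform_measure M G) (S n)"
    proof (intro always_eventually allI)
      fix n
      have "measure (uniform_measure M G) (S n) = measure M (G \<inter> S n) / measure M G"
        using G_pos G(1) by (intro measure_uniform_measure) (auto simp: emeasure_eq_measure)
      then show "norm (measure (uniform_measure M A) (S n)) \<le>
          measure M G / measure M A * measure (uniform_measure M G) (S n)"
        using G_pos A_pos G finite_measure_mono[of "A \<inter> S n" "G \<inter> S n"]
        by (simp add: measure_uniform divide_right_mono le_infI1)
    qed
  qed
  then show "(\<lambda>n. measure (uniform_measure M A)
      {\<omega> \<in> space (uniform_measure M A). \<epsilon> < dist (X n \<omega>) (Y \<omega>)}) \<longlonglongrightarrow> 0"
    by (simp add: S_def)
qed

end

end

subsection \<open>The stable limit theorem\<close>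

theorem theorem1p4:
  fixes M :: "'a measure"
    and F :: "nat \<Rightarrow> 'a measure"
    and U :: "nat \<Rightarrow> 'a \<Rightarrow> real^'d"
    and B :: "nat \<Rightarrow> 'a \<Rightarrow> real^'d^'d"
    and Q :: "nat \<Rightarrow> real^'d^'d"
    and G :: "'a set"
    and \<eta> :: "'a \<Rightarrow> real^'d^'d"
    and P :: "real^'d^'d"
    and \<mu> :: "(real^'d) measure"
    and Z :: "nat \<Rightarrow> 'a \<Rightarrow> real^'d"
  defines "Finf \<equiv> sigma_infinity M F"
    and "A \<equiv> G \<inter> {\<omega> \<in> space M. invertible (\<eta> \<omega>)}"
  assumes prob: "prob_space M"
    and filtr: "filtration (space M) F" "\<And>n. subalgebra M (F n)"
    and adapted: "\<And>n. U n \<in> borel_measurable (F n)" "\<And>n. B n \<in> borel_measurable (F n)"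
    and B_inv: "AE \<omega> in M. \<forall>\<^sub>F n in sequentially. invertible (B n \<omega>)"
    and Q_lim: "Q \<longlonglongrightarrow> 0"
    and Q_inv: "\<forall>\<^sub>F n in sequentially. invertible (Q n)"
    and G: "G \<in> sets Finf" "measure M G > 0"
    and i: "\<eta> \<in> borel_measurable Finf" "measure M A > 0"
      "converges_in_prob (uniform_measure M G) (\<lambda>n \<omega>. Q n ** matrix_inv (B n \<omega>)) \<eta>"
    and ii: "stochastically_bounded (uniform_measure M A) (\<lambda>n \<omega>. Q n *v U n \<omega>)"
    and iii: "invertible P" "spectral_radius P < 1"
      "\<And>r. r \<ge> 1 \<Longrightarrow> converges_in_prob (uniform_measure M G)
         (\<lambda>n \<omega>. B n \<omega> ** matrix_inv (B (n - r) \<omega>)) (\<lambda>\<omega>. matrix_power P r)"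
    and iv: "prob_space \<mu>" "sets \<mu> = sets borel"
      "(\<integral>\<^sup>+ x. ennreal (log_plus (norm x)) \<partial>\<mu>) < \<infinity>"
      "\<And>\<theta>. converges_in_prob (uniform_measure M A)
         (\<lambda>n. complex_cond_exp M (F (n - 1)) (\<lambda>\<omega>. iexp (\<theta> \<bullet> (B n \<omega> *v increment U n \<omega>))))
         (\<lambda>\<omega>. \<integral>x. iexp (\<theta> \<bullet> x) \<partial>\<mu>)"
    and Z_rv: "\<And>j. Z j \<in> borel_measurable M"
    and Z_indep: "prob_space.indep_vars M (\<lambda>_. borel) Z UNIV"
    and Z_ident: "\<And>j. distr M borel (Z j) = distr M borel (Z 0)"
    and Z_law: "distr M borel (Z 0) = \<mu>"
    and Z_Finf: "prob_space.indep_set M (sigma_gen_seq M Z) (sets Finf)"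
  shows "converges_mixing (uniform_measure M A) Finf
           (\<lambda>n \<omega>. B n \<omega> *v U n \<omega>) (\<lambda>\<omega>. \<Sum>j. matrix_power P j *v Z j \<omega>) \<and>
         converges_stably (uniform_measure M A) Finf
           (\<lambda>n \<omega>. Q n *v U n \<omega>) (\<lambda>\<omega>. \<eta> \<omega> *v (\<Sum>j. matrix_power P j *v Z j \<omega>))"
proof -

  \<comment> \<open>Measurability and the conditioned measure\<close>
  interpret prob_space M by fact
  note [measurable] = Z_rv
  have F_mono: "sets (F m) \<subseteq> sets (F n)" if "m \<le> n" for m n
    using filtr(1) that by (auto simp: filtration_def)
  have Finf: "subalgebra M Finf"
    unfolding Finf_def by (rule subalgebra_sigma_infinity[OF filtr(2)])
  have Finf_M: "sets Finf \<subseteq> sets M" "space Finf = space M"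
    using Finf by (auto simp: subalgebra_def)
  note [measurable] = measurable_from_subalg[OF filtr(2) adapted(1)]
    measurable_from_subalg[OF filtr(2) adapted(2)] measurable_from_subalg[OF Finf i(1)]
  have det_meas [measurable]: "(det :: real^'d^'d \<Rightarrow> real) \<in> borel_measurable borel"
    by (intro borel_measurable_continuous_onI continuous_intros)
  \<comment> \<open>Essential for what follows: the indicator of \<open>A\<close> has to be an
    admissible part of a \<open>Finf\<close>-measurable weight.\<close>
  have A_Finf: "A \<in> sets Finf"
  proof -
    have "{\<omega> \<in> space Finf. det (\<eta> \<omega>) \<noteq> 0} \<in> sets Finf"
      using i(1) by measurable
    then show ?thesis
      unfolding A_def using G(1) by (auto simp: invertible_det_nz Finf_M)
  qed
  then have A [measurable]: "A \<in> sets M" and G_M: "G \<in> sets M"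
    using G(1) Finf_M by auto
  define N where "N = uniform_measure M A"
  interpret N: prob_space N
    unfolding N_def by (rule prob_space_uniform[OF A i(2)])
  have sets_N [measurable_cong]: "sets N = sets M" and space_N: "space N = space M"
    by (simp_all add: N_def)
  have Finf_N: "subalgebra N Finf"
    using Finf by (simp add: subalgebra_def sets_N space_N)
  have measurable_N: "f \<in> borel_measurable N" if "f \<in> borel_measurable M" for f :: "'a \<Rightarrow> 'z::topological_space"
    using that by simp

  \<comment> \<open>Algebraic relations between the normalised processes\<close>
  define W where "W n \<omega> = B n \<omega> *v increment U n \<omega>" for n \<omega>
  define X where "X n \<omega> = B n \<omega> *v U n \<omega>" for n \<omega>
  define V where "V n \<omega> = Q n *v U n \<omega>" for n \<omega>
  define R where "R n \<omega> = Q n ** matrix_inv (B n \<omega>)" for n \<omega>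
  define K where "K n \<omega> = B n \<omega> ** matrix_inv (B (n - 1) \<omega>)" for n \<omega>
  define Y where "Y \<omega> = (\<Sum>j. matrix_power P j *v Z j \<omega>)" for \<omega>
  \<comment> \<open>On \<open>J n\<close> the matrix \<open>matrix_inv (B n \<omega>)\<close> is
    only a default value, so \<open>V_eq\<close> and \<open>X_Suc\<close> are claimed off this
    event.\<close>
  define J where "J n = {\<omega> \<in> space M. \<not> invertible (B n \<omega>)}" for n
  have [measurable]: "increment U n \<in> borel_measurable M" for n
    unfolding increment_def[abs_def] by measurable
  have [measurable]: "W n \<in> borel_measurable M" "X n \<in> borel_measurable M" "V n \<in> borel_measurable M"
    "R n \<in> borel_measurable M" "K n \<in> borel_measurable M" for n
    unfolding W_def X_def V_def R_def K_def by measurable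
  have X_F: "X n \<in> borel_measurable (F n)" for n
    unfolding X_def using adapted by measurable
  have J_meas [measurable]: "J n \<in> sets M" for n
    unfolding J_def invertible_det_nz by measurable
  have J_sub: "\<omega> \<in> J n" if "\<omega> \<in> space M" "\<not> invertible (B n \<omega>)" for n \<omega>
    using that by (simp add: J_def)
  have V_eq: "R n \<omega> *v X n \<omega> = V n \<omega>" if "invertible (B n \<omega>)" for n \<omega>
    by (simp add: R_def X_def V_def matrix_vector_mul_assoc matrix_mul_assoc[symmetric]
        matrix_inv_left[OF that])
  \<comment> \<open>The step from \<open>n\<close> to \<open>Suc n\<close> inverts
    \<open>B n\<close> only, so its exceptional event is \<open>J n\<close>.\<close>
  have X_Suc: "X (Suc n) \<omega> = W (Suc n) \<omega> + K (Suc n) \<omega> *v X n \<omega>" if "invertible (B n \<omega>)" for n \<omega>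
  proof -
    have "K (Suc n) \<omega> *v X n \<omega> = B (Suc n) \<omega> *v ((matrix_inv (B n \<omega>) ** B n \<omega>) *v U n \<omega>)"
      by (simp add: K_def X_def matrix_vector_mul_assoc matrix_mul_assoc)
    then show ?thesis
      by (simp add: matrix_inv_left[OF that] W_def X_def increment_def matrix_vector_mult_diff_distrib)
  qed
  \<comment> \<open>The index from which \<open>B n\<close> is invertible depends on \<omega>;
    dominated convergence turns this into vanishing probability.\<close>
  have J_lim: "(\<lambda>n. measure N (J n)) \<longlonglongrightarrow> 0"
  proof (rule N.measure_tendsto_0_if_AE_eventually)
    show "AE \<omega> in N. \<forall>\<^sub>F n in sequentially. \<omega> \<notin> J n"
      unfolding N_def
      by (rule AE_uniform[OF A i(2)], use B_inv in eventually_elim) (auto simp: J_def elim: eventually_mono)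
  qed (simp add: sets_N)
  \<comment> \<open>In this form the estimate discharges every later premise about events where an
    identity or a domination fails.\<close>
  have bad_lim: "(\<lambda>n. measure N {\<omega> \<in> space N. Pr n \<omega>}) \<longlonglongrightarrow> 0"
    if "\<And>n \<omega>. \<omega> \<in> space M \<Longrightarrow> Pr n \<omega> \<Longrightarrow> \<not> invertible (B n \<omega>)" for Pr
  proof (rule Lim_null_comparison[OF _ J_lim])
    show "\<forall>\<^sub>F n in sequentially. norm (measure N {\<omega> \<in> space N. Pr n \<omega>}) \<le> measure N (J n)"
    proof (intro always_eventually allI)
      fix n
      have "measure N {\<omega> \<in> space N. Pr n \<omega>} \<le> measure N (J n)"
        using that by (intro N.finite_measure_mono) (auto simp: space_N J_meas sets_N J_sub)
      then show "norm (measure N {\<omega> \<in> space N. Pr n \<omega>}) \<le> measure N (J n)"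
        by simp
    qed
  qed

  \<comment> \<open>Convergence and tightness under the conditioned measure\<close>
  have R_lim: "converges_in_prob N R \<eta>"
    unfolding N_def using i(3)
    by (intro converges_in_prob_uniform_mono[OF A i(2) _ _ G_M]) (auto simp: A_def R_def[abs_def])
  have K_lim: "converges_in_prob N K (\<lambda>_. P)"
    unfolding N_def using iii(3)[of 1]
    by (intro converges_in_prob_uniform_mono[OF A i(2) _ _ G_M]) (auto simp: A_def K_def[abs_def])
  have V_tight: "tight_sequence N V"
    using ii unfolding V_def[abs_def] N_def[symmetric] by (rule N.tight_sequence_if_stochastically_bounded)
  have X_tight: "tight_sequence N X"
  proof (rule N.tight_sequence_inverse_image[OF _ _ _ _ R_lim _ V_tight])
    show "AE \<omega> in N. invertible (\<eta> \<omega>)"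
      unfolding N_def by (rule AE_uniform_measureI[OF A]) (auto simp: A_def)
    show "(\<lambda>n. measure N {\<omega> \<in> space N. R n \<omega> *v X n \<omega> \<noteq> V n \<omega>}) \<longlonglongrightarrow> 0"
      using V_eq by (intro bad_lim) auto
  qed simp_all

  \<comment> \<open>One step of the recursion for weighted characteristic functions\<close>
  define \<phi> where "\<phi> \<theta> = (\<integral>x. iexp (\<theta> \<bullet> x) \<partial>\<mu>)" for \<theta>
  have law: "distr M borel (Z j) = \<mu>" for j
    using Z_ident Z_law by simp
  interpret \<mu>: prob_space \<mu> by fact
  have \<phi>_le: "cmod (\<phi> \<theta>) \<le> 1" for \<theta>
  proof -
    have "cmod (\<phi> \<theta>) \<le> (\<integral>x. cmod (iexp (\<theta> \<bullet> x)) \<partial>\<mu>)"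
      unfolding \<phi>_def by (rule integral_norm_bound)
    then show ?thesis
      by (simp add: \<mu>.prob_space)
  qed
  define \<psi> where "\<psi> \<xi> n \<theta> = (\<integral>\<omega>. \<xi> \<omega> *\<^sub>R iexp (\<theta> \<bullet> X n \<omega>) \<partial>N)" for \<xi> n \<theta>
  have rec: "(\<lambda>n. \<psi> \<xi> (Suc n) \<theta> - \<phi> \<theta> * \<psi> \<xi> n (\<theta> v* P)) \<longlonglongrightarrow> 0"
    if \<xi>: "integrable N \<xi>" "\<xi> \<in> borel_measurable Finf" for \<xi> \<theta>
  proof -
    \<comment> \<open>Indices are shifted by one: \<open>g n\<close> contains the increment at time
      \<open>Suc n\<close>, so \<open>iv\<close> at \<open>Suc n\<close> conditions on
      \<open>F n\<close>, for which \<open>v n\<close> is measurable.\<close>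
    define g where "g n \<omega> = iexp (\<theta> \<bullet> W (Suc n) \<omega>)" for n \<omega>
    define v where "v n \<omega> = iexp ((\<theta> v* P) \<bullet> X n \<omega>)" for n \<omega>
    define \<kappa> where "\<kappa> n = complex_cond_exp M (F n) (g n)" for n
    have [measurable]: "g n \<in> borel_measurable M" "v n \<in> borel_measurable M" for n
      unfolding g_def v_def by measurable
    have g_le: "cmod (g n \<omega>) \<le> 1" and v_le: "cmod (v n \<omega>) \<le> 1" for n \<omega>
      by (simp_all add: g_def v_def)
    have v_F: "v n \<in> borel_measurable (F n)" for n
      unfolding v_def using X_F by measurable
    interpret F: finite_measure_subalgebra M "F n" for n
      by unfold_locales (rule filtr(2))
    have [measurable]: "\<kappa> n \<in> borel_measurable M" for n
      unfolding \<kappa>_def by measurable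
    have \<kappa>_le: "AE \<omega> in N. cmod (\<kappa> n \<omega>) \<le> 2" for n
      unfolding N_def \<kappa>_def using g_le by (intro AE_uniform[OF A i(2)] F.norm_complex_cond_exp_le) auto
    \<comment> \<open>Replaces \<open>K (Suc n)\<close> by its limit \<open>P\<close>: the error is
      a null sequence times the tight \<open>X n\<close>.\<close>
    have lim1: "(\<lambda>n. \<integral>\<omega>. \<xi> \<omega> *\<^sub>R (iexp (\<theta> \<bullet> X (Suc n) \<omega>) - v n \<omega> * g n \<omega>) \<partial>N) \<longlonglongrightarrow> 0"
    proof (rule N.weighted_integral_tendsto_0[OF _ _ order_refl _ _ \<xi>(1)])
      let ?D = "\<lambda>n \<omega>. iexp (\<theta> \<bullet> X (Suc n) \<omega>) - v n \<omega> * g n \<omega>"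
      have D_eq: "?D n \<omega> = iexp (\<theta> \<bullet> X (Suc n) \<omega>) - iexp (\<theta> \<bullet> (W (Suc n) \<omega> + P *v X n \<omega>))" for n \<omega>
        by (simp add: v_def g_def dot_lmul_matrix inner_add_right distrib_left exp_add mult.commute)
      show "AE \<omega> in N. cmod (?D n \<omega>) \<le> 2" for n
        unfolding D_eq using norm_iexp_diff_le_2 by blast
      have K_null: "converges_in_prob N (\<lambda>n \<omega>. K (Suc n) \<omega> - P) (\<lambda>_. 0)"
        unfolding converges_in_prob_0_iff
      proof (intro allI impI)
        fix \<epsilon> :: real assume "0 < \<epsilon>"
        then have "(\<lambda>n. measure N {\<omega> \<in> space N. dist (K n \<omega>) P > \<epsilon>}) \<longlonglongrightarrow> 0"
          using K_lim unfolding converges_in_prob_def by blast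
        from LIMSEQ_Suc[OF this] show "(\<lambda>n. measure N {\<omega> \<in> space N. \<epsilon> < norm (K (Suc n) \<omega> - P)}) \<longlonglongrightarrow> 0"
          by (simp add: dist_norm)
      qed
      show "converges_in_prob N ?D (\<lambda>_. 0)"
      proof (rule N.converges_in_prob_dominated[OF _ _ _ K_null X_tight])
        have "cmod (?D n \<omega>) \<le> norm \<theta> * (norm (K (Suc n) \<omega> - P) * norm (X n \<omega>))"
          if "invertible (B n \<omega>)" for n \<omega>
        proof -
          have "cmod (?D n \<omega>) \<le> \<bar>\<theta> \<bullet> X (Suc n) \<omega> - \<theta> \<bullet> (W (Suc n) \<omega> + P *v X n \<omega>)\<bar>"
            unfolding D_eq by (rule norm_iexp_diff_le)
          also have "\<dots> = \<bar>\<theta> \<bullet> ((K (Suc n) \<omega> - P) *v X n \<omega>)\<bar>"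
            by (simp add: X_Suc[OF that] matrix_vector_mult_diff_rdistrib inner_add_right inner_diff_right)
          also have "\<dots> \<le> norm \<theta> * (norm (K (Suc n) \<omega> - P) * norm (X n \<omega>))"
            by (intro order_trans[OF Cauchy_Schwarz_ineq2] mult_left_mono norm_matrix_vector_mult_le) simp
          finally show ?thesis .
        qed
        then show "(\<lambda>n. measure N {\<omega> \<in> space N. \<not> cmod (?D n \<omega>) \<le>
            norm \<theta> * (norm (K (Suc n) \<omega> - P) * norm (X n \<omega>))}) \<longlonglongrightarrow> 0"
          by (intro bad_lim) blast
      qed (simp_all add: measurable_N)
    qed (simp_all add: measurable_N)
    \<comment> \<open>Replaces \<open>g n\<close> by its conditional expectation under
      \<open>M\<close>. The density of \<open>N\<close> is moved into \<open>w\<close>, which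
      remains \<open>Finf\<close>-measurable because \<open>A\<close> is in
      \<open>Finf\<close>.\<close>
    have lim2: "(\<lambda>n. \<integral>\<omega>. \<xi> \<omega> *\<^sub>R (v n \<omega> * (g n \<omega> - \<kappa> n \<omega>)) \<partial>N) \<longlonglongrightarrow> 0"
    proof -
      define w where "w \<omega> = indicator A \<omega> / measure M A * \<xi> \<omega>" for \<omega>
      have \<xi>_M [measurable]: "\<xi> \<in> borel_measurable M"
        using measurable_from_subalg[OF Finf \<xi>(2)] .
      have w: "integrable M w"
        using \<xi>(1) integrable_uniform_measure[OF A i(2) \<xi>_M] by (simp add: w_def[abs_def] N_def)
      have w_Finf: "w \<in> borel_measurable (sigma_infinity M F)"
        using \<xi>(2) A_Finf unfolding w_def[abs_def] Finf_def by measurable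
      have "(\<lambda>n. \<integral>\<omega>. w \<omega> *\<^sub>R (v n \<omega> * (g n \<omega> - \<kappa> n \<omega>)) \<partial>M) \<longlonglongrightarrow> 0"
        unfolding \<kappa>_def
        by (rule weighted_martingale_difference_vanish[OF filtr(2) F_mono _ g_le v_F v_le w w_Finf]) auto
      moreover have "(\<integral>\<omega>. \<xi> \<omega> *\<^sub>R (v n \<omega> * (g n \<omega> - \<kappa> n \<omega>)) \<partial>N) =
          (\<integral>\<omega>. w \<omega> *\<^sub>R (v n \<omega> * (g n \<omega> - \<kappa> n \<omega>)) \<partial>M)" for n
        unfolding N_def by (subst integral_uniform_measure[OF A i(2)]) (auto simp: w_def)
      ultimately show ?thesis by simp
    qed
    \<comment> \<open>Replaces the conditional characteristic function by \<phi>, the factor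
      \<open>v n\<close> having modulus 1.\<close>
    have lim3: "(\<lambda>n. \<integral>\<omega>. \<xi> \<omega> *\<^sub>R (v n \<omega> * (\<kappa> n \<omega> - \<phi> \<theta>)) \<partial>N) \<longlonglongrightarrow> 0"
    proof (rule N.weighted_integral_tendsto_0[OF _ _ _ _ _ \<xi>(1), where E = "\<lambda>n \<omega>. \<kappa> n \<omega> - \<phi> \<theta>"])
      show "cmod (v n \<omega> * (\<kappa> n \<omega> - \<phi> \<theta>)) \<le> cmod (\<kappa> n \<omega> - \<phi> \<theta>)" for n \<omega>
        using mult_right_mono[OF v_le[of n \<omega>], of "cmod (\<kappa> n \<omega> - \<phi> \<theta>)"] by (simp add: norm_mult)
      show "AE \<omega> in N. cmod (\<kappa> n \<omega> - \<phi> \<theta>) \<le> 3" for n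
        using \<kappa>_le[of n]
      proof eventually_elim
        case (elim \<omega>)
        then show ?case
          using norm_triangle_ineq4[of "\<kappa> n \<omega>" "\<phi> \<theta>"] \<phi>_le[of \<theta>] by linarith
      qed
      show "converges_in_prob N (\<lambda>n \<omega>. \<kappa> n \<omega> - \<phi> \<theta>) (\<lambda>_. 0)"
        unfolding converges_in_prob_0_iff
      proof (intro allI impI)
        fix \<epsilon> :: real assume "0 < \<epsilon>"
        then have "(\<lambda>n. measure N {\<omega> \<in> space N. dist (complex_cond_exp M (F (n - 1))
            (\<lambda>\<omega>. iexp (\<theta> \<bullet> (B n \<omega> *v increment U n \<omega>))) \<omega>) (\<phi> \<theta>) > \<epsilon>}) \<longlonglongrightarrow> 0"
          using iv(4)[of \<theta>] unfolding converges_in_prob_def N_def[symmetric] \<phi>_def by blast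
        from LIMSEQ_Suc[OF this] show "(\<lambda>n. measure N {\<omega> \<in> space N. \<epsilon> < norm (\<kappa> n \<omega> - \<phi> \<theta>)}) \<longlonglongrightarrow> 0"
          by (simp add: dist_norm \<kappa>_def g_def[abs_def] W_def)
      qed
    qed (simp_all add: measurable_N)
    have "\<psi> \<xi> (Suc n) \<theta> - \<phi> \<theta> * \<psi> \<xi> n (\<theta> v* P) =
        (\<integral>\<omega>. \<xi> \<omega> *\<^sub>R (iexp (\<theta> \<bullet> X (Suc n) \<omega>) - v n \<omega> * g n \<omega>) \<partial>N) +
        ((\<integral>\<omega>. \<xi> \<omega> *\<^sub>R (v n \<omega> * (g n \<omega> - \<kappa> n \<omega>)) \<partial>N) +
         (\<integral>\<omega>. \<xi> \<omega> *\<^sub>R (v n \<omega> * (\<kappa> n \<omega> - \<phi> \<theta>)) \<partial>N))" for n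
    proof -
      have bounded: "integrable N (\<lambda>\<omega>. \<xi> \<omega> *\<^sub>R f \<omega>)"
        if "f \<in> borel_measurable M" "AE \<omega> in N. cmod (f \<omega>) \<le> 2" for f :: "'a \<Rightarrow> complex"
        using that by (intro integrable_scaleR_bounded[OF \<xi>(1)]) (auto simp: measurable_N)
      have v\<kappa>: "AE \<omega> in N. cmod (v n \<omega> * \<kappa> n \<omega>) \<le> 2"
        using \<kappa>_le[of n]
      proof eventually_elim
        case (elim \<omega>)
        then show ?case
          using mult_mono[OF v_le[of n \<omega>] elim] by (simp add: norm_mult)
      qed
      have int1: "integrable N (\<lambda>\<omega>. \<xi> \<omega> *\<^sub>R iexp (\<theta> \<bullet> X (Suc n) \<omega>))"
        by (intro bounded) auto
      have int2: "integrable N (\<lambda>\<omega>. \<xi> \<omega> *\<^sub>R (v n \<omega> * g n \<omega>))"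
        by (intro bounded) (auto simp: v_def g_def norm_mult)
      have int3: "integrable N (\<lambda>\<omega>. \<xi> \<omega> *\<^sub>R (v n \<omega> * \<kappa> n \<omega>))"
        using v\<kappa> by (intro bounded) auto
      have int4: "integrable N (\<lambda>\<omega>. \<phi> \<theta> * (\<xi> \<omega> *\<^sub>R v n \<omega>))"
        by (intro integrable_mult_right bounded) (auto simp: v_def)
      have eq4: "\<phi> \<theta> * \<psi> \<xi> n (\<theta> v* P) = (\<integral>\<omega>. \<phi> \<theta> * (\<xi> \<omega> *\<^sub>R v n \<omega>) \<partial>N)"
        unfolding \<psi>_def v_def by (rule integral_mult_right_zero[symmetric])
      have "(\<integral>\<omega>. \<xi> \<omega> *\<^sub>R (iexp (\<theta> \<bullet> X (Suc n) \<omega>) - v n \<omega> * g n \<omega>) \<partial>N) =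
          \<psi> \<xi> (Suc n) \<theta> - (\<integral>\<omega>. \<xi> \<omega> *\<^sub>R (v n \<omega> * g n \<omega>) \<partial>N)"
        unfolding \<psi>_def scaleR_diff_right by (rule Bochner_Integration.integral_diff[OF int1 int2])
      moreover have "(\<integral>\<omega>. \<xi> \<omega> *\<^sub>R (v n \<omega> * (g n \<omega> - \<kappa> n \<omega>)) \<partial>N) =
          (\<integral>\<omega>. \<xi> \<omega> *\<^sub>R (v n \<omega> * g n \<omega>) \<partial>N) - (\<integral>\<omega>. \<xi> \<omega> *\<^sub>R (v n \<omega> * \<kappa> n \<omega>) \<partial>N)"
        unfolding right_diff_distrib scaleR_diff_right by (rule Bochner_Integration.integral_diff[OF int2 int3])
      moreover have "(\<integral>\<omega>. \<xi> \<omega> *\<^sub>R (v n \<omega> * (\<kappa> n \<omega> - \<phi> \<theta>)) \<partial>N) =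
          (\<integral>\<omega>. \<xi> \<omega> *\<^sub>R (v n \<omega> * \<kappa> n \<omega>) - \<phi> \<theta> * (\<xi> \<omega> *\<^sub>R v n \<omega>) \<partial>N)"
        by (simp add: right_diff_distrib scaleR_diff_right mult.commute)
      moreover note Bochner_Integration.integral_diff[OF int3 int4]
      ultimately show ?thesis
        unfolding eq4 by simp
    qed
    then show ?thesis
      using tendsto_add[OF lim1 tendsto_add[OF lim2 lim3]] by simp
  qed

  \<comment> \<open>The infinite product as characteristic function of the series\<close>
  obtain C t where t: "0 < t" "t < 1" and P_le: "\<And>n. norm (matrix_power P n) \<le> C * t ^ n"
    using matrix_power_decay[OF iii(2)] by blast
  have P_lim: "(\<lambda>r. matrix_power P r) \<longlonglongrightarrow> 0"
  proof (rule Lim_null_comparison)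
    show "(\<lambda>n. C * t ^ n) \<longlonglongrightarrow> 0"
      using tendsto_mult[OF tendsto_const LIMSEQ_power_zero[of t], of C] t by simp
  qed (use P_le in auto)
  have sum: "AE \<omega> in M. summable (\<lambda>j. matrix_power P j *v Z j \<omega>)"
    by (rule AE_summable_matrix_series[OF Z_rv law iv(3) P_le t])
  define c where "c \<theta> = (\<integral>\<omega>. iexp (\<theta> \<bullet> Y \<omega>) \<partial>M)" for \<theta>
  \<comment> \<open>The partial products are the characteristic functions of the partial sums, so
    the product converges because the series does almost surely; no estimate of single factors
    enters.\<close>
  have prod_lim: "(\<lambda>r. \<Prod>j<r. \<phi> (\<theta> v* matrix_power P j)) \<longlonglongrightarrow> c \<theta>" for \<theta>
    using char_series_tendsto[OF _ sum, of \<theta>]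
    unfolding char_partial_sum[OF Z_rv law Z_indep] c_def Y_def \<phi>_def dot_lmul_matrix by simp
  have cf: "(\<lambda>n. \<psi> \<xi> n \<theta>) \<longlonglongrightarrow> c \<theta> * of_real (\<integral>\<omega>. \<xi> \<omega> \<partial>N)"
    if \<xi>: "integrable N \<xi>" "\<xi> \<in> borel_measurable Finf" for \<xi> \<theta>
    unfolding \<psi>_def
    by (rule N.weighted_char_limit_by_recursion[OF X_tight _ \<xi>(1) \<phi>_le rec[OF \<xi>, unfolded \<psi>_def] P_lim prod_lim])
      (simp add: measurable_N)

  \<comment> \<open>Independence of the series from \<open>Finf\<close> and the limit of
    \<open>X n\<close>\<close>
  define HZ where "HZ = sigma (space M) (\<Union>j. sigma_gen M (Z j))"
  have gen_sub: "(\<Union>j. sigma_gen M (Z j)) \<subseteq> sets M"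
    unfolding sigma_gen_def by (intro UN_least sets_image_in_sets) auto
  have space_HZ: "space HZ = space M"
    by (simp add: HZ_def space_measure_of_conv)
  have sets_HZ: "sets HZ = sigma_gen_seq M Z"
    unfolding HZ_def sigma_gen_seq_def
    by (rule sets_measure_of[OF order_trans[OF gen_sub sets.space_closed]])
  have HZ: "subalgebra M HZ"
    unfolding subalgebra_def sets_HZ sigma_gen_seq_def space_HZ
    using sets.sigma_sets_subset[OF gen_sub] by simp
  have Z_HZ [measurable]: "Z j \<in> borel_measurable HZ" for j
  proof (rule measurableI)
    fix S :: "(real^'d) set" assume "S \<in> sets borel"
    then have "Z j -` S \<inter> space M \<in> sigma_gen M (Z j)"
      unfolding sigma_gen_def by (rule in_vimage_algebra)
    then show "Z j -` S \<inter> space HZ \<in> sets HZ"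
      unfolding sets_HZ sigma_gen_seq_def space_HZ by (intro sigma_sets.Basic) blast
  qed simp
  \<comment> \<open>Measurability of \<open>suminf\<close> includes the null event where the series
    diverges, so \<open>Y\<close> itself, not just a modification, is measurable for the
    \<sigma>-field of the \<open>Z j\<close>.\<close>
  have Y_HZ: "Y \<in> borel_measurable HZ"
    unfolding Y_def by (intro borel_measurable_suminf borel_measurable_matrix_vector_mult) auto
  have Y_M [measurable]: "Y \<in> borel_measurable M"
    by (rule measurable_from_subalg[OF HZ Y_HZ])
  have indep: "indep_set (sets HZ) (sets Finf)"
    unfolding sets_HZ by fact
  \<comment> \<open>Independence holds under \<open>M\<close>, hence the return to \<open>M\<close>:
    the weight with the density of \<open>N\<close> included is \<open>Finf\<close>-measurable and
    independent of \<open>Y\<close>.\<close>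
  have Y_char: "(\<integral>\<omega>. \<xi> \<omega> *\<^sub>R iexp (\<theta> \<bullet> Y \<omega>) \<partial>N) = c \<theta> * of_real (\<integral>\<omega>. \<xi> \<omega> \<partial>N)"
    if \<xi>: "integrable N \<xi>" "\<xi> \<in> borel_measurable Finf" for \<xi> \<theta>
  proof -
    define w where "w \<omega> = indicator A \<omega> / measure M A * \<xi> \<omega>" for \<omega>
    have \<xi>_M [measurable]: "\<xi> \<in> borel_measurable M"
      using measurable_from_subalg[OF Finf \<xi>(2)] .
    have w: "integrable M w"
      using \<xi>(1) integrable_uniform_measure[OF A i(2) \<xi>_M] by (simp add: w_def[abs_def] N_def)
    have "(\<lambda>\<omega>. complex_of_real (w \<omega>)) \<in> borel_measurable Finf"
      using \<xi>(2) A_Finf unfolding w_def by measurable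
    moreover have "(\<lambda>\<omega>. iexp (\<theta> \<bullet> Y \<omega>)) \<in> borel_measurable HZ"
      using Y_HZ by measurable
    ultimately have "indep_var borel (\<lambda>\<omega>. iexp (\<theta> \<bullet> Y \<omega>)) borel (\<lambda>\<omega>. complex_of_real (w \<omega>))"
      by (intro indep_var_if_indep_subalgebras[OF HZ Finf indep])
    moreover have "integrable M (\<lambda>\<omega>. iexp (\<theta> \<bullet> Y \<omega>))"
      by (intro integrable_const_bound[where B = 1]) auto
    ultimately have "(\<integral>\<omega>. iexp (\<theta> \<bullet> Y \<omega>) * complex_of_real (w \<omega>) \<partial>M) =
        (\<integral>\<omega>. iexp (\<theta> \<bullet> Y \<omega>) \<partial>M) * (\<integral>\<omega>. complex_of_real (w \<omega>) \<partial>M)"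
      using w by (intro indep_var_lebesgue_integral) auto
    moreover have "(\<integral>\<omega>. \<xi> \<omega> *\<^sub>R iexp (\<theta> \<bullet> Y \<omega>) \<partial>N) = (\<integral>\<omega>. iexp (\<theta> \<bullet> Y \<omega>) * complex_of_real (w \<omega>) \<partial>M)"
      unfolding N_def
      by (subst integral_uniform_measure[OF A i(2)]) (auto simp: w_def scaleR_conv_of_real mult_ac)
    moreover have "(\<integral>\<omega>. \<xi> \<omega> \<partial>N) = (\<integral>\<omega>. w \<omega> \<partial>M)"
      unfolding N_def w_def[abs_def] by (subst integral_uniform_measure[OF A i(2)]) auto
    ultimately show ?thesis
      by (simp add: c_def)
  qed
  have cf_X: "(\<lambda>n. \<integral>\<omega>. \<xi> \<omega> *\<^sub>R iexp (\<theta> \<bullet> X n \<omega>) \<partial>N) \<longlonglongrightarrow> (\<integral>\<omega>. \<xi> \<omega> *\<^sub>R iexp (\<theta> \<bullet> Y \<omega>) \<partial>N)"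
    if "integrable N \<xi>" "\<xi> \<in> borel_measurable Finf" for \<xi> \<theta>
    using cf[OF that] unfolding Y_char[OF that] \<psi>_def .
  have stable_X: "converges_stably N Finf X Y"
    by (rule N.converges_stablyI[OF Finf_N], simp_all add: measurable_N)
      (rule N.weighted_continuity_theorem[OF X_tight _ _ _ cf_X], simp_all add: measurable_N)

  \<comment> \<open>The limit of \<open>Q n *v U n\<close>\<close>
  have cf_V: "(\<lambda>n. \<integral>\<omega>. \<xi> \<omega> *\<^sub>R iexp (\<theta> \<bullet> V n \<omega>) \<partial>N) \<longlonglongrightarrow>
      (\<integral>\<omega>. \<xi> \<omega> *\<^sub>R iexp (\<theta> \<bullet> (\<eta> \<omega> *v Y \<omega>)) \<partial>N)"
    if \<xi>: "integrable N \<xi>" "\<xi> \<in> borel_measurable Finf" for \<xi> \<theta>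
  proof -
    \<comment> \<open>The error of replacing \<open>R n\<close> by \<eta> in
      \<open>V n = R n *v X n\<close>, again null times tight.\<close>
    define D where "D n \<omega> = iexp (\<theta> \<bullet> V n \<omega>) - iexp (\<theta> \<bullet> (\<eta> \<omega> *v X n \<omega>))" for n \<omega>
    have D_M: "D n \<in> borel_measurable M" for n
      unfolding D_def by measurable
    have D_lim: "(\<lambda>n. \<integral>\<omega>. \<xi> \<omega> *\<^sub>R D n \<omega> \<partial>N) \<longlonglongrightarrow> 0"
    proof (rule N.weighted_integral_tendsto_0[OF _ _ order_refl _ _ \<xi>(1)])
      show "AE \<omega> in N. cmod (D n \<omega>) \<le> 2" for n
        unfolding D_def using norm_iexp_diff_le_2 by blast
      have R_null: "converges_in_prob N (\<lambda>n \<omega>. R n \<omega> - \<eta> \<omega>) (\<lambda>_. 0)"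
        using R_lim by (simp add: converges_in_prob_def dist_norm)
      show "converges_in_prob N D (\<lambda>_. 0)"
      proof (rule N.converges_in_prob_dominated[OF _ _ _ R_null X_tight])
        have "cmod (D n \<omega>) \<le> norm \<theta> * (norm (R n \<omega> - \<eta> \<omega>) * norm (X n \<omega>))"
          if "invertible (B n \<omega>)" for n \<omega>
        proof -
          have "cmod (D n \<omega>) \<le> \<bar>\<theta> \<bullet> V n \<omega> - \<theta> \<bullet> (\<eta> \<omega> *v X n \<omega>)\<bar>"
            unfolding D_def by (rule norm_iexp_diff_le)
          also have "\<dots> = \<bar>\<theta> \<bullet> ((R n \<omega> - \<eta> \<omega>) *v X n \<omega>)\<bar>"
            by (simp add: V_eq[OF that] matrix_vector_mult_diff_rdistrib inner_diff_right)
          also have "\<dots> \<le> norm \<theta> * (norm (R n \<omega> - \<eta> \<omega>) * norm (X n \<omega>))"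
            by (intro order_trans[OF Cauchy_Schwarz_ineq2] mult_left_mono norm_matrix_vector_mult_le) simp
          finally show ?thesis .
        qed
        then show "(\<lambda>n. measure N {\<omega> \<in> space N. \<not> cmod (D n \<omega>) \<le>
            norm \<theta> * (norm (R n \<omega> - \<eta> \<omega>) * norm (X n \<omega>))}) \<longlonglongrightarrow> 0"
          by (intro bad_lim) blast
      qed (simp_all add: measurable_N D_M)
    qed (simp_all add: measurable_N D_M)
    \<comment> \<open>Moving \<eta> to the other side of the inner product makes it part of a random
      direction, while the vector is \<open>X n\<close> with its limit \<open>Y\<close> already
      known.\<close>
    have \<theta>\<eta>: "(\<lambda>\<omega>. \<theta> v* \<eta> \<omega>) \<in> borel_measurable Finf"
      using i(1) by measurable
    have "(\<lambda>n. \<integral>\<omega>. \<xi> \<omega> *\<^sub>R iexp ((\<theta> v* \<eta> \<omega>) \<bullet> X n \<omega>) \<partial>N) \<longlonglongrightarrow>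
        (\<integral>\<omega>. \<xi> \<omega> *\<^sub>R iexp ((\<theta> v* \<eta> \<omega>) \<bullet> Y \<omega>) \<partial>N)"
      by (rule N.weighted_char_random_direction[OF Finf_N X_tight _ _ cf_X \<xi> \<theta>\<eta>]) (simp_all add: measurable_N)
    then have lim: "(\<lambda>n. \<integral>\<omega>. \<xi> \<omega> *\<^sub>R iexp (\<theta> \<bullet> (\<eta> \<omega> *v X n \<omega>)) \<partial>N) \<longlonglongrightarrow>
        (\<integral>\<omega>. \<xi> \<omega> *\<^sub>R iexp (\<theta> \<bullet> (\<eta> \<omega> *v Y \<omega>)) \<partial>N)"
      by (simp add: dot_lmul_matrix)
    have "(\<integral>\<omega>. \<xi> \<omega> *\<^sub>R D n \<omega> \<partial>N) =
        (\<integral>\<omega>. \<xi> \<omega> *\<^sub>R iexp (\<theta> \<bullet> V n \<omega>) \<partial>N) - (\<integral>\<omega>. \<xi> \<omega> *\<^sub>R iexp (\<theta> \<bullet> (\<eta> \<omega> *v X n \<omega>)) \<partial>N)" for n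
      unfolding D_def scaleR_diff_right
      by (intro Bochner_Integration.integral_diff integrable_weighted_iexp[OF \<xi>(1)]) (simp_all add: measurable_N)
    then show ?thesis
      using tendsto_add[OF D_lim lim] by simp
  qed
  have stable_V: "converges_stably N Finf V (\<lambda>\<omega>. \<eta> \<omega> *v Y \<omega>)"
    by (rule N.converges_stablyI[OF Finf_N], simp_all add: measurable_N)
      (rule N.weighted_continuity_theorem[OF V_tight _ _ _ cf_V], simp_all add: measurable_N)

  \<comment> \<open>Independence under the conditioned measure\<close>
  have gen_Y: "sigma_gen N Y \<subseteq> sets HZ"
    unfolding sigma_gen_def using HZ Y_HZ
    by (intro sets_image_in_sets) (auto simp: subalgebra_def space_N)
  have "N.indep_set (sigma_gen N Y) (sets Finf)"
    unfolding N.indep_sets2_eq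
  proof (intro conjI ballI)
    have "sets HZ \<subseteq> sets M" using HZ by (simp add: subalgebra_def)
    then show "sigma_gen N Y \<subseteq> sets N" "sets Finf \<subseteq> sets N"
      using gen_Y Finf_M by (auto simp: sets_N)
    fix a b assume "a \<in> sigma_gen N Y" and b: "b \<in> sets Finf"
    then have a: "a \<in> sets HZ" using gen_Y by blast
    have prod: "measure M (a \<inter> b') = measure M a * measure M b'" if "b' \<in> sets Finf" for b'
      using indep a that unfolding indep_sets2_eq by blast
    have [measurable]: "a \<in> sets M" "b \<in> sets M"
      using a b \<open>sets HZ \<subseteq> sets M\<close> Finf_M by auto
    \<comment> \<open>Since \<open>A\<close> is in \<open>Finf\<close>, the product rule under
      \<open>M\<close> applies to \<open>A \<inter> b\<close> and to \<open>A\<close>; dividing by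
      \<open>measure M A\<close> gives the rule under \<open>N\<close>.\<close>
    have "measure M (A \<inter> (a \<inter> b)) = measure M a * measure M (A \<inter> b)"
      using prod[of "A \<inter> b"] A_Finf b by (simp add: Int_left_commute)
    moreover have "measure M (A \<inter> a) = measure M a * measure M A"
      using prod[of A] A_Finf by (simp add: Int_commute)
    ultimately show "measure N (a \<inter> b) = measure N a * measure N b"
      unfolding N_def using i(2) by (simp add: measure_uniform[OF A i(2)])
  qed
  then show ?thesis
    using stable_X stable_V unfolding converges_mixing_def N_def[symmetric] X_def[abs_def] V_def[abs_def] Y_def[abs_def]
    by blast
qed

end
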